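(* Let $n\ge 1$, let $m$ be a tempered weight on $\mathbb{R}^{2n}$ and let $a\in S^m_0(\mathbb{R}^n_x\times\mathbb{R}^n_\theta)$. Let $S:\mathbb{R}^n_x\times\mathbb{R}^n_\theta\to\mathbb{R}$ satisfy: (G1) $S\in C^\infty(\mathbb{R}^n_x\times\mathbb{R}^n_\theta,\mathbb{R})$; (G2) there is $\delta_0>0$ such that $\inf_{x,\theta\in\mathbb{R}^n}\left|\det\frac{\partial^2 S}{\partial x\,\partial\theta}(x,\theta)\right|\ge\delta_0$; (G3) for all $(\alpha,\beta)\in\mathbb{N}^n\times\mathbb{N}^n$ there is $C_{\alpha,\beta}>0$ such that $|\partial_x^\alpha\partial_\theta^\beta S(x,\theta)|\le C_{\alpha,\beta}\,\lambda(x,\theta)^{2-|\alpha|-|\beta|}$ for all $(x,\theta)$. Let $F$ be the integral operator with distribution kernel $$K(x,y)=\int_{\mathbb{R}^n}e^{i(S(x,\theta)-y\cdot\theta)}a(x,\theta)\,\widehat{d\theta},\qquad \widehat{d\theta}=(2\pi)^{-n}d\theta .$$ Then: 1. If $m$ is bounded, $F$ can be extended to a bounded linear operator on $L^2(\mathbb{R}^n)$. 2. If $\lim_{|x|+|\theta|\to\infty}m(x,\theta)=0$, $F$ can be extended to a compact operator on $L^2(\mathbb{R}^n)$.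
   Context: Notation: $\lambda(z)=1+|z|$ for $z$ in a Euclidean space; $\lambda(x,\theta)$ means $\lambda$ of the vector $(x,\theta)\in\mathbb{R}^{2n}$. A tempered weight on $\mathbb{R}^d$ is a continuous function $m:\mathbb{R}^d\to[0,+\infty[$ for which there exist $C_0>0$ and $l\in\mathbb{R}$ such that $m(z)\le C_0\,m(z_1)(1+|z_1-z|)^l$ for all $z,z_1\in\mathbb{R}^d$. For an open set $\Omega\subset\mathbb{R}^d$, $\rho\in[0,1]$ and a tempered weight $m$ on $\mathbb{R}^d$, $S^m_\rho(\Omega)$ is the set of $a\in C^\infty(\Omega)$ such that for every $\alpha\in\mathbb{N}^d$ there is $C_\alpha>0$ with $|\partial^\alpha a(z)|\le C_\alpha\,m(z)(1+|z|)^{-\rho|\alpha|}$ for all $z\in\Omega$. On the Schwartz space $\mathcal{S}(\mathbb{R}^n)$ the operator $F$ acts by $Fu(x)=\int_{\mathbb{R}^n}e^{iS(x,\theta)}a(x,\theta)\,\mathcal{F}u(\theta)\,\widehat{d\theta}$, where $\mathcal{F}u(\theta)=\int_{\mathbb{R}^n}e^{-iy\cdot\theta}u(y)\,dy$; the extensions are from $\mathcal{S}(\mathbb{R}^n)$ to $L^2(\mathbb{R}^n)$. *)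

theory Defs
  imports "HOL-Analysis.Analysis"
begin

section \<open>Partial derivatives and smooth functions\<close>

definition partial_deriv :: "'a::real_normed_vector \<Rightarrow> ('a \<Rightarrow> 'b::real_normed_vector) \<Rightarrow> 'a \<Rightarrow> 'b"
  where "partial_deriv b f z = vector_derivative (\<lambda>t. f (z + t *\<^sub>R b)) (at 0)"

text \<open>Multi-indices are functions \<open>\<alpha> :: 'a \<Rightarrow> nat\<close> of which only the values on \<^const>\<open>Basis\<close> matter.
  The iterated derivative needs some order of the coordinates; for smooth functions, the only
  ones to which it is applied, the choice is irrelevant.\<close>

definition basis_list :: "'a::euclidean_space list"
  where "basis_list = (SOME bs. set bs = Basis \<and> distinct bs)"

definition mderiv :: "('a::euclidean_space \<Rightarrow> nat) \<Rightarrow> ('a \<Rightarrow> 'b::real_normed_vector) \<Rightarrow> 'a \<Rightarrow> 'b"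
  where "mderiv \<alpha> f = foldr (\<lambda>b g. (partial_deriv b ^^ \<alpha> b) g) basis_list f"

definition mi_order :: "('a::euclidean_space \<Rightarrow> nat) \<Rightarrow> nat"
  where "mi_order \<alpha> = (\<Sum>b\<in>Basis. \<alpha> b)"

definition mderiv_fst ::
    "('a::euclidean_space \<Rightarrow> nat) \<Rightarrow> ('a \<times> 'b \<Rightarrow> 'c::real_normed_vector) \<Rightarrow> 'a \<times> 'b \<Rightarrow> 'c"
  where "mderiv_fst \<alpha> f = (\<lambda>(x, \<theta>). mderiv \<alpha> (\<lambda>x'. f (x', \<theta>)) x)"

definition mderiv_snd ::
    "('b::euclidean_space \<Rightarrow> nat) \<Rightarrow> ('a \<times> 'b \<Rightarrow> 'c::real_normed_vector) \<Rightarrow> 'a \<times> 'b \<Rightarrow> 'c"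
  where "mderiv_snd \<beta> f = (\<lambda>(x, \<theta>). mderiv \<beta> (\<lambda>\<theta>'. f (x, \<theta>')) \<theta>)"

primrec times_differentiable_on ::
    "nat \<Rightarrow> 'a::euclidean_space set \<Rightarrow> ('a \<Rightarrow> 'b::real_normed_vector) \<Rightarrow> bool"
  where
    "times_differentiable_on 0 \<Omega> f \<longleftrightarrow> continuous_on \<Omega> f"
  | "times_differentiable_on (Suc k) \<Omega> f \<longleftrightarrow>
       (\<forall>z\<in>\<Omega>. f differentiable (at z)) \<and>
       (\<forall>b\<in>Basis. times_differentiable_on k \<Omega> (partial_deriv b f))"

text \<open>\<open>C\<^sup>\<infinity>(\<Omega>)\<close>, for open \<open>\<Omega>\<close>.\<close>

definition smooth_on :: "'a::euclidean_space set \<Rightarrow> ('a \<Rightarrow> 'b::real_normed_vector) \<Rightarrow> bool"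
  where "smooth_on \<Omega> f \<longleftrightarrow> (\<forall>k. times_differentiable_on k \<Omega> f)"


section \<open>Weights and symbols\<close>

definition lam :: "'a::real_normed_vector \<Rightarrow> real"
  where "lam z = 1 + norm z"

definition tempered_weight :: "('a::euclidean_space \<Rightarrow> real) \<Rightarrow> bool"
  where "tempered_weight m \<longleftrightarrow>
    continuous_on UNIV m \<and> (\<forall>z. 0 \<le> m z) \<and>
    (\<exists>C>0. \<exists>l::real. \<forall>z z1. m z \<le> C * m z1 * (1 + norm (z1 - z)) powr l)"

definition symbol_class :: "('a::euclidean_space \<Rightarrow> real) \<Rightarrow> real \<Rightarrow> 'a set \<Rightarrow> ('a \<Rightarrow> complex) set"
  where "symbol_class m \<rho> \<Omega> =
    {a. smooth_on \<Omega> a \<and>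
        (\<forall>\<alpha>. \<exists>C>0. \<forall>z\<in>\<Omega>. norm (mderiv \<alpha> a z) \<le> C * m z * lam z powr (- \<rho> * real (mi_order \<alpha>)))}"

definition mixed_hessian :: "((real^'n) \<times> (real^'n) \<Rightarrow> real) \<Rightarrow> (real^'n) \<times> (real^'n) \<Rightarrow> real^'n^'n"
  where "mixed_hessian S z =
    (\<chi> i j. partial_deriv (axis i 1, 0) (partial_deriv (0, axis j 1) S) z)"


section \<open>Schwartz functions and the integral operator\<close>

definition schwartz :: "('a::euclidean_space \<Rightarrow> complex) set"
  where "schwartz =
    {u. smooth_on UNIV u \<and> (\<forall>k::nat. \<forall>\<alpha>. \<exists>C. \<forall>x. lam x ^ k * norm (mderiv \<alpha> u x) \<le> C)}"

definition fourier :: "('a::euclidean_space \<Rightarrow> complex) \<Rightarrow> 'a \<Rightarrow> complex"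
  where "fourier u \<theta> = (LINT y|lebesgue. exp (- \<i> * of_real (y \<bullet> \<theta>)) * u y)"

text \<open>The factor in front of the integral is the normalisation of
  \<open>(2\<pi>)\<^sup>-\<^sup>n d\<theta>\<close>.\<close>

definition fourier_integral_op ::
    "('a::euclidean_space \<times> 'a \<Rightarrow> real) \<Rightarrow> ('a \<times> 'a \<Rightarrow> complex) \<Rightarrow> ('a \<Rightarrow> complex) \<Rightarrow> 'a \<Rightarrow> complex"
  where "fourier_integral_op S a u x =
    (1 / (2 * pi) ^ DIM('a)) *\<^sub>R
      (LINT \<theta>|lebesgue. exp (\<i> * of_real (S (x, \<theta>))) * a (x, \<theta>) * fourier u \<theta>)"


section \<open>The space of square integrable functions\<close>

definition square_integrable :: "('a::euclidean_space \<Rightarrow> complex) \<Rightarrow> bool"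
  where "square_integrable f \<longleftrightarrow>
    f \<in> borel_measurable lebesgue \<and> integrable lebesgue (\<lambda>x. (norm (f x))\<^sup>2)"

definition l2norm :: "('a::euclidean_space \<Rightarrow> complex) \<Rightarrow> real"
  where "l2norm f = sqrt (LINT x|lebesgue. (norm (f x))\<^sup>2)"

lemma square_integrable_zero: "square_integrable (\<lambda>x. 0)"
  by (simp add: square_integrable_def)

lemma square_integrable_cmult:
  assumes "square_integrable f"
  shows "square_integrable (\<lambda>x. c * f x)"
  using assms by (auto simp: square_integrable_def norm_mult power_mult_distrib)

lemma square_integrable_add:
  fixes f g :: "'a::euclidean_space \<Rightarrow> complex"
  assumes "square_integrable f" "square_integrable g"
  shows "square_integrable (\<lambda>x. f x + g x)"
proof -
  have [measurable]: "f \<in> borel_measurable lebesgue" "g \<in> borel_measurable lebesgue"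
    using assms by (auto simp: square_integrable_def)
  have int: "integrable lebesgue (\<lambda>x. 2 * (norm (f x))\<^sup>2 + 2 * (norm (g x))\<^sup>2)"
    using assms by (auto simp: square_integrable_def)
  have le: "(norm (f x + g x))\<^sup>2 \<le> 2 * (norm (f x))\<^sup>2 + 2 * (norm (g x))\<^sup>2" for x
  proof -
    have "(norm (f x + g x))\<^sup>2 \<le> (norm (f x) + norm (g x))\<^sup>2"
      by (intro power_mono norm_triangle_ineq norm_ge_zero)
    also have "\<dots> \<le> 2 * (norm (f x))\<^sup>2 + 2 * (norm (g x))\<^sup>2"
      using sum_squares_bound[of "norm (f x)" "norm (g x)"] by (simp add: power2_sum)
    finally show ?thesis .
  qed
  have "integrable lebesgue (\<lambda>x. (norm (f x + g x))\<^sup>2)"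
    by (rule Bochner_Integration.integrable_bound[OF int]) (use le in simp_all)
  then show ?thesis by (simp add: square_integrable_def)
qed

lemma l2norm_nonneg: "0 \<le> l2norm f"
  by (simp add: l2norm_def)

lemma l2norm_cmult: "l2norm (\<lambda>x. c * f x) = norm c * l2norm f"
  by (simp add: l2norm_def norm_mult power_mult_distrib real_sqrt_mult)

lemma l2norm_cong_AE:
  assumes "square_integrable f" "square_integrable g" "AE x in lebesgue. f x = g x"
  shows "l2norm f = l2norm g"
proof -
  have "(LINT x|lebesgue. (norm (f x))\<^sup>2) = (LINT x|lebesgue. (norm (g x))\<^sup>2)"
  proof (rule integral_cong_AE)
    show "AE x in lebesgue. (norm (f x))\<^sup>2 = (norm (g x))\<^sup>2"
      using assms(3) by eventually_elim simp
  qed (use assms in \<open>auto simp: square_integrable_def\<close>)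
  then show ?thesis by (simp add: l2norm_def)
qed

lemma l2norm_eq_0_iff:
  assumes "square_integrable f"
  shows "l2norm f = 0 \<longleftrightarrow> (AE x in lebesgue. f x = 0)"
  using assms integral_nonneg_eq_0_iff_AE[of lebesgue "\<lambda>x. (norm (f x))\<^sup>2"]
  by (simp add: square_integrable_def l2norm_def)

lemma square_add_le:
  fixes s p q :: real
  assumes "s > 0"
  shows "(p + q)\<^sup>2 \<le> (1 + s) * p\<^sup>2 + (1 + 1 / s) * q\<^sup>2"
proof -
  have "(s * p - q)\<^sup>2 / s = (1 + s) * p\<^sup>2 + (1 + 1 / s) * q\<^sup>2 - (p + q)\<^sup>2"
    using assms by (simp add: power2_eq_square field_simps)
  moreover have "0 \<le> (s * p - q)\<^sup>2 / s"
    using assms by (intro divide_nonneg_pos zero_le_power2)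
  ultimately show ?thesis by linarith
qed

lemma l2norm_triangle:
  fixes f g :: "'a::euclidean_space \<Rightarrow> complex"
  assumes f: "square_integrable f" and g: "square_integrable g"
  shows "l2norm (\<lambda>x. f x + g x) \<le> l2norm f + l2norm g"
proof -
  let ?A = "l2norm f" and ?B = "l2norm g"
  have fg: "square_integrable (\<lambda>x. f x + g x)"
    by (rule square_integrable_add[OF f g])
  have sq: "(LINT x|lebesgue. (norm (h x))\<^sup>2) = (l2norm h)\<^sup>2"
    for h :: "'a \<Rightarrow> complex" by (simp add: l2norm_def)
  consider "?A = 0" | "?B = 0" | "?A > 0" "?B > 0"
    using l2norm_nonneg[of f] l2norm_nonneg[of g] by linarith
  then show ?thesis
  proof cases
    case 1
    then have "AE x in lebesgue. f x + g x = g x"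
      unfolding l2norm_eq_0_iff[OF f] by eventually_elim simp
    then show ?thesis using l2norm_cong_AE[OF fg g] 1 by simp
  next
    case 2
    then have "AE x in lebesgue. f x + g x = f x"
      unfolding l2norm_eq_0_iff[OF g] by eventually_elim simp
    then show ?thesis using l2norm_cong_AE[OF fg f] 2 by simp
  next
    case 3
    define s where "s = ?B / ?A"
    have s: "s > 0" and B: "?B = s * ?A" using 3 by (simp_all add: s_def)
    have pointwise: "(norm (f x + g x))\<^sup>2 \<le> (1 + s) * (norm (f x))\<^sup>2 + (1 + 1 / s) * (norm (g x))\<^sup>2" for x
    proof -
      let ?p = "norm (f x)" and ?q = "norm (g x)"
      have "(?p + ?q)\<^sup>2 \<le> (1 + s) * ?p\<^sup>2 + (1 + 1 / s) * ?q\<^sup>2"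
        by (rule square_add_le[OF s])
      moreover have "(norm (f x + g x))\<^sup>2 \<le> (?p + ?q)\<^sup>2"
        by (intro power_mono norm_triangle_ineq norm_ge_zero)
      ultimately show ?thesis by linarith
    qed
    have "(l2norm (\<lambda>x. f x + g x))\<^sup>2
        \<le> (LINT x|lebesgue. (1 + s) * (norm (f x))\<^sup>2 + (1 + 1 / s) * (norm (g x))\<^sup>2)"
      unfolding sq[symmetric] using f g fg
      by (intro integral_mono pointwise) (auto simp: square_integrable_def)
    also have "\<dots> = (1 + s) * ?A\<^sup>2 + (1 + 1 / s) * ?B\<^sup>2"
      using f g by (simp add: square_integrable_def sq)
    also have "\<dots> = (?A + ?B)\<^sup>2"
      unfolding B using s by (simp add: power2_eq_square algebra_simps)
    finally show ?thesis
      by (rule power2_le_imp_le) (intro add_nonneg_nonneg l2norm_nonneg)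
  qed
qed

definition l2rel :: "('a::euclidean_space \<Rightarrow> complex) \<Rightarrow> ('a \<Rightarrow> complex) \<Rightarrow> bool"
  where "l2rel f g \<longleftrightarrow> square_integrable f \<and> square_integrable g \<and> (AE x in lebesgue. f x = g x)"

lemma l2rel_part_equivp: "part_equivp l2rel"
proof (rule part_equivpI)
  show "\<exists>f. l2rel f f"
    using square_integrable_zero by (auto simp: l2rel_def)
  show "symp l2rel"
    by (simp add: symp_def l2rel_def eq_commute)
  show "transp l2rel"
  proof (rule transpI)
    fix f g h
    assume fg: "l2rel f g" and gh: "l2rel g h"
    from fg gh have "AE x in lebesgue. f x = g x" "AE x in lebesgue. g x = h x"
      by (simp_all add: l2rel_def)
    then have "AE x in lebesgue. f x = h x"
      by eventually_elim simp
    with fg gh show "l2rel f h" by (simp add: l2rel_def)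
  qed
qed

quotient_type (overloaded) 'a L2 = "'a::euclidean_space \<Rightarrow> complex" / partial: l2rel
  morphisms rep_L2 L2_class
  by (rule l2rel_part_equivp)

lift_definition scaleC_L2 :: "complex \<Rightarrow> 'a::euclidean_space L2 \<Rightarrow> 'a L2"
  is "\<lambda>c f x. c * f x"
  unfolding l2rel_def by (intro conjI square_integrable_cmult) auto

instantiation L2 :: (euclidean_space) real_normed_vector
begin

lift_definition zero_L2 :: "'a L2" is "\<lambda>x. 0"
  by (simp add: l2rel_def square_integrable_zero)

lift_definition plus_L2 :: "'a L2 \<Rightarrow> 'a L2 \<Rightarrow> 'a L2" is "\<lambda>f g x. f x + g x"
proof -
  fix f f' g g' :: "'a \<Rightarrow> complex"
  assume "l2rel f f'" "l2rel g g'"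
  then have "AE x in lebesgue. f x = f' x" "AE x in lebesgue. g x = g' x"
    by (simp_all add: l2rel_def)
  then have "AE x in lebesgue. f x + g x = f' x + g' x"
    by eventually_elim simp
  with \<open>l2rel f f'\<close> \<open>l2rel g g'\<close> show "l2rel (\<lambda>x. f x + g x) (\<lambda>x. f' x + g' x)"
    by (simp add: l2rel_def square_integrable_add)
qed

definition uminus_L2 :: "'a L2 \<Rightarrow> 'a L2" where "- f = scaleC_L2 (- 1) f"

definition minus_L2 :: "'a L2 \<Rightarrow> 'a L2 \<Rightarrow> 'a L2" where "f - g = f + - g" for f g :: "'a L2"

definition scaleR_L2 :: "real \<Rightarrow> 'a L2 \<Rightarrow> 'a L2" where "r *\<^sub>R f = scaleC_L2 (of_real r) f"

lift_definition norm_L2 :: "'a L2 \<Rightarrow> real" is l2norm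
  by (auto simp: l2rel_def intro: l2norm_cong_AE)

definition sgn_L2 :: "'a L2 \<Rightarrow> 'a L2" where "sgn f = inverse (norm f) *\<^sub>R f" for f :: "'a L2"

definition dist_L2 :: "'a L2 \<Rightarrow> 'a L2 \<Rightarrow> real" where "dist f g = norm (f - g)" for f g :: "'a L2"

definition uniformity_L2 :: "('a L2 \<times> 'a L2) filter"
  where "uniformity_L2 = (INF e\<in>{0<..}. principal {(f :: 'a L2, g). dist f g < e})"

definition open_L2 :: "'a L2 set \<Rightarrow> bool"
  where "open U = (\<forall>f\<in>U. \<forall>\<^sub>F (f', g) in uniformity. f' = f \<longrightarrow> g \<in> U)" for U :: "'a L2 set"

instance
proof
  fix f g h :: "'a L2" and r s :: real
  show "f + g + h = f + (g + h)"
    by transfer (simp add: l2rel_def add.assoc square_integrable_add)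
  show "f + g = g + f"
    by transfer (simp add: l2rel_def add.commute square_integrable_add)
  show "0 + f = f"
    by transfer (auto simp: l2rel_def)
  show "- f + f = 0"
    unfolding uminus_L2_def by transfer (auto simp: l2rel_def square_integrable_zero)
  show "f - g = f + - g"
    by (rule minus_L2_def)
  show "r *\<^sub>R (f + g) = r *\<^sub>R f + r *\<^sub>R g"
    unfolding scaleR_L2_def
    by transfer (simp add: l2rel_def ring_distribs square_integrable_add square_integrable_cmult)
  show "(r + s) *\<^sub>R f = r *\<^sub>R f + s *\<^sub>R f"
    unfolding scaleR_L2_def
    by transfer (simp add: l2rel_def ring_distribs square_integrable_add square_integrable_cmult)
  show "r *\<^sub>R s *\<^sub>R f = (r * s) *\<^sub>R f"
    unfolding scaleR_L2_def
    by transfer (simp add: l2rel_def mult.assoc square_integrable_cmult)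
  show "1 *\<^sub>R f = f"
    unfolding scaleR_L2_def by transfer (auto simp: l2rel_def)
  show "norm f = 0 \<longleftrightarrow> f = 0"
    by transfer (auto simp: l2rel_def l2norm_eq_0_iff square_integrable_zero)
  show "norm (f + g) \<le> norm f + norm g"
    by transfer (auto simp: l2rel_def intro: l2norm_triangle)
  show "norm (r *\<^sub>R f) = \<bar>r\<bar> * norm f"
    unfolding scaleR_L2_def by transfer (simp add: l2norm_cmult)
qed (rule sgn_L2_def dist_L2_def uniformity_L2_def open_L2_def)+

end

text \<open>\<^const>\<open>bounded_linear\<close> only speaks about real scalars, hence the extra clause.\<close>

definition bounded_operator :: "('a::euclidean_space L2 \<Rightarrow> 'a L2) \<Rightarrow> bool"
  where "bounded_operator T \<longleftrightarrow>
    bounded_linear T \<and> (\<forall>c f. T (scaleC_L2 c f) = scaleC_L2 c (T f))"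

definition compact_operator :: "('a::euclidean_space L2 \<Rightarrow> 'a L2) \<Rightarrow> bool"
  where "compact_operator T \<longleftrightarrow>
    bounded_operator T \<and> (\<forall>B. bounded B \<longrightarrow> compact (closure (T ` B)))"

text \<open>The values of \<^const>\<open>L2_class\<close> are meaningful on square integrable functions only, so that
  \<open>A u \<in> L\<^sup>2\<close> has to be part of the definition.\<close>

definition extends_from_schwartz ::
    "(('a::euclidean_space \<Rightarrow> complex) \<Rightarrow> 'a \<Rightarrow> complex) \<Rightarrow> ('a L2 \<Rightarrow> 'a L2) \<Rightarrow> bool"
  where "extends_from_schwartz A T \<longleftrightarrow>
    (\<forall>u\<in>schwartz. square_integrable u \<and> square_integrable (A u) \<and>
       T (L2_class u) = L2_class (A u))"

end

theory Submission
  imports Defs "HOL-Probability.Sinc_Integral"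
begin

text \<open>Cut \<open>\<real>\<^sup>n\<^sub>x\<close> and \<open>\<real>\<^sup>n\<^sub>\<theta>\<close> into unit cubes with integer corners. On the product \<open>k\<close> of two cubes write
  \<open>S(x,\<theta>) = 2\<pi>(p\<^sub>k\<cdot>x + q\<^sub>k\<cdot>\<theta>) + \<psi>\<^sub>k(x,\<theta>)\<close>, where \<open>(p\<^sub>k,q\<^sub>k)\<close> is the rounded gradient of \<open>S/2\<pi>\<close> at the corner, so that
  \<open>c\<^sub>k = e\<^bsup>i\<psi>\<^esup> a\<close> has derivatives bounded by a multiple of \<open>sup m\<close>. The bilinear form of \<open>e\<^bsup>iS\<^esup> a\<close> is the sum over \<open>k\<close>
  of the integrals of \<open>e\<^bsup>2\<pi>i(p\<cdot>x+q\<cdot>\<theta>)\<^esup> c\<^sub>k w(x) v(\<theta>)\<close>. The fundamental theorem of calculus, one coordinate at a time, writes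
  \<open>c\<^sub>k\<close> as a superposition of products of indicators in \<open>x\<close> and in \<open>\<theta>\<close>; the form is then bounded by the
  Cauchy-Schwarz inequality and Bessel's inequality on the cubes, because few cubes share a frequency:
  \<open>x \<mapsto> \<nabla>\<^sub>\<theta>S(x,\<theta>)\<close> and \<open>\<theta> \<mapsto> \<nabla>\<^sub>xS(x,\<theta>)\<close> are expansive, by (G2), (G3) and a covering space argument. Neither
  almost orthogonality nor the Calderon-Vaillancourt theorem is used, and the \<open>L\<^sup>2\<close> bound for the Fourier
  transform is the special case \<open>S = -x\<cdot>\<theta>\<close>, \<open>a = 1\<close>. If \<open>m\<close> vanishes at infinity, the cubes outside a
  large ball contribute an operator of small norm, and the rest has a continuous kernel on a compact set.\<close>

section \<open>Iterated partial derivatives\<close>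

text \<open>The obstacle is that only the derivatives of S of order at least two are bounded: the
  gradient grows, so the derivatives of e^{iS} a are not bounded uniformly over the cubes.
  Subtracting a linear phase removes the growth, and rounding its slope to 2 pi times a lattice
  vector makes the removed factor a member of the orthonormal system of the cube, as Bessel's
  inequality requires. The determinant bound by itself gives only local injectivity of the gradient
  maps, whereas the count of cubes with a common frequency has to separate points arbitrarily far
  apart; hence the passage to global expansion. F is treated as a composition T U, where U is the
  Fourier transform and T has the kernel e^{iS} a. Both kernels are bounded, so on functions that
  are integrable and square integrable all integrals converge absolutely and no oscillatory integral
  in y arises. The estimate for T is linear in the bound for the derivatives of the amplitude on the
  cubes that are kept, with a factor that depends on S only; this linearity turns decay of m into
  small operator norm.\<close>

lemma has_vector_derivative_line:
  assumes "(f has_derivative f') (at (z + t *\<^sub>R b))"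
  shows "((\<lambda>s. f (z + s *\<^sub>R b)) has_vector_derivative f' b) (at t)"
proof -
  have "((\<lambda>s. z + s *\<^sub>R b) has_derivative (\<lambda>s. s *\<^sub>R b)) (at t)"
    by (auto intro!: derivative_eq_intros)
  from has_derivative_compose[OF this assms] show ?thesis
    using linear_cmul[OF bounded_linear.linear[OF has_derivative_bounded_linear[OF assms]]]
    by (simp add: has_vector_derivative_def)
qed

lemma partial_deriv_unique: "(f has_derivative f') (at z) \<Longrightarrow> partial_deriv b f z = f' b"
  unfolding partial_deriv_def using has_vector_derivative_line[of f f' z 0 b]
  by (intro vector_derivative_at) simp

lemma has_vector_derivative_along:
  assumes "f differentiable (at (z + t *\<^sub>R b))"
  shows "((\<lambda>s. f (z + s *\<^sub>R b)) has_vector_derivative partial_deriv b f (z + t *\<^sub>R b)) (at t)"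
proof -
  obtain f' where f': "(f has_derivative f') (at (z + t *\<^sub>R b))"
    using assms by (auto simp: differentiable_def)
  show ?thesis using has_vector_derivative_line[OF f'] by (simp add: partial_deriv_unique[OF f'])
qed

lemma frechet_derivative_eq_sum_partial:
  fixes f :: "'a::euclidean_space \<Rightarrow> 'b::real_normed_vector"
  assumes "f differentiable (at z)"
  shows "(f has_derivative (\<lambda>h. \<Sum>b\<in>Basis. (h \<bullet> b) *\<^sub>R partial_deriv b f z)) (at z)"
proof -
  obtain f' where f': "(f has_derivative f') (at z)"
    using assms by (auto simp: differentiable_def)
  have lin: "linear f'" using has_derivative_bounded_linear[OF f'] by (simp add: bounded_linear.linear)
  have "f' h = (\<Sum>b\<in>Basis. (h \<bullet> b) *\<^sub>R partial_deriv b f z)" for h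
  proof -
    have "f' h = f' (\<Sum>b\<in>Basis. (h \<bullet> b) *\<^sub>R b)" by (simp add: euclidean_representation)
    also have "\<dots> = (\<Sum>b\<in>Basis. (h \<bullet> b) *\<^sub>R f' b)" by (simp add: linear_sum[OF lin] linear_cmul[OF lin])
    finally show ?thesis by (simp add: partial_deriv_unique[OF f'])
  qed
  then have "f' = (\<lambda>h. \<Sum>b\<in>Basis. (h \<bullet> b) *\<^sub>R partial_deriv b f z)" by blast
  with f' show ?thesis by simp
qed

lemma smooth_on_imp_differentiable: "smooth_on UNIV f \<Longrightarrow> f differentiable (at z)"
  unfolding smooth_on_def by (metis UNIV_I times_differentiable_on.simps(2))

lemma smooth_on_imp_continuous: "smooth_on \<Omega> f \<Longrightarrow> continuous_on \<Omega> f"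
  unfolding smooth_on_def by (metis times_differentiable_on.simps(1))

lemma smooth_on_partial_deriv: "smooth_on \<Omega> f \<Longrightarrow> b \<in> Basis \<Longrightarrow> smooth_on \<Omega> (partial_deriv b f)"
  unfolding smooth_on_def by (metis times_differentiable_on.simps(2))

lemma differentiable_bounded_linear:
  "bounded_linear L \<Longrightarrow> f differentiable F \<Longrightarrow> (\<lambda>z. L (f z)) differentiable F"
  unfolding differentiable_def by (metis bounded_linear.has_derivative)

lemma partial_deriv_bounded_linear:
  assumes "bounded_linear L" "f differentiable (at z)"
  shows "partial_deriv b (\<lambda>z. L (f z)) z = L (partial_deriv b f z)"
proof -
  obtain f' where f': "(f has_derivative f') (at z)"
    using assms by (auto simp: differentiable_def)
  show ?thesis
    using partial_deriv_unique[OF f'] partial_deriv_unique[OF bounded_linear.has_derivative[OF assms(1) f']] by simp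
qed

lemma times_differentiable_on_bounded_linear:
  assumes "bounded_linear L" "times_differentiable_on k UNIV f"
  shows "times_differentiable_on k UNIV (\<lambda>z. L (f z))"
  using assms(2)
proof (induction k arbitrary: f)
  case 0
  then show ?case using bounded_linear.continuous_on[OF assms(1)] by auto
next
  case (Suc k)
  have "(\<lambda>z. L (f z)) differentiable (at z)" for z
    using Suc.prems by (intro differentiable_bounded_linear[OF assms(1)]) simp
  moreover have "partial_deriv b (\<lambda>z. L (f z)) = (\<lambda>z. L (partial_deriv b f z))" for b
    using Suc.prems by (intro ext partial_deriv_bounded_linear[OF assms(1)]) simp
  ultimately show ?case using Suc by simp
qed

lemma smooth_on_bounded_linear: "bounded_linear L \<Longrightarrow> smooth_on UNIV f \<Longrightarrow> smooth_on UNIV (\<lambda>z. L (f z))"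
  by (simp add: smooth_on_def times_differentiable_on_bounded_linear)

text \<open>The mean value theorem is applied twice: in direction b to the increment of f in
  direction c, then in direction c to the partial derivative so obtained. The second difference on
  the left is symmetric in b and c, which the next lemma exploits.\<close>

lemma second_difference_mvt:
  fixes f :: "'a::euclidean_space \<Rightarrow> real"
  assumes f: "smooth_on UNIV f" and b: "b \<in> Basis" and h: "h > 0"
  obtains s t where "0 < s" "s < h" "0 < t" "t < h"
    "f (z + h *\<^sub>R b + h *\<^sub>R c) - f (z + h *\<^sub>R b) - f (z + h *\<^sub>R c) + f z
       = h * (h * partial_deriv c (partial_deriv b f) (z + s *\<^sub>R b + t *\<^sub>R c))"
proof -
  define g where "g s = f ((z + h *\<^sub>R c) + s *\<^sub>R b) - f (z + s *\<^sub>R b)" for s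
  have "(g has_real_derivative (partial_deriv b f ((z + h *\<^sub>R c) + s *\<^sub>R b) - partial_deriv b f (z + s *\<^sub>R b))) (at s)" for s
    unfolding g_def has_real_derivative_iff_has_vector_derivative
    by (intro has_vector_derivative_diff has_vector_derivative_along smooth_on_imp_differentiable f)
  from MVT2[OF h this] obtain s where s: "0 < s" "s < h"
    "g h - g 0 = h * (partial_deriv b f ((z + h *\<^sub>R c) + s *\<^sub>R b) - partial_deriv b f (z + s *\<^sub>R b))"
    by auto
  have "((\<lambda>t. partial_deriv b f ((z + s *\<^sub>R b) + t *\<^sub>R c)) has_real_derivative
      partial_deriv c (partial_deriv b f) ((z + s *\<^sub>R b) + t *\<^sub>R c)) (at t)" for t
    unfolding has_real_derivative_iff_has_vector_derivative
    by (intro has_vector_derivative_along smooth_on_imp_differentiable smooth_on_partial_deriv f b)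
  from MVT2[OF h this] obtain t where t: "0 < t" "t < h"
    "partial_deriv b f ((z + s *\<^sub>R b) + h *\<^sub>R c) - partial_deriv b f ((z + s *\<^sub>R b) + 0 *\<^sub>R c)
      = h * partial_deriv c (partial_deriv b f) ((z + s *\<^sub>R b) + t *\<^sub>R c)"
    by auto
  have "g h - g 0 = h * (h * partial_deriv c (partial_deriv b f) (z + s *\<^sub>R b + t *\<^sub>R c))"
    using s(3) t(3) by (simp add: algebra_simps)
  then show thesis
    using that[OF s(1,2) t(1,2)] by (simp add: g_def algebra_simps)
qed

text \<open>Both mixed derivatives take, at points near z, the value of the same symmetric second
  difference divided by the square of h; continuity at z then rules out different values at
  z.\<close>

lemma partial_deriv_commute_real:
  fixes f :: "'a::euclidean_space \<Rightarrow> real"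
  assumes f: "smooth_on UNIV f" and b: "b \<in> Basis" and c: "c \<in> Basis"
  shows "partial_deriv b (partial_deriv c f) z = partial_deriv c (partial_deriv b f) z"
proof (rule ccontr)
  define G where "G = partial_deriv b (partial_deriv c f)"
  define H where "H = partial_deriv c (partial_deriv b f)"
  assume "partial_deriv b (partial_deriv c f) z \<noteq> partial_deriv c (partial_deriv b f) z"
  then have e: "dist (G z) (H z) / 2 > 0" (is "?e > 0") by (simp add: G_def H_def)
  have cont: "continuous_on UNIV G" "continuous_on UNIV H"
    unfolding G_def H_def by (intro smooth_on_imp_continuous smooth_on_partial_deriv f b c)+
  obtain d1 where d1: "d1 > 0" "\<And>w. dist w z < d1 \<Longrightarrow> dist (G w) (G z) < ?e"
    using cont(1) e unfolding continuous_on_iff by (metis UNIV_I)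
  obtain d2 where d2: "d2 > 0" "\<And>w. dist w z < d2 \<Longrightarrow> dist (H w) (H z) < ?e"
    using cont(2) e unfolding continuous_on_iff by (metis UNIV_I)
  \<comment> \<open>Two displacements are added, each shorter than h, so h is half of the admissible
    radius.\<close>
  define h where "h = min d1 d2 / 2"
  have h: "h > 0" using d1 d2 by (simp add: h_def)
  have small: "dist (z + s *\<^sub>R u + t *\<^sub>R v) z < min d1 d2"
    if "0 < s" "s < h" "0 < t" "t < h" "u \<in> Basis" "v \<in> Basis" for s t and u v :: 'a
  proof -
    have "dist (z + s *\<^sub>R u + t *\<^sub>R v) z = norm (s *\<^sub>R u + t *\<^sub>R v)" by (simp add: dist_norm)
    also have "\<dots> \<le> s + t" using that by (intro order_trans[OF norm_triangle_ineq]) simp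
    also have "\<dots> < min d1 d2" using that unfolding h_def by linarith
    finally show ?thesis .
  qed
  obtain s t where st: "0 < s" "s < h" "0 < t" "t < h"
    "f (z + h *\<^sub>R b + h *\<^sub>R c) - f (z + h *\<^sub>R b) - f (z + h *\<^sub>R c) + f z = h * (h * H (z + s *\<^sub>R b + t *\<^sub>R c))"
    using second_difference_mvt[OF f b h] unfolding H_def by metis
  obtain s' t' where st': "0 < s'" "s' < h" "0 < t'" "t' < h"
    "f (z + h *\<^sub>R c + h *\<^sub>R b) - f (z + h *\<^sub>R c) - f (z + h *\<^sub>R b) + f z = h * (h * G (z + s' *\<^sub>R c + t' *\<^sub>R b))"
    using second_difference_mvt[OF f c h] unfolding G_def by metis
  have "h * (h * H (z + s *\<^sub>R b + t *\<^sub>R c)) = h * (h * G (z + s' *\<^sub>R c + t' *\<^sub>R b))"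
    using st(5) st'(5) by (simp add: algebra_simps)
  then have eq: "H (z + s *\<^sub>R b + t *\<^sub>R c) = G (z + s' *\<^sub>R c + t' *\<^sub>R b)" using h by simp
  have "dist (H (z + s *\<^sub>R b + t *\<^sub>R c)) (H z) < ?e" "dist (G (z + s' *\<^sub>R c + t' *\<^sub>R b)) (G z) < ?e"
    using d1(2) d2(2) small[OF st(1-4) b c] small[OF st'(1-4) c b] by auto
  then have "dist (G z) (H z) < ?e + ?e"
    unfolding eq by (metis add_strict_mono dist_commute dist_triangle_less_add)
  then show False by simp
qed

text \<open>The mean value equation holds for real-valued functions, so the values are tested
  against basis vectors of the target.\<close>

lemma partial_deriv_commute:
  fixes f :: "'a::euclidean_space \<Rightarrow> 'b::euclidean_space"
  assumes f: "smooth_on UNIV f" and b: "b \<in> Basis" and c: "c \<in> Basis"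
  shows "partial_deriv b (partial_deriv c f) = partial_deriv c (partial_deriv b f)"
proof (rule ext, rule euclidean_eqI)
  fix z and e :: 'b
  have bl: "bounded_linear (\<lambda>x::'b. x \<bullet> e)" by (rule bounded_linear_inner_left)
  have *: "partial_deriv b' (partial_deriv c' f) z \<bullet> e = partial_deriv b' (partial_deriv c' (\<lambda>z. f z \<bullet> e)) z"
    if "c' \<in> Basis" for b' c'
  proof -
    have "partial_deriv c' (\<lambda>z. f z \<bullet> e) = (\<lambda>z. partial_deriv c' f z \<bullet> e)"
      by (intro ext partial_deriv_bounded_linear[OF bl] smooth_on_imp_differentiable f)
    then show ?thesis
      using partial_deriv_bounded_linear[OF bl smooth_on_imp_differentiable[OF smooth_on_partial_deriv[OF f that]]]
      by simp
  qed
  show "partial_deriv b (partial_deriv c f) z \<bullet> e = partial_deriv c (partial_deriv b f) z \<bullet> e"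
    using partial_deriv_commute_real[OF smooth_on_bounded_linear[OF bl f] b c, of z] unfolding *[OF b] *[OF c] .
qed

text \<open>Lists of directions suit induction on the order of differentiation and treat the
  directions of a product space alike. For smooth functions only the multiset of the list matters,
  see \<open>pds_perm\<close>.\<close>

definition pds :: "'a::real_normed_vector list \<Rightarrow> ('a \<Rightarrow> 'b::real_normed_vector) \<Rightarrow> 'a \<Rightarrow> 'b"
  where "pds ls f = foldr partial_deriv ls f"

lemma pds_simps [simp]:
  "pds [] f = f" "pds (b # ls) f = partial_deriv b (pds ls f)" "pds (ks @ ls) f = pds ks (pds ls f)"
  by (simp_all add: pds_def)

lemma smooth_on_pds: "smooth_on \<Omega> f \<Longrightarrow> set ls \<subseteq> Basis \<Longrightarrow> smooth_on \<Omega> (pds ls f)"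
  by (induction ls) (auto intro: smooth_on_partial_deriv)

lemma pds_move:
  fixes f :: "'a::euclidean_space \<Rightarrow> 'b::euclidean_space"
  assumes "smooth_on UNIV f" "b \<in> Basis" "set ks \<subseteq> Basis"
  shows "partial_deriv b (pds ks f) = pds ks (partial_deriv b f)"
  using assms(3)
proof (induction ks)
  case (Cons k ks)
  then show ?case
    using partial_deriv_commute[OF smooth_on_pds[OF assms(1)] assms(2), of ks k] by simp
qed simp

lemma pds_perm:
  fixes f :: "'a::euclidean_space \<Rightarrow> 'b::euclidean_space"
  assumes "smooth_on UNIV f" "set ls \<subseteq> Basis" "mset ls = mset ls'"
  shows "pds ls f = pds ls' f"
  using assms(2,3)
proof (induction ls arbitrary: ls')
  case (Cons b ls)
  from Cons.prems(2) have "b \<in> set ls'" by (metis list.set_intros(1) mset_eq_setD)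
  then obtain xs ys where ls': "ls' = xs @ b # ys" by (meson split_list)
  have set: "set ls' \<subseteq> Basis" using Cons.prems by (metis mset_eq_setD)
  have "mset ls = mset (xs @ ys)" "set ls \<subseteq> Basis" using Cons.prems ls' by auto
  then have "pds ls f = pds (xs @ ys) f" using Cons.IH by blast
  then show ?case
    using Cons.prems set pds_move[OF smooth_on_pds[OF assms(1), of ys], of b xs]
    by (auto simp: ls')
qed simp

section \<open>Multi-indices and lists of directions\<close>

lemma set_basis_list: "set (basis_list :: 'a::euclidean_space list) = Basis"
  and distinct_basis_list: "distinct (basis_list :: 'a::euclidean_space list)"
proof -
  have "\<exists>bs::'a list. set bs = Basis \<and> distinct bs" by (rule finite_distinct_list) simp
  from someI_ex[OF this] show "set (basis_list :: 'a list) = Basis" "distinct (basis_list :: 'a list)"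
    by (auto simp: basis_list_def)
qed

definition mi_list :: "('a::euclidean_space \<Rightarrow> nat) \<Rightarrow> 'a list"
  where "mi_list \<alpha> = concat (map (\<lambda>b. replicate (\<alpha> b) b) basis_list)"

lemma mderiv_eq_pds: "mderiv \<alpha> f = pds (mi_list \<alpha>) f"
proof -
  have *: "(partial_deriv b ^^ n) g = pds (replicate n b) g" for b n and g :: "'a \<Rightarrow> 'b"
    by (induction n) simp_all
  have "foldr (\<lambda>b g. (partial_deriv b ^^ \<alpha> b) g) bs f = pds (concat (map (\<lambda>b. replicate (\<alpha> b) b) bs)) f" for bs
    by (induction bs) (simp_all add: *)
  then show ?thesis by (simp add: mderiv_def mi_list_def)
qed

lemma mset_mi_list_count:
  assumes "set ls \<subseteq> (Basis :: 'a::euclidean_space set)"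
  shows "mset (mi_list (count_list ls)) = mset ls"
proof (rule multiset_eqI)
  fix x :: 'a
  have *: "count (mset (concat (map (\<lambda>b. replicate (\<alpha> b) b) bs))) x = (if x \<in> set bs then \<alpha> x else 0)"
    if "distinct bs" for \<alpha> and bs :: "'a list"
    using that by (induction bs) auto
  show "count (mset (mi_list (count_list ls))) x = count (mset ls) x"
    using assms unfolding mi_list_def *[OF distinct_basis_list]
    by (auto simp: set_basis_list count_mset count_list_0_iff)
qed

lemma mi_order_count_list: "set ls \<subseteq> Basis \<Longrightarrow> mi_order (count_list ls) = length ls"
  by (simp add: mi_order_def sum_count_set)

text \<open>\<open>count_list ls\<close> is the multi-index that counts the occurrences of each
  direction, and symmetry of the derivatives makes the order of the list immaterial. Through this
  equation the symbol and Schwartz estimates reach all lists.\<close>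

lemma pds_eq_mderiv:
  fixes f :: "'a::euclidean_space \<Rightarrow> 'b::euclidean_space"
  assumes "smooth_on UNIV f" "set ls \<subseteq> Basis"
  shows "pds ls f = mderiv (count_list ls) f"
  unfolding mderiv_eq_pds using assms by (intro pds_perm) (simp_all add: mset_mi_list_count)

lemma pds_fst: "pds ls (\<lambda>x'. f (x', \<theta>)) x = pds (map (\<lambda>b. (b, 0)) ls) f (x, \<theta>)"
  by (induction ls arbitrary: x) (simp_all add: partial_deriv_def)

lemma pds_snd: "pds ls (\<lambda>\<theta>'. f (x, \<theta>')) \<theta> = pds (map (\<lambda>b. (0, b)) ls) f (x, \<theta>)"
  by (induction ls arbitrary: \<theta>) (simp_all add: partial_deriv_def)

lemma mderiv_fst_snd_eq_pds:
  "mderiv_fst \<alpha> (mderiv_snd \<beta> f)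
     = pds (map (\<lambda>b. (b, 0)) (mi_list \<alpha>) @ map (\<lambda>b. (0, b)) (mi_list \<beta>)) f"
  by (auto simp: mderiv_fst_def mderiv_snd_def mderiv_eq_pds pds_fst pds_snd fun_eq_iff)

lemma Basis_prod_list_split:
  assumes "set ls \<subseteq> (Basis :: ('a::euclidean_space \<times> 'b::euclidean_space) set)"
  obtains l1 l2 where "set l1 \<subseteq> Basis" "set l2 \<subseteq> Basis" "length ls = length l1 + length l2"
    "mset ls = mset (map (\<lambda>b. (b, 0)) l1 @ map (\<lambda>b. (0, b)) l2)"
proof -
  have "\<exists>l1 l2. set l1 \<subseteq> Basis \<and> set l2 \<subseteq> Basis \<and> length ls = length l1 + length l2 \<and>
      mset ls = mset (map (\<lambda>b. (b, 0)) l1 @ map (\<lambda>b. (0, b)) l2)"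
    using assms
  proof (induction ls)
    case Nil
    show ?case by (intro exI[of _ "[]"]) simp
  next
    case (Cons b ls)
    then obtain l1 l2 where l: "set l1 \<subseteq> Basis" "set l2 \<subseteq> Basis" "length ls = length l1 + length l2"
      "mset ls = mset (map (\<lambda>b. (b, 0)) l1 @ map (\<lambda>b. (0, b)) l2)" by auto
    from Cons.prems consider u where "u \<in> Basis" "b = (u, 0)" | v where "v \<in> Basis" "b = (0, v)"
      by (auto simp: Basis_prod_def)
    then show ?case
    proof cases
      case 1
      with l show ?thesis by (intro exI[of _ "u # l1"] exI[of _ l2]) auto
    next
      case 2
      with l show ?thesis by (intro exI[of _ l1] exI[of _ "v # l2"]) auto
    qed
  qed
  with that show thesis by blast
qed

text \<open>Sorting the list puts the directions of the second variable innermost and those of the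
  first variable outermost, which is the form of (G3); the exponent there depends on the total order
  alone.\<close>

lemma pds_eq_mderiv_fst_snd:
  fixes f :: "'a::euclidean_space \<times> 'b::euclidean_space \<Rightarrow> 'c::euclidean_space"
  assumes "smooth_on UNIV f" "set ls \<subseteq> Basis"
  obtains \<alpha> \<beta> where "pds ls f = mderiv_fst \<alpha> (mderiv_snd \<beta> f)" "mi_order \<alpha> + mi_order \<beta> = length ls"
proof -
  from Basis_prod_list_split[OF assms(2)] obtain l1 l2 where l: "set l1 \<subseteq> Basis" "set l2 \<subseteq> Basis"
    "length ls = length l1 + length l2" "mset ls = mset (map (\<lambda>b. (b, 0)) l1 @ map (\<lambda>b. (0, b)) l2)" .
  have "pds ls f = mderiv_fst (count_list l1) (mderiv_snd (count_list l2) f)"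
    unfolding mderiv_fst_snd_eq_pds
    using assms l by (intro pds_perm) (simp_all add: mset_mi_list_count)
  moreover have "mi_order (count_list l1) + mi_order (count_list l2) = length ls"
    using l by (simp add: mi_order_count_list)
  ultimately show thesis by (rule that)
qed

section \<open>Quantitative differentiability\<close>

text \<open>Differentiability is demanded everywhere but the bounds only on K, so that closed cubes
  can be used without one-sided derivatives. M bounds each iterated derivative separately; at the
  top order continuity is asked for, enough for the fundamental theorem of calculus.\<close>

primrec deriv_bounded ::
    "nat \<Rightarrow> real \<Rightarrow> 'a::euclidean_space set \<Rightarrow> ('a \<Rightarrow> 'b::real_normed_vector) \<Rightarrow> bool"
  where
    "deriv_bounded 0 M K f \<longleftrightarrow> continuous_on UNIV f \<and> (\<forall>z\<in>K. norm (f z) \<le> M)"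
  | "deriv_bounded (Suc n) M K f \<longleftrightarrow> (\<forall>z. f differentiable (at z)) \<and> (\<forall>z\<in>K. norm (f z) \<le> M) \<and>
       (\<forall>b\<in>Basis. deriv_bounded n M K (partial_deriv b f))"

lemma deriv_bounded_SucD: "deriv_bounded (Suc n) M K f \<Longrightarrow> deriv_bounded n M K f"
proof (induction n arbitrary: f)
  case 0
  then show ?case
    by (auto simp: continuous_on_eq_continuous_at intro: differentiable_imp_continuous_within)
next
  case (Suc n)
  show ?case unfolding deriv_bounded.simps(2)[of n]
  proof (intro conjI ballI)
    fix b :: 'a assume "b \<in> Basis"
    then have "deriv_bounded (Suc n) M K (partial_deriv b f)"
      using Suc.prems unfolding deriv_bounded.simps(2)[of "Suc n"] by blast
    then show "deriv_bounded n M K (partial_deriv b f)" by (rule Suc.IH)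
  qed (use Suc.prems in simp_all)
qed

lemma deriv_bounded_le: "k \<le> n \<Longrightarrow> deriv_bounded n M K f \<Longrightarrow> deriv_bounded k M K f"
proof (induction n rule: dec_induct)
  case (step n)
  then show ?case using deriv_bounded_SucD by blast
qed

lemma deriv_bounded_imp_continuous: "deriv_bounded n M K f \<Longrightarrow> continuous_on UNIV f"
  by (cases n) (auto simp: continuous_on_eq_continuous_at intro: differentiable_imp_continuous_within)

lemma deriv_bounded_norm_le: "deriv_bounded n M K f \<Longrightarrow> z \<in> K \<Longrightarrow> norm (f z) \<le> M"
  by (cases n) auto

lemma deriv_bounded_mono:
  "deriv_bounded n M K f \<Longrightarrow> M \<le> M' \<Longrightarrow> L \<subseteq> K \<Longrightarrow> deriv_bounded n M' L f"
proof (induction n arbitrary: f)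
  case (Suc n)
  have "deriv_bounded n M' L (partial_deriv b f)" if "b \<in> Basis" for b
    by (rule Suc.IH) (use Suc.prems that in auto)
  moreover have "norm (f z) \<le> M'" if "z \<in> L" for z
    using Suc.prems(2,3) that deriv_bounded_norm_le[OF Suc.prems(1), of z] by (simp add: subset_iff)
  ultimately show ?case using Suc.prems by simp
next
  case 0
  then have "norm (f z) \<le> M'" if "z \<in> L" for z
    using 0(2,3) that deriv_bounded_norm_le[OF 0(1)] by (meson order_trans subsetD)
  then show ?case using 0 by simp
qed

lemma deriv_bounded_bounded_linear:
  assumes L: "bounded_linear L" "\<And>x. norm (L x) \<le> norm x" and f: "deriv_bounded n M K f"
  shows "deriv_bounded n M K (\<lambda>z. L (f z))"
  using f
proof (induction n arbitrary: f)
  case 0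
  then show ?case using bounded_linear.continuous_on[OF L(1)] order_trans[OF L(2)] by auto
next
  case (Suc n)
  have "(\<lambda>z. L (f z)) differentiable (at z)" for z
    using Suc.prems by (intro differentiable_bounded_linear[OF L(1)]) simp
  moreover have "partial_deriv b (\<lambda>z. L (f z)) = (\<lambda>z. L (partial_deriv b f z))" for b
    using Suc.prems by (intro ext partial_deriv_bounded_linear[OF L(1)]) simp
  ultimately show ?case using Suc order_trans[OF L(2)] by simp
qed

lemma deriv_bounded_add:
  assumes "deriv_bounded n M K f" "deriv_bounded n N K g"
  shows "deriv_bounded n (M + N) K (\<lambda>z. f z + g z)"
  using assms
proof (induction n arbitrary: f g)
  case 0
  then show ?case by (auto intro!: continuous_intros order_trans[OF norm_triangle_ineq] add_mono)
next
  case (Suc n)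
  have "partial_deriv b (\<lambda>z. f z + g z) = (\<lambda>z. partial_deriv b f z + partial_deriv b g z)" for b
  proof
    fix z
    obtain f' g' where "(f has_derivative f') (at z)" "(g has_derivative g') (at z)"
      using Suc.prems unfolding deriv_bounded.simps differentiable_def by meson
    note d = partial_deriv_unique[OF this(1)] partial_deriv_unique[OF this(2)]
      partial_deriv_unique[OF has_derivative_add[OF this]]
    show "partial_deriv b (\<lambda>z. f z + g z) z = partial_deriv b f z + partial_deriv b g z"
      by (simp add: d)
  qed
  with Suc show ?case
    by (auto intro!: differentiable_add order_trans[OF norm_triangle_ineq] add_mono)
qed

text \<open>Each differentiation splits a product into two products, hence the factor
  \<open>2 ^ n\<close>.\<close>

lemma deriv_bounded_mult:
  fixes f g :: "'a::euclidean_space \<Rightarrow> complex"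
  assumes "deriv_bounded n M K f" "deriv_bounded n N K g" "0 \<le> M" "0 \<le> N"
  shows "deriv_bounded n (2 ^ n * M * N) K (\<lambda>z. f z * g z)"
  using assms(1,2)
proof (induction n arbitrary: f g)
  case 0
  then show ?case using assms by (auto intro!: continuous_intros mult_mono simp: norm_mult)
next
  case (Suc n)
  have pd: "partial_deriv b (\<lambda>z. f z * g z) = (\<lambda>z. f z * partial_deriv b g z + partial_deriv b f z * g z)" for b
  proof
    fix z
    obtain f' g' where "(f has_derivative f') (at z)" "(g has_derivative g') (at z)"
      using Suc.prems unfolding deriv_bounded.simps differentiable_def by meson
    note d = partial_deriv_unique[OF this(1)] partial_deriv_unique[OF this(2)]
      partial_deriv_unique[OF has_derivative_mult[OF this]]
    show "partial_deriv b (\<lambda>z. f z * g z) z = f z * partial_deriv b g z + partial_deriv b f z * g z"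
      by (simp add: d)
  qed
  have le: "norm (f z * g z) \<le> 2 ^ Suc n * M * N" if "z \<in> K" for z
  proof -
    have "norm (f z * g z) \<le> M * N"
      using Suc.prems that assms by (auto intro!: mult_mono simp: norm_mult)
    also have "\<dots> \<le> 2 ^ Suc n * (M * N)"
      using assms mult_mono[of 1 "2 ^ Suc n" "M * N" "M * N"] one_le_power[of "2::real" "Suc n"] by simp
    finally show ?thesis by (simp add: mult_ac)
  qed
  have "deriv_bounded n (2 ^ n * M * N + 2 ^ n * M * N) K (\<lambda>z. f z * partial_deriv b g z + partial_deriv b f z * g z)"
    if "b \<in> Basis" for b
    using Suc.prems that deriv_bounded_SucD[OF Suc.prems(1)] deriv_bounded_SucD[OF Suc.prems(2)]
    by (intro deriv_bounded_add Suc.IH) auto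
  moreover have "2 ^ n * M * N + 2 ^ n * M * N = 2 ^ Suc n * M * N" by simp
  ultimately have "deriv_bounded n (2 ^ Suc n * M * N) K (\<lambda>z. f z * partial_deriv b g z + partial_deriv b f z * g z)"
    if "b \<in> Basis" for b
    using that by metis
  then show ?case
    using Suc.prems le by (auto intro!: differentiable_mult simp: pd simp del: power_Suc)
qed

lemma smooth_on_imp_deriv_bounded:
  assumes "smooth_on UNIV f" "\<And>ls z. set ls \<subseteq> Basis \<Longrightarrow> length ls \<le> n \<Longrightarrow> z \<in> K \<Longrightarrow> norm (pds ls f z) \<le> M"
  shows "deriv_bounded n M K f"
  using assms
proof (induction n arbitrary: f)
  case 0
  then show ?case using 0(2)[of "[]"] by (auto intro: smooth_on_imp_continuous)
next
  case (Suc n)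
  have "deriv_bounded n M K (partial_deriv b f)" if "b \<in> Basis" for b
  proof (rule Suc.IH)
    show "smooth_on UNIV (partial_deriv b f)" using Suc.prems that by (intro smooth_on_partial_deriv)
    show "norm (pds ls (partial_deriv b f) z) \<le> M" if "set ls \<subseteq> Basis" "length ls \<le> n" "z \<in> K" for ls z
      using Suc.prems(2)[of "ls @ [b]" z] that \<open>b \<in> Basis\<close> by simp
  qed
  then show ?case
    using Suc.prems(2)[of "[]"] smooth_on_imp_differentiable[OF Suc.prems(1)] by simp
qed

text \<open>The second summand is the bound that \<open>deriv_bounded_mult\<close> gives for the
  product of a derivative of the phase with the exponential; the first keeps the sequence increasing
  and above the modulus 1.\<close>

primrec exp_bound :: "real \<Rightarrow> nat \<Rightarrow> real"
  where "exp_bound L 0 = 1"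
  | "exp_bound L (Suc n) = exp_bound L n + 2 ^ n * L * exp_bound L n"

lemma exp_bound_ge_1: "0 \<le> L \<Longrightarrow> 1 \<le> exp_bound L n"
  by (induction n) (auto intro!: add_increasing2)

text \<open>Only the gradient of \<psi> has to be bounded: \<open>cis\<close> has modulus 1 whatever
  the size of the phase, and each derivative of \<open>cis (\<psi> z)\<close> is \<open>\<i>\<close>
  times a derivative of \<psi> times the exponential again. The exponential thus gains one order
  over the gradient.\<close>

lemma deriv_bounded_cis:
  fixes \<psi> :: "'a::euclidean_space \<Rightarrow> real"
  assumes L: "0 \<le> L" and diff: "\<And>z. \<psi> differentiable (at z)"
    and \<psi>: "\<And>b. b \<in> Basis \<Longrightarrow> deriv_bounded n L K (partial_deriv b \<psi>)"
  shows "deriv_bounded (Suc n) (exp_bound L (Suc n)) K (\<lambda>z. cis (\<psi> z))"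
proof -
  have d: "((\<lambda>z. cis (\<psi> z)) has_derivative (\<lambda>h. \<psi>' h *\<^sub>R (\<i> * cis (\<psi> z)))) (at z)"
    if "(\<psi> has_derivative \<psi>') (at z)" for z \<psi>'
  proof -
    have "(cis has_derivative (\<lambda>t. t *\<^sub>R (\<i> * cis (\<psi> z)))) (at (\<psi> z))"
      using has_vector_derivative_real_field[of "\<lambda>t. exp (\<i> * t)" "\<i> * exp (\<i> * \<psi> z)" "\<psi> z" UNIV]
      by (auto simp: has_vector_derivative_def cis_conv_exp intro!: derivative_eq_intros)
    from has_derivative_compose[OF that this] show ?thesis .
  qed
  have diff': "(\<lambda>z. cis (\<psi> z)) differentiable (at z)" for z
    using d diff[of z] by (auto simp: differentiable_def)
  have pd: "partial_deriv b (\<lambda>z. cis (\<psi> z)) = (\<lambda>z. (\<i> * of_real (partial_deriv b \<psi> z)) * cis (\<psi> z))" for b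
  proof
    fix z
    obtain \<psi>' where \<psi>': "(\<psi> has_derivative \<psi>') (at z)" using diff[of z] by (auto simp: differentiable_def)
    show "partial_deriv b (\<lambda>z. cis (\<psi> z)) z = (\<i> * of_real (partial_deriv b \<psi> z)) * cis (\<psi> z)"
      unfolding partial_deriv_unique[OF d[OF \<psi>']] partial_deriv_unique[OF \<psi>'] by (simp add: scaleR_conv_of_real)
  qed
  have step: "deriv_bounded (Suc k) (exp_bound L (Suc k)) K (\<lambda>z. cis (\<psi> z))"
    if k: "deriv_bounded k (exp_bound L k) K (\<lambda>z. cis (\<psi> z))"
      "\<And>b. b \<in> Basis \<Longrightarrow> deriv_bounded k L K (partial_deriv b \<psi>)" for k
  proof -
    have "deriv_bounded k (exp_bound L (Suc k)) K (partial_deriv b (\<lambda>z. cis (\<psi> z)))" if b: "b \<in> Basis" for b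
    proof -
      have "bounded_linear (\<lambda>x::real. \<i> * complex_of_real x)"
        by (rule bounded_linear_const_mult[OF bounded_linear_of_real])
      then have "deriv_bounded k L K (\<lambda>z. \<i> * of_real (partial_deriv b \<psi> z))"
        by (rule deriv_bounded_bounded_linear) (use k b in \<open>auto simp: norm_mult\<close>)
      from deriv_bounded_mult[OF this k(1)]
      have "deriv_bounded k (2 ^ k * L * exp_bound L k) K (partial_deriv b (\<lambda>z. cis (\<psi> z)))"
        unfolding pd using L exp_bound_ge_1[OF L, of k] by simp
      then show ?thesis
        by (rule deriv_bounded_mono) (use exp_bound_ge_1[OF L, of k] in auto)
    qed
    then show ?thesis
      unfolding deriv_bounded.simps(2) using diff' exp_bound_ge_1[OF L, of "Suc k"]
      by (metis norm_cis)
  qed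
  have "deriv_bounded k (exp_bound L k) K (\<lambda>z. cis (\<psi> z))" if "k \<le> Suc n" for k
    using that
  proof (induction k)
    case 0
    have "continuous_on UNIV (\<lambda>z. cis (\<psi> z))"
      by (auto simp: continuous_on_eq_continuous_at intro: differentiable_imp_continuous_within diff')
    then show ?case by simp
  next
    case (Suc k)
    have "deriv_bounded k L K (partial_deriv b \<psi>)" if "b \<in> Basis" for b
      using deriv_bounded_le[OF _ \<psi>[OF that]] Suc.prems by simp
    then show ?case using Suc by (intro step) simp_all
  qed
  from this[of "Suc n"] show ?thesis by simp
qed

section \<open>Global expansion from uniform local expansion\<close>

text \<open>A locally expanding map whose local inverses live on balls of uniform size is a covering of
  the simply connected target, hence injective, and its inverse is Lipschitz along segments.\<close>

lemma expansive_if_uniformly_locally_expansive: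
  fixes f :: "'a::euclidean_space \<Rightarrow> 'a"
  assumes cont: "continuous_on UNIV f" and \<rho>: "\<rho> > 0" and c: "c > 0"
    and loc: "\<And>x u v. u \<in> ball x \<rho> \<Longrightarrow> v \<in> ball x \<rho> \<Longrightarrow> c * dist u v \<le> dist (f u) (f v)"
  shows "c * dist x y \<le> dist (f x) (f y)"
proof -
  \<comment> \<open>Points at distance \<rho>/2 from x have images at distance at least \<sigma>
    from \<open>f x\<close>. Since f is open on small balls, the image of the closed half ball
    contains the ball of radius \<sigma>, the same for all x.\<close>
  define \<sigma> where "\<sigma> = c * (\<rho> / 2)"
  have \<sigma>: "\<sigma> > 0" using \<rho> c by (simp add: \<sigma>_def)
  have inj: "inj_on f (ball x \<rho>)" for x
  proof (rule inj_onI)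
    fix u v assume "u \<in> ball x \<rho>" "v \<in> ball x \<rho>" "f u = f v"
    then show "u = v" using loc[of u x v] c by (simp add: mult_le_0_iff)
  qed
  have openf: "open (f ` U)" if "U \<subseteq> ball x \<rho>" "open U" for U x
    by (rule invariance_of_domain) (use that inj cont in \<open>auto intro: continuous_on_subset inj_on_subset\<close>)
  have ball_im: "ball (f x) \<sigma> \<subseteq> f ` cball x (\<rho> / 2)" for x
  proof (rule ball_subset_open_map_image)
    show "continuous_on (closure (cball x (\<rho> / 2))) f" using cont continuous_on_subset by blast
    show "open (f ` interior (cball x (\<rho> / 2)))"
      by (rule openf[of _ x]) (use \<rho> in \<open>auto simp: subset_iff\<close>)
    show "\<sigma> \<le> norm (f z - f x)" if "z \<in> frontier (cball x (\<rho> / 2))" for z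
    proof -
      have "dist x z = \<rho> / 2" using that \<rho> by (simp add: frontier_cball sphere_def)
      with loc[of x x z] \<rho> show ?thesis
        unfolding \<sigma>_def by (metis dist_norm dist_commute centre_in_ball mem_ball field_sum_of_halves less_add_same_cancel1 half_gt_zero)
    qed
  qed (use \<rho> \<sigma> in auto)
  have near: "\<exists>u. dist u x < \<rho> \<and> f u = w" if "dist (f x) w < \<sigma>" for x w
  proof -
    have "w \<in> f ` cball x (\<rho> / 2)" using ball_im[of x] that by auto
    then show ?thesis using \<rho> by (force simp: dist_commute)
  qed
  \<comment> \<open>A limit point of the range is closer than \<sigma> to some value and is
    therefore a value itself: the range is open, closed and nonempty.\<close>
  have surj: "range f = UNIV"
  proof -
    have "open (range f)"
      unfolding open_contains_ball
    proof
      fix w assume "w \<in> range f"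
      then obtain x where "w = f x" by blast
      then show "\<exists>e>0. ball w e \<subseteq> range f" using ball_im[of x] \<sigma> by blast
    qed
    moreover have "closed (range f)"
      unfolding closed_limpt islimpt_approachable
    proof (intro allI impI)
      fix w assume "\<forall>e>0. \<exists>x'\<in>range f. x' \<noteq> w \<and> dist x' w < e"
      then obtain x where "dist (f x) w < \<sigma>" using \<sigma> by blast
      then show "w \<in> range f" using near by blast
    qed
    ultimately show ?thesis using clopen[of "range f"] by blast
  qed
  have cov: "covering_space UNIV f UNIV"
  proof (rule covering_spaceI)
    show "\<exists>T. w \<in> T \<and> openin (top_of_set UNIV) T \<and>
        (\<exists>v. \<Union>v = UNIV \<inter> f -` T \<and> (\<forall>u\<in>v. openin (top_of_set UNIV) u) \<and> pairwise disjnt v \<and>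
             (\<forall>u\<in>v. \<exists>q. homeomorphism u T f q))" if "w \<in> UNIV" for w
    proof (intro exI[of _ "ball w \<sigma>"] conjI)
      define U where "U x = ball x \<rho> \<inter> f -` ball w \<sigma>" for x
      have openU: "open (U x)" for x
        unfolding U_def by (intro open_Int open_ball open_vimage cont)
      have fU: "f ` U x = ball w \<sigma>" if "f x = w" for x
        using near[of x] that by (force simp: U_def dist_commute)
      show "\<exists>v. \<Union>v = UNIV \<inter> f -` ball w \<sigma> \<and> (\<forall>u\<in>v. openin (top_of_set UNIV) u) \<and>
          pairwise disjnt v \<and> (\<forall>u\<in>v. \<exists>q. homeomorphism u (ball w \<sigma>) f q)"
      proof (intro exI[of _ "U ` (f -` {w})"] conjI ballI)
        have "\<exists>x. f x = w \<and> u \<in> U x" if "f u \<in> ball w \<sigma>" for u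
          using near[of u w] that by (auto simp: U_def dist_commute)
        then have "UNIV \<inter> f -` ball w \<sigma> \<subseteq> \<Union> (U ` (f -` {w}))" by blast
        then show "\<Union> (U ` (f -` {w})) = UNIV \<inter> f -` ball w \<sigma>"
          unfolding U_def by blast
        show "openin (top_of_set UNIV) u" if "u \<in> U ` (f -` {w})" for u
          using that openU by auto
        show "pairwise disjnt (U ` (f -` {w}))"
        proof (rule pairwiseI)
          fix A B assume "A \<in> U ` (f -` {w})" "B \<in> U ` (f -` {w})" "A \<noteq> B"
          then obtain x x' where x: "f x = w" "f x' = w" "A = U x" "B = U x'" "x \<noteq> x'" by auto
          show "disjnt A B"
          proof (rule ccontr)
            assume "\<not> disjnt A B"
            then obtain u where "u \<in> A" "u \<in> B" by (auto simp: disjnt_def)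
            \<comment> \<open>A common point u of two sheets has both centres within \<rho>. There f
              is injective, yet it takes the value w at both of them.\<close>
            then have "x \<in> ball u \<rho>" "x' \<in> ball u \<rho>" using x by (auto simp: U_def dist_commute)
            then show False using inj_onD[OF inj[of u], of x x'] x by auto
          qed
        qed
        show "\<exists>q. homeomorphism u (ball w \<sigma>) f q" if u: "u \<in> U ` (f -` {w})" for u
        proof -
          obtain x where x: "f x = w" "u = U x" using u by auto
          have "inj_on f u" using inj[of x] by (rule inj_on_subset) (auto simp: x U_def)
          from invariance_of_domain_homeomorphism[OF _ _ _ this] obtain q where "homeomorphism u (f ` u) f q"
            using openU x cont continuous_on_subset by (metis subset_UNIV order_refl)
          then show ?thesis using fU x by auto
        qed
      qed
    qed (use \<sigma> in auto)
  qed (use cont surj in auto)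
  \<comment> \<open>The target is simply connected, so its identity map lifts through the covering f
    to a global right inverse.\<close>
  obtain g where g: "continuous_on UNIV g" "g (f x) = x" "\<And>w. f (g w) = w"
  proof (rule covering_space_lift_strong[OF cov, of x "f x" UNIV "\<lambda>w. w"])
    show "simply_connected (UNIV :: 'a set)" by (intro convex_imp_simply_connected convex_UNIV)
    show "locally path_connected (UNIV :: 'a set)"
      by (intro convex_imp_locally_path_connected convex_UNIV)
  qed auto
  \<comment> \<open>Both \<open>\<lambda>y. g (f y)\<close> and the identity are lifts of f, and
    they agree at x; on a connected domain they coincide.\<close>
  have gf: "g (f y) = y" for y
  proof (rule covering_space_lift_unique[OF cov, of "\<lambda>y. g (f y)" x "\<lambda>y. y" UNIV f])
    show "continuous_on UNIV (\<lambda>y. g (f y))"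
      using continuous_on_compose2[OF g(1) cont] by simp
  qed (use g cont in auto)
  have loc_lip: "c * dist (g w) (g w') \<le> dist w w'" if close: "dist w w' < \<sigma>" for w w'
  proof -
    obtain u where u: "dist u (g w) < \<rho>" "f u = w'" using near[of "g w" w'] close g(3) by metis
    have "g w' = u" using gf u(2) by metis
    then show ?thesis using loc[of "g w" "g w" u] u g(3)[of w] \<rho> by (simp add: dist_commute)
  qed
  \<comment> \<open>The segment from \<open>f x\<close> to \<open>f y\<close> is cut into N pieces
    shorter than \<sigma>; along a segment the lengths of the pieces add up exactly, so the local
    Lipschitz constant of g survives.\<close>
  obtain N :: nat where N: "dist (f x) (f y) / \<sigma> < N" using reals_Archimedean2 by blast
  then have N0: "N > 0" using \<sigma> by (metis divide_nonneg_pos gr0I less_le_not_le of_nat_0 zero_le_dist)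
  define p where "p i = f x + (real i / N) *\<^sub>R (f y - f x)" for i :: nat
  have step: "c * dist (g (p i)) (g (p (Suc i))) \<le> dist (f x) (f y) / N" for i
  proof -
    have "p i - p (Suc i) = (- 1 / N) *\<^sub>R (f y - f x)"
      by (simp add: p_def add_divide_distrib algebra_simps)
    then have "dist (p i) (p (Suc i)) = dist (f x) (f y) / N"
      by (simp add: dist_norm norm_minus_commute)
    moreover have "dist (f x) (f y) / N < \<sigma>" using N N0 \<sigma> by (simp add: field_simps)
    ultimately show ?thesis using loc_lip[of "p i" "p (Suc i)"] by simp
  qed
  have "c * dist (g (p 0)) (g (p n)) \<le> n * (dist (f x) (f y) / N)" for n
  proof (induction n)
    case (Suc n)
    have "c * dist (g (p 0)) (g (p (Suc n))) \<le> c * (dist (g (p 0)) (g (p n)) + dist (g (p n)) (g (p (Suc n))))"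
      using c by (intro mult_left_mono dist_triangle) simp
    also have "\<dots> \<le> n * (dist (f x) (f y) / N) + dist (f x) (f y) / N"
      using Suc step[of n] by (simp add: distrib_left)
    finally show ?case by (simp add: algebra_simps add_divide_distrib)
  qed simp
  from this[of N] have "c * dist (g (f x)) (g (f y)) \<le> dist (f x) (f y)"
    using N0 by (simp add: p_def)
  then show ?thesis by (simp add: g(2) gf)
qed

text \<open>The matrices with bounded entries and determinant bounded away from 0 form a compact
  set, and none of them annihilates a unit vector, so the norm of A h has a positive minimum over
  this set times the unit sphere.\<close>

lemma matrix_lower_bound:
  assumes \<delta>: "\<delta> > 0" 
  obtains \<kappa> where "\<kappa> > 0"
    "\<And>(A::real^'n^'n) h. \<delta> \<le> \<bar>det A\<bar> \<Longrightarrow> (\<And>i j. \<bar>A $ i $ j\<bar> \<le> C) \<Longrightarrow> \<kappa> * norm h \<le> norm (A *v h)"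
proof -
  define K :: "(real^'n^'n) set" where "K = {A. \<delta> \<le> \<bar>det A\<bar> \<and> (\<forall>i j. \<bar>A $ i $ j\<bar> \<le> C)}"
  have "closed K"
    unfolding K_def
    by (intro closed_Collect_conj closed_Collect_le closed_Collect_all continuous_intros)
      (auto simp: det_def intro!: continuous_intros)
  moreover have "bounded K"
  proof -
    have "norm A \<le> (\<Sum>i\<in>(UNIV::'n set). \<Sum>j\<in>(UNIV::'n set). C)" if "A \<in> K" for A
    proof -
      have "norm A \<le> (\<Sum>i\<in>UNIV. norm (A $ i))" by (simp add: norm_vec_def L2_set_le_sum)
      also have "\<dots> \<le> (\<Sum>i\<in>(UNIV::'n set). \<Sum>j\<in>UNIV. \<bar>A $ i $ j\<bar>)" by (intro sum_mono norm_le_l1_cart)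
      also have "\<dots> \<le> (\<Sum>i\<in>(UNIV::'n set). \<Sum>j\<in>(UNIV::'n set). C)" using that by (intro sum_mono) (simp add: K_def)
      finally show ?thesis .
    qed
    then show ?thesis by (auto simp: bounded_iff)
  qed
  ultimately have comp: "compact (K \<times> sphere (0::real^'n) 1)"
    by (intro compact_Times compact_sphere) (simp add: compact_eq_bounded_closed)
  have cont: "continuous_on (K \<times> sphere (0::real^'n) 1) (\<lambda>(A, h). norm (A *v h))"
    unfolding case_prod_beta matrix_vector_mult_def
    by (intro continuous_intros)
  show thesis
  proof (cases "K = {}")
    case True
    then have "\<not> (\<delta> \<le> \<bar>det A\<bar> \<and> (\<forall>i j. \<bar>A $ i $ j\<bar> \<le> C))" for A :: "real^'n^'n"
      unfolding K_def by blast
    then show thesis using that[of 1] zero_less_one by blast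
  next
    case False
    then have "K \<times> sphere (0::real^'n) 1 \<noteq> {}" by simp
    from continuous_attains_inf[OF comp this cont] obtain B k
      where Bk: "B \<in> K" "norm k = 1" "\<And>A h. A \<in> K \<Longrightarrow> norm h = 1 \<Longrightarrow> norm (B *v k) \<le> norm (A *v h)"
      by auto
    have "det B \<noteq> 0" using Bk(1) \<delta> by (auto simp: K_def)
    then have "B *v k \<noteq> 0"
      using Bk(2) by (metis invertible_det_nz invertible_eq_bij matrix_vector_mult_0_right bij_is_inj inj_eq norm_zero zero_neq_one)
    show thesis
    proof (rule that[of "norm (B *v k)"])
      fix A :: "real^'n^'n" and h :: "real^'n"
      assume A: "\<delta> \<le> \<bar>det A\<bar>" "\<And>i j. \<bar>A $ i $ j\<bar> \<le> C"
      show "norm (B *v k) * norm h \<le> norm (A *v h)"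
      proof (cases "h = 0")
        case False
        have "norm (B *v k) \<le> norm (A *v ((1 / norm h) *\<^sub>R h))"
          using A False by (intro Bk(3)) (auto simp: K_def)
        also have "\<dots> = norm (A *v h) / norm h" by (simp add: matrix_vector_mult_scaleR)
        finally show ?thesis using False by (simp add: field_simps)
      qed simp
    qed (use \<open>B *v k \<noteq> 0\<close> in simp)
  qed
qed

text \<open>The parameter p is the variable that is held fixed later. The constant is uniform in p
  because the lower bound \<kappa> and the radius \<rho> are built from \<delta>, C and L
  only.\<close>

lemma expansive_if_det_bounded_below:
  fixes J :: "'b \<Rightarrow> real^'n \<Rightarrow> real^'n^'n" and f :: "'b \<Rightarrow> real^'n \<Rightarrow> real^'n"
  assumes deriv: "\<And>p x. (f p has_derivative (\<lambda>h. J p x *v h)) (at x)"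
    and \<delta>: "\<delta> > 0" "\<And>p x. \<delta> \<le> \<bar>det (J p x)\<bar>" and C: "\<And>p x i j. \<bar>J p x $ i $ j\<bar> \<le> C"
    and L: "L > 0" "\<And>p x y h. norm ((J p x - J p y) *v h) \<le> L * dist x y * norm h"
  obtains c where "c > 0" "\<And>p x y. c * dist x y \<le> dist (f p x) (f p y)"
proof -
  obtain \<kappa> where \<kappa>: "\<kappa> > 0" "\<And>p x h. \<kappa> * norm h \<le> norm (J p x *v h)"
    using matrix_lower_bound[OF \<delta>(1), where C = C and ?'n = 'n] \<delta>(2) C by metis
  \<comment> \<open>Within this radius the derivative deviates from its value at the centre by at
    most \<kappa>/2, which leaves \<kappa>/2 of the lower bound \<kappa> for the nonlinear
    map.\<close>
  define \<rho> where "\<rho> = \<kappa> / (2 * L)"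
  have \<rho>: "\<rho> > 0" using \<kappa> L by (simp add: \<rho>_def)
  have loc: "\<kappa> / 2 * dist u v \<le> dist (f p u) (f p v)" if "u \<in> ball x \<rho>" "v \<in> ball x \<rho>" for p x u v
  proof -
    have "norm ((f p u - J p x *v u) - (f p v - J p x *v v)) \<le> \<kappa> / 2 * norm (u - v)"
    proof (rule differentiable_bound[of "ball x \<rho>" _ "\<lambda>y h. J p y *v h - J p x *v h"])
      show "((\<lambda>y. f p y - J p x *v y) has_derivative (\<lambda>h. J p y *v h - J p x *v h)) (at y within ball x \<rho>)" for y
        by (intro has_derivative_diff has_derivative_at_withinI[OF deriv] bounded_linear_imp_has_derivative
            matrix_vector_mul_bounded_linear)
      show "onorm (\<lambda>h. J p y *v h - J p x *v h) \<le> \<kappa> / 2" if "y \<in> ball x \<rho>" for y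
      proof (rule onorm_bound)
        show "norm (J p y *v h - J p x *v h) \<le> \<kappa> / 2 * norm h" for h
        proof -
          have "L * dist y x \<le> \<kappa> / 2" using that L by (simp add: \<rho>_def dist_commute field_simps)
          then have "L * dist y x * norm h \<le> \<kappa> / 2 * norm h" by (intro mult_right_mono) simp_all
          then show ?thesis using L(2)[of p y x h] by (simp add: matrix_vector_mult_diff_rdistrib)
        qed
      qed (use \<kappa> in simp)
    qed (use that in simp_all)
    then have "norm ((f p u - f p v) - J p x *v (u - v)) \<le> \<kappa> / 2 * norm (u - v)"
      by (simp add: matrix_vector_mult_diff_distrib algebra_simps)
    moreover have "norm (J p x *v (u - v)) \<le> norm (f p u - f p v) + norm ((f p u - f p v) - J p x *v (u - v))"
      by (metis norm_triangle_sub norm_minus_commute)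
    ultimately show ?thesis using \<kappa>(2)[of "u - v" p x] by (simp add: dist_norm)
  qed
  show thesis
  proof (rule that[of "\<kappa> / 2"])
    show "\<kappa> / 2 * dist x y \<le> dist (f p x) (f p y)" for p x y
    proof (rule expansive_if_uniformly_locally_expansive[OF _ \<rho> _ loc])
      show "continuous_on UNIV (f p)"
        by (intro continuous_at_imp_continuous_on ballI has_derivative_continuous[OF deriv])
    qed (use \<kappa> in auto)
  qed (use \<kappa> in simp)
qed

section \<open>Unit cubes and Bessel's inequality\<close>

definition lattice :: "'a::euclidean_space set"
  where "lattice = {x. \<forall>b\<in>Basis. x \<bullet> b \<in> \<int>}"

definition vfloor :: "'a::euclidean_space \<Rightarrow> 'a"
  where "vfloor x = (\<Sum>b\<in>Basis. of_int \<lfloor>x \<bullet> b\<rfloor> *\<^sub>R b)"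

text \<open>As fibres of \<open>vfloor\<close> the half-open cubes partition the space exactly, and
  the indicator of any union of cubes is a condition on \<open>vfloor z\<close>. For k outside the
  lattice the fibre is empty.\<close>

definition unit_cube :: "'a::euclidean_space \<Rightarrow> 'a set"
  where "unit_cube k = {x. vfloor x = k}"

lemma vfloor_inner [simp]: "b \<in> Basis \<Longrightarrow> vfloor x \<bullet> b = of_int \<lfloor>x \<bullet> b\<rfloor>"
  by (simp add: vfloor_def)

lemma vfloor_in_lattice [simp]: "vfloor x \<in> lattice"
  by (simp add: lattice_def)

lemma mem_unit_cube: "x \<in> unit_cube k \<longleftrightarrow> (\<forall>b\<in>Basis. of_int \<lfloor>x \<bullet> b\<rfloor> = k \<bullet> b)"
  unfolding unit_cube_def mem_Collect_eq euclidean_eq_iff[of "vfloor x"] by simp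

lemma vfloor_measurable [measurable]: "vfloor \<in> borel_measurable borel"
  unfolding vfloor_def by measurable

lemma unit_cube_measurable [measurable]: "unit_cube k \<in> sets borel"
  unfolding unit_cube_def by measurable

lemma vfloor_Pair: "vfloor (x, y) = (vfloor x, vfloor y)"
  by (rule euclidean_eqI) (auto simp: Basis_prod_def)

lemma lattice_Pair: "(x, y) \<in> lattice \<longleftrightarrow> x \<in> lattice \<and> y \<in> lattice"
  by (simp add: lattice_def Basis_prod_def ball_Un)

lemma lattice_diff: "x \<in> lattice \<Longrightarrow> y \<in> lattice \<Longrightarrow> x - y \<in> lattice"
  by (simp add: lattice_def inner_diff_left)

lemma finite_lattice_bounded:
  assumes "bounded (A :: 'a::euclidean_space set)"
  shows "finite (lattice \<inter> A)"
proof -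
  obtain R where R: "\<And>x. x \<in> A \<Longrightarrow> norm x \<le> R" using assms by (auto simp: bounded_iff)
  let ?G = "Basis \<rightarrow>\<^sub>E (of_int ` {- \<lceil>R\<rceil>..\<lceil>R\<rceil>} :: real set)"
  have "lattice \<inter> A \<subseteq> (\<lambda>f. \<Sum>b\<in>Basis. f b *\<^sub>R b) ` ?G"
  proof
    fix x :: 'a assume x: "x \<in> lattice \<inter> A"
    have "restrict (\<lambda>b. x \<bullet> b) Basis \<in> ?G"
    proof (rule restrict_PiE_iff[THEN iffD2], intro ballI)
      fix b :: 'a assume b: "b \<in> Basis"
      then obtain i where i: "x \<bullet> b = of_int i" using x by (auto simp: lattice_def elim: Ints_cases)
      have "\<bar>x \<bullet> b\<bar> \<le> R" using Basis_le_norm[OF b, of x] R[of x] x by simp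
      then have "i \<in> {- \<lceil>R\<rceil>..\<lceil>R\<rceil>}" unfolding i by (auto simp: abs_le_iff) linarith+
      then show "x \<bullet> b \<in> of_int ` {- \<lceil>R\<rceil>..\<lceil>R\<rceil>}" unfolding i by blast
    qed
    moreover have "x = (\<Sum>b\<in>Basis. restrict (\<lambda>b. x \<bullet> b) Basis b *\<^sub>R b)"
      by (simp add: euclidean_representation)
    ultimately show "x \<in> (\<lambda>f. \<Sum>b\<in>Basis. f b *\<^sub>R b) ` ?G" by blast
  qed
  then show ?thesis by (rule finite_subset) (intro finite_imageI finite_PiE, auto)
qed

section \<open>Orthonormality of the exponentials on a unit cube\<close>

lemma lborel_integral_prod_Basis:
  fixes h :: "'a::euclidean_space \<Rightarrow> real \<Rightarrow> 'c::{real_normed_field, banach, second_countable_topology}"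
  assumes h: "\<And>b. b \<in> Basis \<Longrightarrow> integrable lborel (h b)"
  shows "integrable lborel (\<lambda>x. \<Prod>b\<in>Basis. h b (x \<bullet> b))" (is "?I")
    and "(LINT x|lborel. (\<Prod>b\<in>Basis. h b (x \<bullet> b))) = (\<Prod>b\<in>Basis. LINT t|lborel. h b t)" (is ?E)
proof -
  interpret product_sigma_finite "\<lambda>_::'a. lborel :: real measure" ..
  have [measurable]: "h b \<in> borel_measurable borel" if "b \<in> Basis" for b
    using borel_measurable_integrable[OF h[OF that]] by simp
  have m: "(\<lambda>x::'a. \<Prod>b\<in>Basis. h b (x \<bullet> b)) \<in> borel_measurable borel" by measurable
  have eq: "(\<Prod>b\<in>Basis. h b ((\<Sum>b'\<in>Basis. f b' *\<^sub>R b') \<bullet> b)) = (\<Prod>b\<in>Basis. h b (f b))" for f :: "'a \<Rightarrow> real"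
    by (intro prod.cong) (simp_all add: inner_sum_left inner_Basis if_distrib sum.delta cong: if_cong)
  have t: "(\<lambda>f. \<Sum>b\<in>Basis. f b *\<^sub>R b) \<in> (\<Pi>\<^sub>M b\<in>(Basis::'a set). lborel) \<rightarrow>\<^sub>M borel" by measurable
  show ?I
    by (subst lborel_eq, subst integrable_distr_eq[OF t m])
      (unfold eq, intro product_integrable_prod h finite_Basis)
  show ?E
    by (subst lborel_eq, subst integral_distr[OF t m])
      (unfold eq, intro product_integral_prod h finite_Basis)
qed

lemma cis_sum: "finite A \<Longrightarrow> cis (\<Sum>i\<in>A. f i) = (\<Prod>i\<in>A. cis (f i))"
  by (induction A rule: finite_induct) (simp_all flip: cis_mult)

lemma integral_cis_unit_interval:
  fixes k m :: real
  assumes "k \<in> \<int>" "m \<in> \<int>"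
  shows "integrable lborel (\<lambda>t. indicator {t. of_int \<lfloor>t\<rfloor> = k} t *\<^sub>R cis (2 * pi * (m * t)))" (is "integrable _ ?f")
    and "(LINT t|lborel. indicator {t. of_int \<lfloor>t\<rfloor> = k} t *\<^sub>R cis (2 * pi * (m * t))) = (if m = 0 then 1 else 0)"
proof -
  obtain i j where ij: "k = of_int i" "m = of_int j" using assms by (auto elim!: Ints_cases)
  have set: "{t. of_int \<lfloor>t\<rfloor> = k} = {k..<k + 1}"
    unfolding ij by (auto simp: floor_eq_iff)
  \<comment> \<open>The half-open interval is closed up for the fundamental theorem of calculus; the
    added endpoint is a null set.\<close>
  have AE: "AE t in lborel. indicator {k..k + 1} t *\<^sub>R cis (2 * pi * (m * t)) = ?f t"
    unfolding set using AE_lborel_singleton[of "k + 1"] by eventually_elim (auto simp: indicator_def)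
  have meas: "?f \<in> borel_measurable lborel" by (simp add: set cis_conv_exp)
  have cont: "continuous_on {k..k + 1} (\<lambda>t. cis (2 * pi * (m * t)))"
    by (intro continuous_intros)
  have int: "integrable lborel (\<lambda>t. indicator {k..k + 1} t *\<^sub>R cis (2 * pi * (m * t)))"
    by (rule borel_integrable_atLeastAtMost'[OF cont, unfolded set_integrable_def])
  show "integrable lborel ?f"
    by (rule integrable_cong_AE_imp[OF int]) (use meas AE in auto)
  have "(LINT t|lborel. ?f t) = (LINT t|lborel. indicator {k..k + 1} t *\<^sub>R cis (2 * pi * (m * t)))"
    by (rule integral_cong_AE) (use meas AE int in auto)
  also have "\<dots> = (if m = 0 then 1 else 0)"
  proof (cases "m = 0")
    case True
    then show ?thesis by simp
  next
    case False
    have d: "((\<lambda>t. cis (2 * pi * (m * t)) / (\<i> * (2 * pi * m))) has_vector_derivative cis (2 * pi * (m * t))) (at t within S)" for t S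
    proof -
      have "((\<lambda>t. exp (\<i> * (2 * pi * m) * t) / (\<i> * (2 * pi * m))) has_field_derivative exp (\<i> * (2 * pi * m) * t)) (at (of_real t :: complex))"
        using False by (auto intro!: derivative_eq_intros)
      from has_vector_derivative_real_field[OF this, of S] show ?thesis
        by (simp add: cis_conv_exp mult_ac)
    qed
    have "cis (2 * pi * (m * (k + 1))) = cis (2 * pi * (m * k))"
    proof -
      have "cis (2 * pi * (m * (k + 1))) = cis (2 * pi * (m * k)) * cis (2 * pi * m)"
        by (simp add: cis_mult algebra_simps)
      also have "cis (2 * pi * m) = 1" using assms(2) by (rule cis_multiple_2pi)
      finally show ?thesis by simp
    qed
    then show ?thesis
      using False by (subst integral_FTC_Icc[OF _ d cont]) auto
  qed
  finally show "(LINT t|lborel. ?f t) = (if m = 0 then 1 else 0)" .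
qed

text \<open>With m the difference of two frequencies this is the orthonormality used in Bessel's
  inequality; with m = 0 it gives the volume of the cube. Both reduce to one coordinate at a
  time.\<close>

lemma integral_cis_unit_cube:
  fixes k m :: "'a::euclidean_space"
  assumes "k \<in> lattice" "m \<in> lattice"
  shows "integrable lborel (\<lambda>x. indicator (unit_cube k) x *\<^sub>R cis (2 * pi * (m \<bullet> x)))"
    and "(LINT x|lborel. indicator (unit_cube k) x *\<^sub>R cis (2 * pi * (m \<bullet> x))) = (if m = 0 then 1 else 0)"
proof -
  define h where "h b t = (indicator {t. of_int \<lfloor>t\<rfloor> = k \<bullet> b} t *\<^sub>R cis (2 * pi * ((m \<bullet> b) * t)))" for b :: 'a and t
  have eq: "indicator (unit_cube k) x *\<^sub>R cis (2 * pi * (m \<bullet> x)) = (\<Prod>b\<in>Basis. h b (x \<bullet> b))" for x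
  proof -
    have "cis (2 * pi * (m \<bullet> x)) = (\<Prod>b\<in>Basis. cis (2 * pi * ((m \<bullet> b) * (x \<bullet> b))))"
      unfolding euclidean_inner[of m x] sum_distrib_left by (rule cis_sum) simp
    moreover have "(indicator (unit_cube k) x :: real) = (\<Prod>b\<in>Basis. indicator {t. of_int \<lfloor>t\<rfloor> = k \<bullet> b} (x \<bullet> b))"
      by (auto simp: indicator_def mem_unit_cube)
    ultimately show ?thesis by (simp add: h_def scaleR_conv_of_real prod.distrib of_real_prod)
  qed
  have kb: "k \<bullet> b \<in> \<int>" "m \<bullet> b \<in> \<int>" if "b \<in> Basis" for b using assms that by (auto simp: lattice_def)
  have int: "integrable lborel (h b)" if "b \<in> Basis" for b
    unfolding h_def using integral_cis_unit_interval(1)[OF kb[OF that]] .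
  show "integrable lborel (\<lambda>x. indicator (unit_cube k) x *\<^sub>R cis (2 * pi * (m \<bullet> x)))"
    unfolding eq by (rule lborel_integral_prod_Basis(1)[OF int])
  have "(LINT x|lborel. (\<Prod>b\<in>Basis. h b (x \<bullet> b))) = (\<Prod>b\<in>Basis. LINT t|lborel. h b t)"
    by (rule lborel_integral_prod_Basis(2)[OF int])
  also have "\<dots> = (\<Prod>b\<in>Basis. if m \<bullet> b = 0 then 1 else 0)"
    by (intro prod.cong refl) (simp add: h_def integral_cis_unit_interval(2) kb)
  also have "\<dots> = (if m = 0 then 1 else 0)"
    by (auto simp: euclidean_eq_iff[of m])
  finally show "(LINT x|lborel. indicator (unit_cube k) x *\<^sub>R cis (2 * pi * (m \<bullet> x))) = (if m = 0 then 1 else 0)"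
    unfolding eq .
qed

lemma emeasure_unit_cube:
  assumes "k \<in> lattice"
  shows "emeasure lborel (unit_cube k) = 1"
proof -
  have *: "complex_integrable lborel (\<lambda>x. of_real (indicator (unit_cube k) x))"
    "(LINT x|lborel. complex_of_real (indicator (unit_cube k) x)) = 1"
    using integral_cis_unit_cube[OF assms, of 0] by (simp_all add: lattice_def scaleR_conv_of_real)
  have "integrable lborel (indicator (unit_cube k) :: 'a \<Rightarrow> real)"
    using *(1) by (simp add: complex_of_real_integrable_eq)
  then have "emeasure lborel (unit_cube k) < \<infinity>" by (simp add: integrable_indicator_iff)
  moreover have "measure lborel (unit_cube k) = 1" using *(2) by simp
  ultimately show ?thesis by (simp add: emeasure_eq_ennreal_measure)
qed

section \<open>Fourier coefficients on cubes and Bessel's inequality\<close>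

abbreviation sq_int :: "('a::euclidean_space \<Rightarrow> complex) \<Rightarrow> bool"
  where "sq_int f \<equiv> f \<in> borel_measurable borel \<and> integrable lborel (\<lambda>x. (norm (f x))\<^sup>2)"

lemma integrable_mult_sq_int:
  fixes f g :: "'a::euclidean_space \<Rightarrow> complex"
  assumes "sq_int f" "sq_int g"
  shows "integrable lborel (\<lambda>x. f x * g x)"
proof (rule Bochner_Integration.integrable_bound)
  show "integrable lborel (\<lambda>x. (norm (f x))\<^sup>2 + (norm (g x))\<^sup>2)" using assms by auto
  have "norm (f x * g x) \<le> (norm (f x))\<^sup>2 + (norm (g x))\<^sup>2" for x
  proof -
    have "2 * (norm (f x) * norm (g x)) \<le> (norm (f x))\<^sup>2 + (norm (g x))\<^sup>2"
      using sum_squares_bound[of "norm (f x)" "norm (g x)"] by simp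
    moreover have "0 \<le> norm (f x) * norm (g x)" by simp
    ultimately show ?thesis unfolding norm_mult by linarith
  qed
  then show "AE x in lborel. norm (f x * g x) \<le> norm ((norm (f x))\<^sup>2 + (norm (g x))\<^sup>2)"
    by (intro AE_I2) simp
qed (use assms in auto)

lemma sq_int_indicator_cis:
  assumes "k \<in> lattice" "p \<in> lattice"
  shows "sq_int (\<lambda>x. indicator (unit_cube k) x *\<^sub>R cis (2 * pi * (p \<bullet> x)))"
proof -
  have "integrable lborel (indicator (unit_cube k) :: 'a \<Rightarrow> real)"
    using emeasure_unit_cube[OF assms(1)] by (simp add: integrable_indicator_iff)
  moreover have "(norm (indicator (unit_cube k) x *\<^sub>R cis (2 * pi * (p \<bullet> x))))\<^sup>2 = indicator (unit_cube k) x" for x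
    by (simp add: indicator_def)
  ultimately show ?thesis by (simp add: cis_conv_exp)
qed

lemma sq_int_cnj: "sq_int f \<Longrightarrow> sq_int (\<lambda>x. cnj (f x))"
  using borel_measurable_continuous_on[OF continuous_on_cnj[OF continuous_on_id]] by auto

text \<open>A Fourier coefficient of the restriction of v to the cube, at frequency -p: the forms to
  be estimated are bilinear, so the exponential enters without conjugation.\<close>

definition cube_coeff :: "('a::euclidean_space \<Rightarrow> complex) \<Rightarrow> 'a \<Rightarrow> 'a \<Rightarrow> complex"
  where "cube_coeff v k p = (LINT x|lborel. indicator (unit_cube k) x *\<^sub>R (cis (2 * pi * (p \<bullet> x)) * v x))"

text \<open>Let u be the restriction of v and g its partial Fourier sum. Expanding the square and
  using orthonormality, the integral of \<open>(norm (u x - g x))\<^sup>2\<close> equals the right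
  side minus the left side, and it is nonnegative.\<close>

lemma bessel_unit_cube:
  fixes v :: "'a::euclidean_space \<Rightarrow> complex"
  assumes v: "sq_int v" and k: "k \<in> lattice" and F: "finite F" "F \<subseteq> lattice"
  shows "(\<Sum>p\<in>F. (norm (cube_coeff v k p))\<^sup>2) \<le> (LINT x|lborel. indicator (unit_cube k) x * (norm (v x))\<^sup>2)"
proof -
  define e where "e p x = indicator (unit_cube k) x *\<^sub>R cis (2 * pi * (p \<bullet> x))" for p x
  define u where "u x = indicator (unit_cube k) x *\<^sub>R v x" for x
  define c where "c p = cube_coeff v k p" for p
  \<comment> \<open>The conjugates match the sign convention of \<open>cube_coeff\<close>.\<close>
  define g where "g x = (\<Sum>p\<in>F. c p * cnj (e p x))" for x
  have [measurable]: "v \<in> borel_measurable borel" using v by blast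
  have e: "sq_int (e p)" "sq_int (\<lambda>x. cnj (e p x))" if "p \<in> F" for p
  proof -
    show "sq_int (e p)" unfolding e_def using that F by (intro sq_int_indicator_cis k) auto
    then show "sq_int (\<lambda>x. cnj (e p x))" by (rule sq_int_cnj)
  qed
  have u: "sq_int u"
  proof
    show "integrable lborel (\<lambda>x. (norm (u x))\<^sup>2)"
      by (rule Bochner_Integration.integrable_bound[of _ "\<lambda>x. (norm (v x))\<^sup>2"])
        (use v in \<open>auto simp: u_def indicator_def\<close>)
  qed (simp add: u_def[abs_def])
  have c: "(LINT x|lborel. e p x * u x) = c p" for p
    unfolding c_def cube_coeff_def
    by (intro Bochner_Integration.integral_cong refl) (simp add: e_def u_def indicator_def)
  have orth: "(LINT x|lborel. cnj (e p x) * e q x) = (if p = q then 1 else 0)" if "p \<in> F" "q \<in> F" for p q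
  proof -
    have "(LINT x|lborel. cnj (e p x) * e q x) = (LINT x|lborel. indicator (unit_cube k) x *\<^sub>R cis (2 * pi * ((q - p) \<bullet> x)))"
      by (intro Bochner_Integration.integral_cong refl)
        (simp add: e_def indicator_def cis_cnj cis_mult inner_diff_left algebra_simps)
    also have "\<dots> = (if q - p = 0 then 1 else 0)"
      by (rule integral_cis_unit_cube(2)[OF k]) (use that F lattice_diff in blast)
    finally show ?thesis by auto
  qed
  note int = integrable_mult_sq_int
  have cu: "sq_int (\<lambda>x. cnj (u x))" using u by (rule sq_int_cnj)
  have i1: "integrable lborel (\<lambda>x. u x * cnj (u x))" by (rule int[OF u cu])
  have gu: "(LINT x|lborel. cnj (g x) * u x) = (\<Sum>p\<in>F. of_real ((norm (c p))\<^sup>2))"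
    and gui: "integrable lborel (\<lambda>x. cnj (g x) * u x)"
  proof -
    have eq: "cnj (g x) * u x = (\<Sum>p\<in>F. cnj (c p) * (e p x * u x))" for x
      by (simp add: g_def sum_distrib_right sum_distrib_left mult_ac)
    show "integrable lborel (\<lambda>x. cnj (g x) * u x)"
      unfolding eq by (intro Bochner_Integration.integrable_sum integrable_mult_right int e u)
    have "(LINT x|lborel. cnj (g x) * u x) = (\<Sum>p\<in>F. LINT x|lborel. cnj (c p) * (e p x * u x))"
      unfolding eq by (rule Bochner_Integration.integral_sum) (intro integrable_mult_right int e u)
    also have "\<dots> = (\<Sum>p\<in>F. cnj (c p) * c p)" by (simp add: c)
    finally have "(LINT x|lborel. cnj (g x) * u x) = (\<Sum>p\<in>F. cnj (c p) * c p)" .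
    then show "(LINT x|lborel. cnj (g x) * u x) = (\<Sum>p\<in>F. of_real ((norm (c p))\<^sup>2))"
      unfolding complex_norm_square by (simp add: mult.commute)
  qed
  have ug: "(LINT x|lborel. g x * cnj (u x)) = (\<Sum>p\<in>F. of_real ((norm (c p))\<^sup>2))"
    and ugi: "integrable lborel (\<lambda>x. g x * cnj (u x))"
  proof -
    have "g x * cnj (u x) = cnj (cnj (g x) * u x)" for x by simp
    then show "integrable lborel (\<lambda>x. g x * cnj (u x))" "(LINT x|lborel. g x * cnj (u x)) = (\<Sum>p\<in>F. of_real ((norm (c p))\<^sup>2))"
      using gui gu by (simp_all only: Bochner_Integration.integrable_cnj Bochner_Integration.integral_cnj cnj_sum complex_cnj_complex_of_real)
  qed
  have gg: "(LINT x|lborel. g x * cnj (g x)) = (\<Sum>p\<in>F. of_real ((norm (c p))\<^sup>2))"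
    and ggi: "integrable lborel (\<lambda>x. g x * cnj (g x))"
  proof -
    have eq: "g x * cnj (g x) = (\<Sum>p\<in>F. \<Sum>q\<in>F. (c p * cnj (c q)) * (cnj (e p x) * e q x))" for x
      by (simp add: g_def sum_product mult_ac)
    show "integrable lborel (\<lambda>x. g x * cnj (g x))"
      unfolding eq by (intro Bochner_Integration.integrable_sum integrable_mult_right int e)
    have "(LINT x|lborel. g x * cnj (g x)) = (\<Sum>p\<in>F. LINT x|lborel. (\<Sum>q\<in>F. (c p * cnj (c q)) * (cnj (e p x) * e q x)))"
      unfolding eq by (rule Bochner_Integration.integral_sum)
        (intro Bochner_Integration.integrable_sum integrable_mult_right int e)
    also have "\<dots> = (\<Sum>p\<in>F. \<Sum>q\<in>F. LINT x|lborel. (c p * cnj (c q)) * (cnj (e p x) * e q x))"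
      by (intro sum.cong refl Bochner_Integration.integral_sum integrable_mult_right int e)
    also have "\<dots> = (\<Sum>p\<in>F. \<Sum>q\<in>F. (c p * cnj (c q)) * (LINT x|lborel. cnj (e p x) * e q x))" by simp
    also have "\<dots> = (\<Sum>p\<in>F. \<Sum>q\<in>F. if p = q then c p * cnj (c q) else 0)"
      by (intro sum.cong refl) (simp add: orth)
    also have "\<dots> = (\<Sum>p\<in>F. of_real ((norm (c p))\<^sup>2))"
      unfolding complex_norm_square using F by simp
    finally show "(LINT x|lborel. g x * cnj (g x)) = (\<Sum>p\<in>F. of_real ((norm (c p))\<^sup>2))" .
  qed
  have sq: "complex_of_real ((norm (u x - g x))\<^sup>2) = u x * cnj (u x) - cnj (g x) * u x - g x * cnj (u x) + g x * cnj (g x)" for x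
    unfolding complex_norm_square by (simp add: algebra_simps)
  have "complex_of_real (LINT x|lborel. (norm (u x - g x))\<^sup>2) = (LINT x|lborel. complex_of_real ((norm (u x - g x))\<^sup>2))"
    by (rule integral_complex_of_real[symmetric])
  also have "\<dots> = (LINT x|lborel. u x * cnj (u x)) - (\<Sum>p\<in>F. of_real ((norm (c p))\<^sup>2))"
    unfolding sq using i1 gui ugi ggi by (simp add: gu ug gg)
  also have "(LINT x|lborel. u x * cnj (u x)) = of_real (LINT x|lborel. indicator (unit_cube k) x * (norm (v x))\<^sup>2)"
  proof -
    have "u x * cnj (u x) = of_real (indicator (unit_cube k) x * (norm (v x))\<^sup>2)" for x
      unfolding complex_norm_square[symmetric] by (simp add: u_def indicator_def)
    then show ?thesis by (simp only: integral_complex_of_real)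
  qed
  also have "\<dots> - (\<Sum>p\<in>F. of_real ((norm (c p))\<^sup>2)) =
      complex_of_real ((LINT x|lborel. indicator (unit_cube k) x * (norm (v x))\<^sup>2) - (\<Sum>p\<in>F. (norm (c p))\<^sup>2))"
    by simp
  finally have "(LINT x|lborel. (norm (u x - g x))\<^sup>2)
      = (LINT x|lborel. indicator (unit_cube k) x * (norm (v x))\<^sup>2) - (\<Sum>p\<in>F. (norm (c p))\<^sup>2)"
    by (simp only: of_real_eq_iff)
  moreover have "0 \<le> (LINT x|lborel. (norm (u x - g x))\<^sup>2)" by simp
  ultimately show ?thesis by (simp add: c_def)
qed

text \<open>Indices with the same cube and the same frequency are collected, at most D at a time.
  What remains is Bessel's inequality on each cube, summed over disjoint cubes.\<close>

lemma sum_cube_coeff_le: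
  fixes v :: "'a::euclidean_space \<Rightarrow> complex" and \<kappa> p :: "'i \<Rightarrow> 'a"
  assumes v: "sq_int v" and I: "finite I" "\<And>i. i \<in> I \<Longrightarrow> \<kappa> i \<in> lattice" "\<And>i. i \<in> I \<Longrightarrow> p i \<in> lattice"
    and D: "\<And>y. card {i \<in> I. (\<kappa> i, p i) = y} \<le> D"
  shows "(\<Sum>i\<in>I. (norm (cube_coeff v (\<kappa> i) (p i)))\<^sup>2) \<le> real D * (LINT x|lborel. (norm (v x))\<^sup>2)"
proof -
  define G where "G = (\<lambda>(k, q). (norm (cube_coeff v k q))\<^sup>2)"
  let ?h = "\<lambda>i. (\<kappa> i, p i)"
  have [measurable]: "v \<in> borel_measurable borel" using v by blast
  have int: "integrable lborel (\<lambda>x. indicator (unit_cube k) x * (norm (v x))\<^sup>2)" for k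
    by (rule Bochner_Integration.integrable_bound[of _ "\<lambda>x. (norm (v x))\<^sup>2"])
        (use v in \<open>auto simp: indicator_def\<close>)
  have "(\<Sum>i\<in>I. G (?h i)) = (\<Sum>y\<in>?h ` I. \<Sum>i\<in>{i \<in> I. ?h i = y}. G (?h i))"
    by (rule sum.image_gen[OF I(1)])
  also have "\<dots> = (\<Sum>y\<in>?h ` I. real (card {i \<in> I. ?h i = y}) * G y)"
    by (intro sum.cong refl) simp
  also have "\<dots> \<le> (\<Sum>y\<in>?h ` I. real D * G y)"
    by (intro sum_mono mult_right_mono) (use D in \<open>auto simp: G_def\<close>)
  also have "\<dots> \<le> (\<Sum>y\<in>(\<kappa> ` I) \<times> (p ` I). real D * G y)"
    by (rule sum_mono2) (use I in \<open>auto simp: G_def\<close>)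
  also have "\<dots> = real D * (\<Sum>k\<in>\<kappa> ` I. \<Sum>q\<in>p ` I. (norm (cube_coeff v k q))\<^sup>2)"
    by (simp add: sum.cartesian_product sum_distrib_left G_def)
  also have "\<dots> \<le> real D * (\<Sum>k\<in>\<kappa> ` I. LINT x|lborel. indicator (unit_cube k) x * (norm (v x))\<^sup>2)"
    by (intro mult_left_mono sum_mono bessel_unit_cube) (use v I in auto)
  also have "(\<Sum>k\<in>\<kappa> ` I. LINT x|lborel. indicator (unit_cube k) x * (norm (v x))\<^sup>2)
      = (LINT x|lborel. (\<Sum>k\<in>\<kappa> ` I. indicator (unit_cube k) x * (norm (v x))\<^sup>2))"
    by (subst Bochner_Integration.integral_sum) (use int in auto)
  also have "\<dots> \<le> (LINT x|lborel. (norm (v x))\<^sup>2)"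
  proof (rule integral_mono)
    fix x
    have "(\<Sum>k\<in>\<kappa> ` I. indicator (unit_cube k) x) = (if vfloor x \<in> \<kappa> ` I then 1 else (0::real))"
      using I(1) by (simp add: unit_cube_def indicator_def)
    then show "(\<Sum>k\<in>\<kappa> ` I. indicator (unit_cube k) x * (norm (v x))\<^sup>2) \<le> (norm (v x))\<^sup>2"
      by (simp flip: sum_distrib_right)
  qed (use v int in auto)
  finally show ?thesis by (simp add: G_def mult_left_mono)
qed

text \<open>Cauchy-Schwarz separates w from v; each of the two sums of squares costs a factor D
  under a square root. Here p and q are the two halves of the frequency attached to the cube
  i.\<close>

lemma sum_cube_coeff_product_le:
  fixes v w :: "'a::euclidean_space \<Rightarrow> complex" and p q :: "'a \<times> 'a \<Rightarrow> 'a"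
  assumes v: "sq_int v" and w: "sq_int w" and I: "finite I" "I \<subseteq> lattice"
    and pq: "\<And>i. i \<in> I \<Longrightarrow> p i \<in> lattice" "\<And>i. i \<in> I \<Longrightarrow> q i \<in> lattice"
    and D: "\<And>y. card {i \<in> I. (fst i, p i) = y} \<le> D" "\<And>y. card {i \<in> I. (snd i, q i) = y} \<le> D"
    and c: "\<And>i. i \<in> I \<Longrightarrow> norm (c i) \<le> M" and M: "0 \<le> M"
  shows "norm (\<Sum>i\<in>I. c i * (cube_coeff w (fst i) (p i) * cube_coeff v (snd i) (q i)))
    \<le> M * D * (sqrt (LINT x|lborel. (norm (w x))\<^sup>2) * sqrt (LINT x|lborel. (norm (v x))\<^sup>2))"
proof -
  let ?W = "\<lambda>i. norm (cube_coeff w (fst i) (p i))" and ?V = "\<lambda>i. norm (cube_coeff v (snd i) (q i))"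
  have lat: "fst i \<in> lattice" "snd i \<in> lattice" if "i \<in> I" for i
    using I(2) that lattice_Pair[of "fst i" "snd i"] by auto
  have "norm (\<Sum>i\<in>I. c i * (cube_coeff w (fst i) (p i) * cube_coeff v (snd i) (q i))) \<le> (\<Sum>i\<in>I. M * (?W i * ?V i))"
    by (rule sum_norm_le) (auto simp: norm_mult intro!: mult_right_mono c)
  also have "\<dots> = M * (\<Sum>i\<in>I. ?W i * ?V i)" by (simp add: sum_distrib_left)
  also have "\<dots> \<le> M * (sqrt (\<Sum>i\<in>I. (?W i)\<^sup>2) * sqrt (\<Sum>i\<in>I. (?V i)\<^sup>2))"
    using L2_set_mult_ineq[of ?W ?V I] M by (intro mult_left_mono) (simp_all add: L2_set_def)
  also have "\<dots> \<le> M * (sqrt (real D * (LINT x|lborel. (norm (w x))\<^sup>2)) * sqrt (real D * (LINT x|lborel. (norm (v x))\<^sup>2)))"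
    by (intro mult_left_mono mult_mono real_sqrt_le_mono sum_cube_coeff_le)
      (use assms lat M in \<open>auto intro!: sum_nonneg\<close>)
  also have "\<dots> = M * D * (sqrt (LINT x|lborel. (norm (w x))\<^sup>2) * sqrt (LINT x|lborel. (norm (v x))\<^sup>2))"
    by (simp add: real_sqrt_mult)
  finally show ?thesis .
qed

section \<open>Sums of oscillatory integrals over cubes\<close>

text \<open>The default value 0 of the integral of a non-integrable function respects the bound as
  well, since g is nonnegative. This serves integrands whose measurability in a parameter would be
  awkward to establish, such as pairings with functions depending on that parameter.\<close>

lemma norm_integral_le_integral:
  fixes f :: "'a::euclidean_space \<Rightarrow> 'b::{banach, second_countable_topology}"
  assumes g: "integrable M g" and le: "\<And>x. norm (f x) \<le> g x"
  shows "norm (LINT x|M. f x) \<le> (LINT x|M. g x)"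
proof (cases "integrable M f")
  case True
  then show ?thesis using assms by (intro Bochner_Integration.integral_norm_bound_integral)
next
  case False
  have "0 \<le> g x" for x using le[of x] norm_ge_zero[of "f x"] by linarith
  with False show ?thesis by (simp add: not_integrable_integral_eq)
qed

lemma integral_fst_snd_mult:
  fixes f :: "'a::euclidean_space \<Rightarrow> 'c::{real_normed_field, banach, second_countable_topology}"
    and g :: "'b::euclidean_space \<Rightarrow> 'c"
  assumes f: "integrable lborel f" and g: "integrable lborel g"
  shows "integrable lborel (\<lambda>z. f (fst z) * g (snd z))" (is ?I)
    and "(LINT z|lborel. f (fst z) * g (snd z)) = (LINT x|lborel. f x) * (LINT y|lborel. g y)"
proof -
  have [measurable]: "f \<in> borel_measurable borel" "g \<in> borel_measurable borel"
    using f g by (auto dest: borel_measurable_integrable)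
  have I: "integrable (lborel \<Otimes>\<^sub>M lborel) (\<lambda>z. f (fst z) * g (snd z))"
  proof (rule lborel_pair.Fubini_integrable)
    show "integrable lborel (\<lambda>x. LINT y|lborel. norm (f (fst (x, y)) * g (snd (x, y))))"
      using f g by (simp add: norm_mult)
  qed (use f g in simp_all)
  then show ?I by (simp add: lborel_prod)
  have "(LINT z|(lborel \<Otimes>\<^sub>M lborel). f (fst z) * g (snd z)) = (LINT x|lborel. LINT y|lborel. f x * g y)"
    using lborel_pair.integral_fst'[OF I] by simp
  then show "(LINT z|lborel. f (fst z) * g (snd z)) = (LINT x|lborel. f x) * (LINT y|lborel. g y)"
    by (simp add: lborel_prod)
qed

text \<open>The counterpart of \<open>l2norm\<close> for Borel functions, see
  \<open>l2norm_eq_l2n\<close>.\<close>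

definition l2n :: "('a::euclidean_space \<Rightarrow> complex) \<Rightarrow> real"
  where "l2n v = sqrt (LINT x|lborel. (norm (v x))\<^sup>2)"

lemma sq_int_bounded_mult:
  assumes v: "sq_int v" and \<phi>: "\<phi> \<in> borel_measurable borel" "\<And>x. norm (\<phi> x) \<le> 1"
  shows "sq_int (\<lambda>x. \<phi> x * v x)" and "l2n (\<lambda>x. \<phi> x * v x) \<le> l2n v"
proof -
  have le: "(norm (\<phi> x * v x))\<^sup>2 \<le> (norm (v x))\<^sup>2" for x
    using \<phi>(2)[of x] by (intro power_mono) (simp_all add: norm_mult mult_left_le_one_le)
  have m: "(\<lambda>x. \<phi> x * v x) \<in> borel_measurable borel" using v \<phi> by (intro borel_measurable_times) auto
  have i: "integrable lborel (\<lambda>x. (norm (\<phi> x * v x))\<^sup>2)"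
    by (rule Bochner_Integration.integrable_bound[of _ "\<lambda>x. (norm (v x))\<^sup>2"]) (use v m le in auto)
  show "sq_int (\<lambda>x. \<phi> x * v x)" using m i by blast
  show "l2n (\<lambda>x. \<phi> x * v x) \<le> l2n v"
    unfolding l2n_def by (intro real_sqrt_le_mono integral_mono i le) (use v in blast)
qed

lemma integrable_sq_int_unit_cube:
  assumes v: "sq_int v" and k: "k \<in> lattice" and p: "p \<in> lattice"
  shows "integrable lborel (\<lambda>x. indicator (unit_cube k) x *\<^sub>R cis (2 * pi * (p \<bullet> x)) * v x)"
  using integrable_mult_sq_int[OF sq_int_indicator_cis[OF k p] v] .

lemma unit_cube_Pair: "z \<in> unit_cube (k, j) \<longleftrightarrow> fst z \<in> unit_cube k \<and> snd z \<in> unit_cube j"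
  by (cases z) (simp add: unit_cube_def vfloor_Pair)

text \<open>One Fourier mode of one cube, tested against w and v. It is a product of a function of
  the first variable and one of the second, so its integral is a product of two cube
  coefficients.\<close>

definition atom :: "('a::euclidean_space \<times> 'a) \<Rightarrow> ('a \<times> 'a) \<Rightarrow> ('a \<Rightarrow> complex) \<Rightarrow> ('a \<Rightarrow> complex) \<Rightarrow> 'a \<times> 'a \<Rightarrow> complex"
  where "atom k p w v z =
    indicator (unit_cube k) z *\<^sub>R (cis (2 * pi * (p \<bullet> z)) * (w (fst z) * v (snd z)))"

lemma atom_eq:
  "atom k p w v z = (indicator (unit_cube (fst k)) (fst z) *\<^sub>R cis (2 * pi * (fst p \<bullet> fst z)) * w (fst z)) *
     (indicator (unit_cube (snd k)) (snd z) *\<^sub>R cis (2 * pi * (snd p \<bullet> snd z)) * v (snd z))"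
  by (cases k) (auto simp: atom_def unit_cube_Pair indicator_def inner_prod_def distrib_left simp flip: cis_mult)

lemma integrable_atom:
  assumes "sq_int w" "sq_int v" "k \<in> lattice" "p \<in> lattice"
  shows "integrable lborel (atom k p w v)"
    and "(LINT z|lborel. atom k p w v z) = cube_coeff w (fst k) (fst p) * cube_coeff v (snd k) (snd p)"
proof -
  have l: "fst k \<in> lattice" "snd k \<in> lattice" "fst p \<in> lattice" "snd p \<in> lattice"
    using assms lattice_Pair[of "fst k" "snd k"] lattice_Pair[of "fst p" "snd p"] by auto
  note * = integral_fst_snd_mult[OF integrable_sq_int_unit_cube[OF assms(1) l(1,3)] integrable_sq_int_unit_cube[OF assms(2) l(2,4)]]
  show "integrable lborel (atom k p w v)"
    using *(1) by (simp add: atom_eq[abs_def])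
  show "(LINT z|lborel. atom k p w v z) = cube_coeff w (fst k) (fst p) * cube_coeff v (snd k) (snd p)"
    using *(2) by (simp add: atom_eq cube_coeff_def)
qed

text \<open>P attaches one frequency to each cube, and c is the remaining amplitude, which may
  differ from cube to cube.\<close>

definition pairing :: "('a::euclidean_space \<times> 'a) set \<Rightarrow> ('a \<times> 'a \<Rightarrow> 'a \<times> 'a) \<Rightarrow>
    ('a \<times> 'a \<Rightarrow> 'a \<times> 'a \<Rightarrow> complex) \<Rightarrow> ('a \<Rightarrow> complex) \<Rightarrow> ('a \<Rightarrow> complex) \<Rightarrow> complex"
  where "pairing I P c w v = (\<Sum>k\<in>I. LINT z|lborel. atom k (P k) w v z * c k z)"

definition pairing_bound :: "('a::euclidean_space \<times> 'a) set \<Rightarrow> ('a \<times> 'a \<Rightarrow> 'a \<times> 'a) \<Rightarrow> real \<Rightarrow>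
    ('a \<times> 'a \<Rightarrow> 'a \<times> 'a \<Rightarrow> complex) \<Rightarrow> bool"
  where "pairing_bound I P K c \<longleftrightarrow>
    (\<forall>w v. sq_int w \<longrightarrow> sq_int v \<longrightarrow> norm (pairing I P c w v) \<le> K * (l2n w * l2n v))"

lemma pairing_cong:
  assumes "\<And>k z. k \<in> I \<Longrightarrow> z \<in> unit_cube k \<Longrightarrow> c k z = d k z"
  shows "pairing I P c w v = pairing I P d w v"
  unfolding pairing_def
  by (intro sum.cong refl Bochner_Integration.integral_cong) (auto simp: atom_def indicator_def assms)

lemma integrable_atom_mult:
  assumes "sq_int w" "sq_int v" "k \<in> lattice" "p \<in> lattice"
    and c: "c \<in> borel_measurable borel" "\<And>z. z \<in> unit_cube k \<Longrightarrow> norm (c z) \<le> M"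
  shows "integrable lborel (\<lambda>z. atom k p w v z * c z)"
proof (rule Bochner_Integration.integrable_bound)
  show "integrable lborel (\<lambda>z. M * norm (atom k p w v z))"
    using integrable_atom(1)[OF assms(1-4)] by simp
  show "(\<lambda>z. atom k p w v z * c z) \<in> borel_measurable lborel"
    using borel_measurable_integrable[OF integrable_atom(1)[OF assms(1-4)]] c(1) by simp
  have "norm (atom k p w v z * c z) \<le> norm (M * norm (atom k p w v z))" for z
  proof (cases "z \<in> unit_cube k")
    case True
    have "norm (atom k p w v z * c z) \<le> M * norm (atom k p w v z)"
      using mult_right_mono[OF c(2)[OF True], of "norm (atom k p w v z)"] by (simp add: norm_mult mult.commute)
    then show ?thesis by simp
  qed (simp add: atom_def)
  then show "AE z in lborel. norm (atom k p w v z * c z) \<le> norm (M * norm (atom k p w v z))" by simp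
qed

lemma pairing_bound_add:
  assumes I: "I \<subseteq> lattice" "\<And>k. k \<in> I \<Longrightarrow> P k \<in> lattice"
    and c: "\<And>k. k \<in> I \<Longrightarrow> c k \<in> borel_measurable borel" "\<And>k z. k \<in> I \<Longrightarrow> z \<in> unit_cube k \<Longrightarrow> norm (c k z) \<le> M"
    and d: "\<And>k. k \<in> I \<Longrightarrow> d k \<in> borel_measurable borel" "\<And>k z. k \<in> I \<Longrightarrow> z \<in> unit_cube k \<Longrightarrow> norm (d k z) \<le> M"
    and K: "pairing_bound I P K c" "pairing_bound I P L d"
  shows "pairing_bound I P (K + L) (\<lambda>k z. c k z + d k z)"
  unfolding pairing_bound_def
proof (intro allI impI)
  fix w v :: "'a \<Rightarrow> complex" assume wv: "sq_int w" "sq_int v"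
  have eq: "pairing I P (\<lambda>k z. c k z + d k z) w v = pairing I P c w v + pairing I P d w v"
    unfolding pairing_def sum.distrib[symmetric] distrib_left
    by (intro sum.cong refl Bochner_Integration.integral_add integrable_atom_mult[OF wv]) (use I c d in blast)+
  have "norm (pairing I P c w v) \<le> K * (l2n w * l2n v)" "norm (pairing I P d w v) \<le> L * (l2n w * l2n v)"
    using K wv unfolding pairing_bound_def by blast+
  then show "norm (pairing I P (\<lambda>k z. c k z + d k z) w v) \<le> (K + L) * (l2n w * l2n v)"
    using norm_triangle_ineq[of "pairing I P c w v" "pairing I P d w v"] unfolding eq distrib_right by linarith
qed

text \<open>On \<open>unit_cube k\<close>, where \<open>k\<close> is the integer part of \<open>z\<close>, the indicator below is a function of one of the
  components of \<open>z\<close> that does not depend on \<open>k\<close>, and can be absorbed into \<open>w\<close> or \<open>v\<close>.\<close>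

lemma pairing_bound_integral:
  fixes d :: "real \<Rightarrow> 'a::euclidean_space \<times> 'a \<Rightarrow> 'a \<times> 'a \<Rightarrow> complex"
  assumes I: "finite I" "I \<subseteq> lattice" "\<And>k. k \<in> I \<Longrightarrow> P k \<in> lattice" and b: "b \<in> Basis" and K: "0 \<le> K"
    and d: "\<And>k. k \<in> I \<Longrightarrow> (\<lambda>(z, t). d t k z) \<in> borel_measurable (borel \<Otimes>\<^sub>M borel)"
      "\<And>k z t. k \<in> I \<Longrightarrow> z \<in> unit_cube k \<Longrightarrow> t \<in> {0..1} \<Longrightarrow> norm (d t k z) \<le> M"
    and dK: "\<And>t. t \<in> {0..1} \<Longrightarrow> pairing_bound I P K (d t)"
    and c: "\<And>k z. k \<in> I \<Longrightarrow> z \<in> unit_cube k \<Longrightarrow>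
      c k z = (LINT t|lborel. indicator {0..1} t *\<^sub>R (indicator {..(z - k) \<bullet> b} t * d t k z))"
  shows "pairing_bound I P K c"
  unfolding pairing_bound_def
proof (intro allI impI)
  fix w v :: "'a \<Rightarrow> complex" assume wv: "sq_int w" "sq_int v"
  have [measurable]: "w \<in> borel_measurable borel" "v \<in> borel_measurable borel" using wv by auto
  define H where "H k z t = atom k (P k) w v z * (indicator {0..1} t *\<^sub>R (indicator {..(z - k) \<bullet> b} t * d t k z))" for k z t
  have lat: "k \<in> lattice" "P k \<in> lattice" if "k \<in> I" for k using I that by auto
  have H: "integrable (lborel \<Otimes>\<^sub>M lborel) (\<lambda>(z, t). H k z t)" if k: "k \<in> I" for k
  proof (rule Bochner_Integration.integrable_bound)
    note [measurable] = d(1)[OF k] borel_measurable_integrable[OF integrable_atom(1)[OF wv lat[OF k]]]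
    show "integrable (lborel \<Otimes>\<^sub>M lborel) (\<lambda>z. norm (atom k (P k) w v (fst z)) * (M * indicator {0..1} (snd z :: real)))"
      unfolding lborel_prod
      by (rule integral_fst_snd_mult(1)) (use integrable_atom(1)[OF wv lat[OF k]] in \<open>auto intro!: integrable_mult_right\<close>)
    have ind: "(\<lambda>(z, t). indicator {..(z - k) \<bullet> b} t :: complex) = (\<lambda>(z, t). if t \<le> (z - k) \<bullet> b then 1 else 0)"
      by (auto simp: indicator_def)
    have [measurable]: "(\<lambda>(z, t). indicator {..(z - k) \<bullet> b} t :: complex) \<in> borel_measurable (borel \<Otimes>\<^sub>M borel)"
      unfolding ind by measurable
    have [measurable]: "(\<lambda>(z, t). atom k (P k) w v z) \<in> borel_measurable (borel \<Otimes>\<^sub>M borel)"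
      by measurable
    show "(\<lambda>(z, t). H k z t) \<in> borel_measurable (lborel \<Otimes>\<^sub>M lborel)"
      unfolding H_def by measurable
    have "norm (H k z t) \<le> norm (atom k (P k) w v z) * (M * indicator {0..1} t)" for z t
    proof (cases "z \<in> unit_cube k \<and> t \<in> {0..1}")
      case True
      then have "norm (d t k z) \<le> M" using d(2)[OF k] by blast
      then have "norm (indicator {..(z - k) \<bullet> b} t * d t k z) \<le> M"
        by (auto simp: indicator_def intro: order_trans[OF norm_ge_zero])
      with True show ?thesis by (simp add: H_def norm_mult mult_left_mono)
    qed (auto simp: H_def atom_def indicator_def)
    then show "AE z in lborel \<Otimes>\<^sub>M lborel. norm (case z of (z, t) \<Rightarrow> H k z t)
        \<le> norm (norm (atom k (P k) w v (fst z)) * (M * indicator {0..1} (snd z)))"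
      by (intro AE_I2) (auto intro: order_trans[OF _ abs_ge_self])
  qed
  obtain w' v' where wv': "\<And>t::real. sq_int (w' t)" "\<And>t. sq_int (v' t)" "\<And>t. l2n (w' t) \<le> l2n w" "\<And>t. l2n (v' t) \<le> l2n v"
    "\<And>t k p z. atom k p w v z * indicator {..(z - k) \<bullet> b} t = atom k p (w' t) (v' t) z"
  proof -
    define \<phi> where "\<phi> b' t x = (if t \<le> (x - vfloor x) \<bullet> b' then 1 else 0 :: complex)" for t :: real and x b' :: 'a
    have \<phi>: "\<phi> b' t \<in> borel_measurable borel" "norm (\<phi> b' t x) \<le> 1" for t b' x
      by (simp_all add: \<phi>_def[abs_def])
    have cube: "atom k p w v z * indicator {..(z - k) \<bullet> b} t = atom k p w v z * (if t \<le> (z - vfloor z) \<bullet> b then 1 else 0)" for k p z t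
      by (auto simp: atom_def indicator_def unit_cube_def)
    have fs: "fst (vfloor z) = vfloor (fst z)" "snd (vfloor z) = vfloor (snd z)" for z :: "'a \<times> 'a"
      by (cases z; simp add: vfloor_Pair)+
    from b consider b' where "b = (b', 0)" | b' where "b = (0, b')" by (auto simp: Basis_prod_def)
    then show thesis
    proof cases
      case 1
      have "atom k p w v z * indicator {..(z - k) \<bullet> b} t = atom k p (\<lambda>x. \<phi> b' t x * w x) v z" for t k p z
        unfolding cube by (simp add: atom_def 1 inner_prod_def fs \<phi>_def)
      then show thesis
        using that[of "\<lambda>t x. \<phi> b' t x * w x" "\<lambda>t. v"] sq_int_bounded_mult[OF wv(1) \<phi>] wv by simp
    next
      case 2
      have "atom k p w v z * indicator {..(z - k) \<bullet> b} t = atom k p w (\<lambda>x. \<phi> b' t x * v x) z" for t k p z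
        unfolding cube by (simp add: atom_def 2 inner_prod_def fs \<phi>_def)
      then show thesis
        using that[of "\<lambda>t. w" "\<lambda>t x. \<phi> b' t x * v x"] sq_int_bounded_mult[OF wv(2) \<phi>] wv by simp
    qed
  qed
  have Hz: "(LINT z|lborel. H k z t) = indicator {0..1} t *\<^sub>R (LINT z|lborel. atom k (P k) (w' t) (v' t) z * d t k z)" for k t
  proof -
    have "H k z t = indicator {0..1} t *\<^sub>R (atom k (P k) (w' t) (v' t) z * d t k z)" for z
      unfolding H_def wv'(5)[symmetric] by simp
    then show ?thesis by simp
  qed
  have "pairing I P c w v = (\<Sum>k\<in>I. LINT z|lborel. LINT t|lborel. H k z t)"
    unfolding pairing_def
  proof (intro sum.cong refl Bochner_Integration.integral_cong)
    fix k z assume k: "k \<in> I"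
    show "atom k (P k) w v z * c k z = (LINT t|lborel. H k z t)"
    proof (cases "z \<in> unit_cube k")
      case True
      then show ?thesis
        by (simp only: H_def c[OF k True] Bochner_Integration.integral_mult_right_zero)
    qed (simp add: H_def atom_def)
  qed
  \<comment> \<open>After Fubini t is outermost, and for fixed t the assumed bound applies to the
    functions \<open>w' t\<close> and \<open>v' t\<close>, whose norms do not exceed those of w and
    v.\<close>
  also have "\<dots> = (\<Sum>k\<in>I. LINT t|lborel. LINT z|lborel. H k z t)"
    by (intro sum.cong refl lborel_pair.Fubini_integral[symmetric] H)
  also have "\<dots> = (LINT t|lborel. (\<Sum>k\<in>I. LINT z|lborel. H k z t))"
    by (rule Bochner_Integration.integral_sum[symmetric]) (rule lborel_pair.integrable_snd[OF H])
  also have "\<dots> = (LINT t|lborel. indicator {0..1} t *\<^sub>R pairing I P (d t) (w' t) (v' t))"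
    by (simp add: Hz pairing_def scaleR_sum_right)
  finally have eq: "pairing I P c w v = (LINT t|lborel. indicator {0..1} t *\<^sub>R pairing I P (d t) (w' t) (v' t))" .
  have "norm (LINT t|lborel. indicator {0..1} t *\<^sub>R pairing I P (d t) (w' t) (v' t)) \<le> (LINT t|lborel. indicator {0..1::real} t * (K * (l2n w * l2n v)))"
  proof (rule norm_integral_le_integral)
    show "integrable lborel (\<lambda>t::real. indicator {0..1} t * (K * (l2n w * l2n v)))" by simp
    fix t :: real
    show "norm (indicator {0..1} t *\<^sub>R pairing I P (d t) (w' t) (v' t)) \<le> indicator {0..1} t * (K * (l2n w * l2n v))"
    proof (cases "t \<in> {0..1}")
      case True
      have "norm (pairing I P (d t) (w' t) (v' t)) \<le> K * (l2n (w' t) * l2n (v' t))"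
        using dK[OF True] wv' unfolding pairing_bound_def by blast
      also have "\<dots> \<le> K * (l2n w * l2n v)"
        using wv'(3,4) K by (intro mult_left_mono mult_mono) (auto simp: l2n_def)
      finally show ?thesis using True by simp
    qed simp
  qed
  then show "norm (pairing I P c w v) \<le> K * (l2n w * l2n v)" unfolding eq by simp
qed

section \<open>Removing the dependence on the variables one by one\<close>

text \<open>B is the set of coordinates that remain free. Induction on B leads from amplitudes
  constant on each cube (\<open>B = {}\<close>) to the given amplitude
  (\<open>B = Basis\<close>).\<close>

definition freeze :: "'a::euclidean_space set \<Rightarrow> 'a \<Rightarrow> 'a \<Rightarrow> 'a"
  where "freeze B y z = (\<Sum>b\<in>Basis. (if b \<in> B then z \<bullet> b else y \<bullet> b) *\<^sub>R b)"

lemma freeze_inner: "b \<in> Basis \<Longrightarrow> freeze B y z \<bullet> b = (if b \<in> B then z \<bullet> b else y \<bullet> b)"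
  by (simp add: freeze_def inner_sum_left_Basis)

lemma freeze_empty: "freeze {} y z = y" and freeze_Basis: "freeze Basis y z = z"
  by (rule euclidean_eqI, simp add: freeze_inner)+

lemma freeze_add:
  assumes "b \<in> Basis" "b \<notin> B"
  shows "freeze B (y + t *\<^sub>R b) z = freeze B y z + t *\<^sub>R b"
  using assms by (intro euclidean_eqI[of "freeze B (y + t *\<^sub>R b) z"])
    (auto simp: freeze_inner inner_add_left inner_Basis)

lemma freeze_insert:
  assumes "b \<in> Basis" "b \<notin> B"
  shows "freeze (insert b B) y z = freeze B (y + ((z - y) \<bullet> b) *\<^sub>R b) z"
  using assms by (intro euclidean_eqI[of "freeze (insert b B) y z"])
    (auto simp: freeze_inner inner_add_left inner_diff_left inner_Basis)

lemma continuous_on_freeze [continuous_intros]: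
  assumes "continuous_on S f" "continuous_on S g"
  shows "continuous_on S (\<lambda>x. freeze B (f x) (g x))"
proof -
  have "freeze B (f x) (g x) = (\<Sum>b\<in>Basis. (of_bool (b \<in> B) * (g x \<bullet> b) + of_bool (b \<notin> B) * (f x \<bullet> b)) *\<^sub>R b)" for x
    unfolding freeze_def by (intro sum.cong refl) simp
  then show ?thesis using assms by (simp del: sum.cong) (intro continuous_intros)
qed

lemma unit_cube_subset_cbox: "unit_cube k \<subseteq> cbox k (k + One)"
proof
  fix z assume "z \<in> unit_cube k"
  then have "k \<bullet> b \<le> z \<bullet> b \<and> z \<bullet> b \<le> (k + One) \<bullet> b" if "b \<in> Basis" for b
    using that floor_correct[of "z \<bullet> b"] by (auto simp: mem_unit_cube inner_add_left inner_sum_left inner_Basis)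
  then show "z \<in> cbox k (k + One)" by (simp add: mem_box)
qed

text \<open>The range of integration is the fixed interval [0,1] and \<tau> occurs in an indicator
  only. With \<tau> the fractional part of a coordinate, this separates that coordinate from the
  derivative under the integral.\<close>

lemma line_integral_partial_deriv:
  fixes f :: "'a::euclidean_space \<Rightarrow> complex"
  assumes f: "\<And>z. f differentiable (at z)" "continuous_on UNIV (partial_deriv b f)" and \<tau>: "0 \<le> \<tau>" "\<tau> \<le> 1"
  shows "f (y + \<tau> *\<^sub>R b) = f y +
    (LINT t|lborel. indicator {0..1} t *\<^sub>R (indicator {..\<tau>} t * partial_deriv b f (y + t *\<^sub>R b)))"
proof -
  have cont: "continuous_on {0..\<tau>} (\<lambda>t. partial_deriv b f (y + t *\<^sub>R b))"
    by (rule continuous_on_compose2[OF f(2)]) (auto intro!: continuous_intros)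
  have "(LINT t|lborel. indicator {0..\<tau>} t *\<^sub>R partial_deriv b f (y + t *\<^sub>R b)) = f (y + \<tau> *\<^sub>R b) - f (y + 0 *\<^sub>R b)"
    by (rule integral_FTC_Icc[OF \<tau>(1) _ cont], rule has_vector_derivative_at_within, rule has_vector_derivative_along, rule f(1))
  moreover have eq: "indicator {0..\<tau>} t *\<^sub>R partial_deriv b f (y + t *\<^sub>R b) =
      indicator {0..1} t *\<^sub>R (indicator {..\<tau>} t * partial_deriv b f (y + t *\<^sub>R b))" for t
    using \<tau> by (auto simp: indicator_def)
  ultimately show ?thesis unfolding eq by (metis (no_types) add.commute add_0_right diff_add_cancel scaleR_zero_left)
qed

text \<open>The fundamental theorem of calculus removes one coordinate, at the price of one derivative in that
  coordinate; the remaining constants are handled by Bessel's inequality.\<close>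

lemma pairing_bound_freeze:
  fixes f :: "'a::euclidean_space \<times> 'a \<Rightarrow> 'a \<times> 'a \<Rightarrow> complex" and P :: "'a \<times> 'a \<Rightarrow> 'a \<times> 'a"
  assumes I: "finite I" "I \<subseteq> lattice" "\<And>k. k \<in> I \<Longrightarrow> P k \<in> lattice"
    and D: "\<And>y. card {k \<in> I. (fst k, fst (P k)) = y} \<le> D" "\<And>y. card {k \<in> I. (snd k, snd (P k)) = y} \<le> D"
    and M: "0 \<le> M" and "finite B" "B \<subseteq> Basis"
    and "\<And>k. k \<in> I \<Longrightarrow> deriv_bounded (card B) M (cbox k (k + One)) (f k)" and "s \<in> cbox 0 One"
  shows "pairing_bound I P (2 ^ card B * M * D) (\<lambda>k z. f k (freeze B (k + s) z))"
  using assms(7-)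
\<comment> \<open>Both f and s must vary: the inductive step passes to a partial derivative of f and
  to base points that contain the integration variable.\<close>
proof (induction B arbitrary: f s rule: finite_induct)
  case empty
  have s: "k + s \<in> cbox k (k + One)" for k
    using \<open>s \<in> cbox 0 One\<close> by (simp add: mem_box inner_add_left)
  have c: "norm (f k (k + s)) \<le> M" if "k \<in> I" for k
    using deriv_bounded_norm_le[OF empty(2)[OF that] s] .
  show ?case
    unfolding pairing_bound_def freeze_empty
  proof (intro allI impI)
    fix w v :: "'a \<Rightarrow> complex" assume wv: "sq_int w" "sq_int v"
    have "pairing I P (\<lambda>k z. f k (k + s)) w v =
        (\<Sum>k\<in>I. f k (k + s) * (cube_coeff w (fst k) (fst (P k)) * cube_coeff v (snd k) (snd (P k))))"
      unfolding pairing_def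
    proof (intro sum.cong refl)
      fix k assume k: "k \<in> I"
      then have "k \<in> lattice" "P k \<in> lattice" using I by auto
      from integrable_atom(2)[OF wv this]
      show "(LINT z|lborel. atom k (P k) w v z * f k (k + s)) =
          f k (k + s) * (cube_coeff w (fst k) (fst (P k)) * cube_coeff v (snd k) (snd (P k)))" by simp
    qed
    moreover have "fst (P k) \<in> lattice" "snd (P k) \<in> lattice" if "k \<in> I" for k
      using I(3)[OF that] lattice_Pair[of "fst (P k)" "snd (P k)"] by auto
    ultimately show "norm (pairing I P (\<lambda>k z. f k (k + s)) w v) \<le> 2 ^ card {} * M * D * (l2n w * l2n v)"
      using sum_cube_coeff_product_le[OF wv(2,1) I(1,2), of "\<lambda>k. fst (P k)" "\<lambda>k. snd (P k)" D "\<lambda>k. f k (k + s)" M] D c M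
      by (simp add: l2n_def)
  qed
next
  case (insert b B)
  have b: "b \<in> Basis" "b \<notin> B" "B \<subseteq> Basis" using insert by auto
  have card: "card (insert b B) = Suc (card B)" using insert by simp
  \<comment> \<open>The base point is moved to the lower face of the box in direction b, so that the
    integration along b starts at t = 0 and ends at the fractional part
    \<open>(z - k) \<bullet> b\<close>.\<close>
  define s0 where "s0 = s - (s \<bullet> b) *\<^sub>R b"
  have s0: "s0 + t *\<^sub>R b \<in> cbox 0 One" if "t \<in> {0..1}" for t
    using insert.prems(3) that b(1) by (auto simp: mem_box s0_def inner_add_left inner_diff_left inner_Basis)
  have fdb: "deriv_bounded (Suc (card B)) M (cbox k (k + One)) (f k)" if "k \<in> I" for k
    using insert.prems(2)[OF that] card by simp
  have db: "deriv_bounded (card B) M (cbox k (k + One)) (partial_deriv b (f k))" if "k \<in> I" for k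
    using fdb[OF that] b by simp
  have cont: "continuous_on UNIV (f k)" "continuous_on UNIV (partial_deriv b (f k))" if "k \<in> I" for k
    using deriv_bounded_imp_continuous fdb[OF that] db[OF that] by blast+
  have in_cbox: "freeze B (k + (s0 + t *\<^sub>R b)) z \<in> cbox k (k + One)" if "z \<in> unit_cube k" "t \<in> {0..1}" for k z t
    using unit_cube_subset_cbox that s0[of t] by (fastforce simp: mem_box freeze_inner inner_add_left)
  define c where "c k z = f k (freeze B (k + s0) z)" for k z
  define d where "d t k z = partial_deriv b (f k) (freeze B (k + (s0 + t *\<^sub>R b)) z)" for t k z
  define d' where "d' k z = (LINT t|lborel. indicator {0..1} t *\<^sub>R (indicator {..(z - k) \<bullet> b} t * d t k z))" for k z
  have eq: "f k (freeze (insert b B) (k + s) z) = c k z + d' k z" if k: "k \<in> I" and z: "z \<in> unit_cube k" for k z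
  proof -
    have \<tau>: "0 \<le> (z - k) \<bullet> b" "(z - k) \<bullet> b \<le> 1"
      using unit_cube_subset_cbox z b(1) by (fastforce simp: mem_box inner_diff_left inner_add_left)+
    have "k + s + ((z - (k + s)) \<bullet> b) *\<^sub>R b = k + s0 + ((z - k) \<bullet> b) *\<^sub>R b"
      by (simp add: s0_def inner_diff_left inner_add_left algebra_simps)
    then have "freeze (insert b B) (k + s) z = freeze B (k + s0) z + ((z - k) \<bullet> b) *\<^sub>R b"
      by (simp only: freeze_insert[OF b(1,2)] freeze_add[OF b(1,2), symmetric])
    moreover have "d t k z = partial_deriv b (f k) (freeze B (k + s0) z + t *\<^sub>R b)" for t
      unfolding d_def by (simp add: freeze_add[OF b(1,2)] flip: add.assoc)
    moreover have "f k differentiable (at x)" for x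
      using fdb[OF k] unfolding deriv_bounded.simps by blast
    ultimately show ?thesis
      unfolding c_def d'_def
      using line_integral_partial_deriv[OF _ cont(2)[OF k] \<tau>, of "freeze B (k + s0) z"] by (simp only:)
  qed
  have nd: "norm (d t k z) \<le> M" if "k \<in> I" "z \<in> unit_cube k" "t \<in> {0..1}" for t k z
    unfolding d_def by (rule deriv_bounded_norm_le[OF db[OF that(1)] in_cbox[OF that(2,3)]])
  \<comment> \<open>The boundary term: f frozen in direction b on the lower face.\<close>
  have IH1: "pairing_bound I P (2 ^ card B * M * D) c"
    unfolding c_def
  proof (rule insert.IH[OF b(3)])
    show "s0 \<in> cbox 0 One" using s0[of 0] by simp
  qed (rule deriv_bounded_SucD[OF fdb])
  have dmeas: "(\<lambda>(z, t). d t k z) \<in> borel_measurable (borel \<Otimes>\<^sub>M borel)" if "k \<in> I" for k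
    unfolding borel_prod d_def case_prod_beta
    by (intro borel_measurable_continuous_onI continuous_on_compose2[OF cont(2)[OF that]]) (auto intro!: continuous_intros)
  \<comment> \<open>The integral term: for each t it is a partial derivative of f frozen at the base
    point \<open>s0 + t *\<^sub>R b\<close>, multiplied by the indicator that
    \<open>pairing_bound_integral\<close> absorbs.\<close>
  have IH2: "pairing_bound I P (2 ^ card B * M * D) d'"
  proof (rule pairing_bound_integral[OF I b(1) _ dmeas nd])
    show "pairing_bound I P (2 ^ card B * M * D) (d t)" if "t \<in> {0..1}" for t
      unfolding d_def by (rule insert.IH[OF b(3) db s0[OF that]])
  qed (use M in \<open>auto simp: d'_def\<close>)
  have cmeas: "c k \<in> borel_measurable borel" if "k \<in> I" for k
    unfolding c_def
    by (intro borel_measurable_continuous_onI continuous_on_compose2[OF cont(1)[OF that]]) (auto intro!: continuous_intros)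
  have cn: "norm (c k z) \<le> M" if "k \<in> I" "z \<in> unit_cube k" for k z
    unfolding c_def using deriv_bounded_norm_le[OF fdb[OF that(1)]] in_cbox[OF that(2), of 0] by simp
  have d'meas: "d' k \<in> borel_measurable borel" if "k \<in> I" for k
  proof -
    have ind: "(\<lambda>(z, t). indicator {..(z - k) \<bullet> b} t :: complex) = (\<lambda>(z, t). if t \<le> (z - k) \<bullet> b then 1 else 0)"
      by (auto simp: indicator_def)
    have [measurable]: "(\<lambda>(z, t). indicator {..(z - k) \<bullet> b} t :: complex) \<in> borel_measurable (borel \<Otimes>\<^sub>M borel)"
      unfolding ind by measurable
    note [measurable] = dmeas[OF that]
    show ?thesis unfolding d'_def by measurable
  qed
  have d'n: "norm (d' k z) \<le> M" if "k \<in> I" "z \<in> unit_cube k" for k z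
  proof -
    have "norm (d' k z) \<le> (LINT t|lborel. indicator {0..1::real} t * M)"
      unfolding d'_def
    proof (rule norm_integral_le_integral)
      show "integrable lborel (\<lambda>t::real. indicator {0..1} t * M)" by simp
      show "norm (indicator {0..1} t *\<^sub>R (indicator {..(z - k) \<bullet> b} t * d t k z)) \<le> indicator {0..1} t * M" for t
        using nd[OF that, of t] M by (auto simp: indicator_def)
    qed
    then show ?thesis by simp
  qed
  \<comment> \<open>Boundary term and integral term have the same bound, so each coordinate doubles
    the constant.\<close>
  have "pairing_bound I P (2 ^ card B * M * D + 2 ^ card B * M * D) (\<lambda>k z. c k z + d' k z)"
    by (rule pairing_bound_add[OF I(2,3) cmeas cn d'meas d'n IH1 IH2])
  moreover have "pairing I P (\<lambda>k z. f k (freeze (insert b B) (k + s) z)) = pairing I P (\<lambda>k z. c k z + d' k z)"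
    by (intro ext pairing_cong eq)
  moreover have "2 ^ card B * M * D + 2 ^ card B * M * D = 2 ^ card (insert b B) * M * D"
    by (simp add: card)
  ultimately show ?case by (simp only: pairing_bound_def)
qed

lemma pairing_bound_deriv_bounded:
  fixes f :: "'a::euclidean_space \<times> 'a \<Rightarrow> 'a \<times> 'a \<Rightarrow> complex" and P :: "'a \<times> 'a \<Rightarrow> 'a \<times> 'a"
  assumes "finite I" "I \<subseteq> lattice" "\<And>k. k \<in> I \<Longrightarrow> P k \<in> lattice"
    and "\<And>y. card {k \<in> I. (fst k, fst (P k)) = y} \<le> D" "\<And>y. card {k \<in> I. (snd k, snd (P k)) = y} \<le> D"
    and "0 \<le> M" and "\<And>k. k \<in> I \<Longrightarrow> deriv_bounded DIM('a \<times> 'a) M (cbox k (k + One)) (f k)"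
  shows "pairing_bound I P (2 ^ DIM('a \<times> 'a) * M * D) f"
  using pairing_bound_freeze[of I P D M Basis f 0] assms
  by (simp add: freeze_Basis mem_box)

section \<open>The space \<open>L\<^sup>2\<close>\<close>

text \<open>Estimates are made with Borel functions, for which products and Fubini's theorem are at
  hand, while \<open>L2\<close> is built on the completed measure; this is the bridge.\<close>

lemma sq_int_iff: "sq_int f \<longleftrightarrow> f \<in> borel_measurable borel \<and> square_integrable f"
proof -
  have "f \<in> borel_measurable lebesgue" "integrable lebesgue (\<lambda>x. (norm (f x))\<^sup>2) \<longleftrightarrow> integrable lborel (\<lambda>x. (norm (f x))\<^sup>2)"
    if "f \<in> borel_measurable borel"
  proof -
    show "f \<in> borel_measurable lebesgue" using that by (intro measurable_completion) simp
    show "integrable lebesgue (\<lambda>x. (norm (f x))\<^sup>2) \<longleftrightarrow> integrable lborel (\<lambda>x. (norm (f x))\<^sup>2)"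
      by (rule integrable_completion) (use that in simp)
  qed
  then show ?thesis unfolding square_integrable_def by blast
qed

lemma l2norm_eq_l2n: "sq_int f \<Longrightarrow> l2norm f = l2n f"
  unfolding l2norm_def l2n_def by (subst integral_completion) auto

lemma sq_int_add: "sq_int f \<Longrightarrow> sq_int g \<Longrightarrow> sq_int (\<lambda>x. f x + g x)"
  unfolding sq_int_iff using square_integrable_add by (auto intro: borel_measurable_add)

lemma sq_int_cmult: "sq_int f \<Longrightarrow> sq_int (\<lambda>x. c * f x)"
  unfolding sq_int_iff using square_integrable_cmult by (auto intro: borel_measurable_times)

lemma sq_int_diff: "sq_int f \<Longrightarrow> sq_int g \<Longrightarrow> sq_int (\<lambda>x. f x - g x)"
  using sq_int_add[of f "\<lambda>x. - 1 * g x"] sq_int_cmult[of g "- 1"] by auto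

text \<open>Every class of \<open>L2\<close> thus contains a Borel function.\<close>

lemma sq_int_representative:
  assumes "square_integrable f"
  obtains g where "sq_int g" "AE x in lborel. f x = g x"
proof -
  have [measurable]: "f \<in> borel_measurable lebesgue" using assms by (simp add: square_integrable_def)
  have "(\<lambda>x. Re (f x)) \<in> borel_measurable lebesgue" "(\<lambda>x. Im (f x)) \<in> borel_measurable lebesgue"
    by measurable
  then obtain g1 g2 where g: "g1 \<in> borel_measurable lborel" "g2 \<in> borel_measurable lborel"
    "AE x in lborel. Re (f x) = g1 x" "AE x in lborel. Im (f x) = g2 x"
    using completion_ex_borel_measurable_real by metis
  define g where "g x = complex_of_real (g1 x) + \<i> * complex_of_real (g2 x)" for x
  have [measurable]: "g \<in> borel_measurable borel" using g unfolding g_def[abs_def] by simp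
  have AE: "AE x in lborel. f x = g x"
    using g(3,4) by eventually_elim (simp add: g_def complex_eq_iff)
  have "integrable lebesgue (\<lambda>x. (norm (g x))\<^sup>2) \<longleftrightarrow> integrable lebesgue (\<lambda>x. (norm (f x))\<^sup>2)"
  proof (rule integrable_cong_AE)
    show "AE x in lebesgue. (norm (g x))\<^sup>2 = (norm (f x))\<^sup>2"
      using AE_completion[OF AE] by eventually_elim simp
  qed (simp_all add: measurable_completion)
  then have "sq_int g"
    using assms by (simp add: square_integrable_def integrable_completion)
  with AE that show thesis by blast
qed

lemma l2rel_refl: "sq_int f \<Longrightarrow> l2rel f f"
  by (simp add: sq_int_iff l2rel_def)

lemma L2_class_eq_iff:
  assumes "sq_int f" "sq_int g"
  shows "L2_class f = L2_class g \<longleftrightarrow> (AE x in lborel. f x = g x)"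
  using Quotient_rel[OF Quotient_L2, of f g] assms
  by (auto simp: sq_int_iff l2rel_def AE_completion_iff)

lemma L2_cases:
  obtains f where "sq_int f" "F = L2_class f"
proof -
  have r: "l2rel (rep_L2 F) (rep_L2 F)" by (rule Quotient_rep_reflp[OF Quotient_L2])
  then obtain f where f: "sq_int f" "AE x in lborel. rep_L2 F x = f x"
    using sq_int_representative by (auto simp: l2rel_def)
  with r have "l2rel (rep_L2 F) f" by (auto simp: l2rel_def sq_int_iff AE_completion)
  then have "L2_class (rep_L2 F) = L2_class f" by (rule Quotient_rel_abs[OF Quotient_L2])
  with f that show thesis by (metis Quotient_abs_rep[OF Quotient_L2])
qed

lemma norm_L2_class: "sq_int f \<Longrightarrow> norm (L2_class f) = l2n f"
  by (simp only: norm_L2.abs_eq[OF l2rel_refl] l2norm_eq_l2n)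

lemma L2_class_add: "sq_int f \<Longrightarrow> sq_int g \<Longrightarrow> L2_class f + L2_class g = L2_class (\<lambda>x. f x + g x)"
  by (rule plus_L2.abs_eq) (rule l2rel_refl, assumption)+

lemma L2_class_scaleC: "sq_int f \<Longrightarrow> scaleC_L2 c (L2_class f) = L2_class (\<lambda>x. c * f x)"
  by (rule scaleC_L2.abs_eq) (rule l2rel_refl)

lemma L2_class_diff: "sq_int f \<Longrightarrow> sq_int g \<Longrightarrow> L2_class f - L2_class g = L2_class (\<lambda>x. f x - g x)"
  using L2_class_add[of f "\<lambda>x. - 1 * g x"] sq_int_cmult[of g "- 1"]
  by (simp add: minus_L2_def uminus_L2_def L2_class_scaleC)

section \<open>Cauchy-Schwarz, Fatou and completeness\<close>

lemma l2n_nonneg: "0 \<le> l2n f"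
  by (simp add: l2n_def)

lemma l2n_power2: "(l2n f)\<^sup>2 = (LINT x|lborel. (norm (f x))\<^sup>2)"
  by (simp add: l2n_def)

lemma nn_integral_eq_l2n: "sq_int f \<Longrightarrow> (\<integral>\<^sup>+x. ennreal ((norm (f x))\<^sup>2) \<partial>lborel) = ennreal ((l2n f)\<^sup>2)"
  unfolding l2n_power2 by (rule nn_integral_eq_integral) auto

lemma sq_int_if_nn_integral_le:
  assumes f: "f \<in> borel_measurable borel" and C: "0 \<le> C" and le: "(\<integral>\<^sup>+x. ennreal ((norm (f x))\<^sup>2) \<partial>lborel) \<le> ennreal (C\<^sup>2)"
  shows "sq_int f" "l2n f \<le> C"
proof -
  have "integrable lborel (\<lambda>x. (norm (f x))\<^sup>2)"
    using f le by (intro integrableI_bounded) (auto simp: le_less_trans[OF _ ennreal_less_top])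
  then show s: "sq_int f" using f by blast
  have "ennreal ((l2n f)\<^sup>2) \<le> ennreal (C\<^sup>2)" using le nn_integral_eq_l2n[OF s] by simp
  then have "(l2n f)\<^sup>2 \<le> C\<^sup>2" by (simp add: ennreal_le_iff)
  then show "l2n f \<le> C" using C by (rule power2_le_imp_le)
qed

lemma l2_Cauchy_Schwarz:
  assumes f: "sq_int f" and g: "sq_int g"
  shows "norm (LINT x|lborel. f x * g x) \<le> l2n f * l2n g"
proof -
  have [measurable]: "f \<in> borel_measurable borel" "g \<in> borel_measurable borel" using f g by auto
  have "ennreal (norm (LINT x|lborel. f x * g x)) \<le> (\<integral>\<^sup>+x. ennreal (norm (f x)) * ennreal (norm (g x)) \<partial>lborel)"
    using integral_norm_bound_ennreal[OF integrable_mult_sq_int[OF f g]] by (simp add: norm_mult ennreal_mult)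
  then have "(ennreal (norm (LINT x|lborel. f x * g x)))\<^sup>2 \<le> (\<integral>\<^sup>+x. ennreal (norm (f x)) * ennreal (norm (g x)) \<partial>lborel)\<^sup>2"
    by (intro power_mono) auto
  also have "\<dots> \<le> (\<integral>\<^sup>+x. (ennreal (norm (f x)))\<^sup>2 \<partial>lborel) * (\<integral>\<^sup>+x. (ennreal (norm (g x)))\<^sup>2 \<partial>lborel)"
    by (rule Cauchy_Schwarz_nn_integral) measurable
  also have "\<dots> = ennreal ((l2n f * l2n g)\<^sup>2)"
    using nn_integral_eq_l2n[OF f] nn_integral_eq_l2n[OF g]
    by (simp add: ennreal_power power_mult_distrib ennreal_mult)
  finally have "(norm (LINT x|lborel. f x * g x))\<^sup>2 \<le> (l2n f * l2n g)\<^sup>2"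
    by (simp add: ennreal_power ennreal_le_iff)
  then show ?thesis by (rule power2_le_imp_le) (simp add: l2n_nonneg)
qed

text \<open>The weighted squares are bounded, so the increments are at most a constant times
  \<open>(1 / sqrt 2) ^ n\<close>, which is summable. Squares are kept because their integrals are
  squared norms in \<open>L2\<close>.\<close>

lemma convergent_if_weighted_summable:
  fixes f :: "nat \<Rightarrow> complex"
  assumes "(\<Sum>n. ennreal (2 ^ n * (norm (f (Suc n) - f n))\<^sup>2)) \<noteq> \<infinity>"
  shows "convergent f"
proof -
  define d where "d n = norm (f (Suc n) - f n)" for n
  have "summable (\<lambda>n. 2 ^ n * (d n)\<^sup>2)"
    using assms by (intro summable_suminf_not_top) (auto simp: d_def)
  then have "Bseq (\<lambda>n. 2 ^ n * (d n)\<^sup>2)"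
    by (intro convergent_imp_Bseq) (auto dest: summable_LIMSEQ_zero intro: convergentI)
  then obtain C where C: "C > 0" "\<And>n. norm (2 ^ n * (d n)\<^sup>2) \<le> C" by (auto simp: Bseq_def)
  have d: "d n \<le> sqrt C * (1 / sqrt 2) ^ n" for n
  proof -
    have "(d n)\<^sup>2 \<le> C / 2 ^ n" using C(2)[of n] by (simp add: field_simps)
    then have "d n \<le> sqrt (C / 2 ^ n)" by (rule real_le_rsqrt)
    then show ?thesis by (simp add: real_sqrt_divide real_sqrt_power power_divide)
  qed
  have "summable (\<lambda>n. sqrt C * (1 / sqrt 2) ^ n)"
    by (intro summable_mult summable_geometric) simp
  then have "summable (\<lambda>n. f (Suc n) - f n)"
    by (rule summable_comparison_test') (use d in \<open>simp add: d_def\<close>)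
  then have "convergent (\<lambda>n. \<Sum>i<n. f (Suc i) - f i)" by (simp add: summable_iff_convergent)
  then have "convergent (\<lambda>n. f n - f 0)" by (simp add: sum_lessThan_telescope)
  then have "convergent (\<lambda>n. (f n - f 0) + f 0)" by (intro convergent_add convergent_const)
  then show ?thesis by simp
qed

lemma l2_Fatou:
  assumes f: "\<And>n. sq_int (f n)" and C: "\<forall>\<^sub>F n in sequentially. l2n (f n) \<le> C" "0 \<le> C"
    and lim: "AE x in lborel. (\<lambda>n. f n x) \<longlonglongrightarrow> g x" and [measurable]: "g \<in> borel_measurable borel"
  shows "sq_int g \<and> l2n g \<le> C"
proof -
  have [measurable]: "f n \<in> borel_measurable borel" for n using f by blast
  have "(\<integral>\<^sup>+x. ennreal ((norm (g x))\<^sup>2) \<partial>lborel) = (\<integral>\<^sup>+x. liminf (\<lambda>n. ennreal ((norm (f n x))\<^sup>2)) \<partial>lborel)"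
  proof (rule nn_integral_cong_AE)
    show "AE x in lborel. ennreal ((norm (g x))\<^sup>2) = liminf (\<lambda>n. ennreal ((norm (f n x))\<^sup>2))"
      using lim
    proof eventually_elim
      case (elim x)
      have "(\<lambda>n. ennreal ((norm (f n x))\<^sup>2)) \<longlonglongrightarrow> ennreal ((norm (g x))\<^sup>2)"
        by (intro tendsto_ennrealI tendsto_intros elim)
      then show ?case by (intro lim_imp_Liminf[symmetric]) simp_all
    qed
  qed
  also have "\<dots> \<le> liminf (\<lambda>n. \<integral>\<^sup>+x. ennreal ((norm (f n x))\<^sup>2) \<partial>lborel)"
    by (rule nn_integral_liminf) measurable
  also have "\<dots> \<le> limsup (\<lambda>n. \<integral>\<^sup>+x. ennreal ((norm (f n x))\<^sup>2) \<partial>lborel)"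
    by (rule Liminf_le_Limsup) simp
  also have "\<dots> \<le> ennreal (C\<^sup>2)"
  proof (rule Limsup_bounded)
    show "\<forall>\<^sub>F n in sequentially. (\<integral>\<^sup>+x. ennreal ((norm (f n x))\<^sup>2) \<partial>lborel) \<le> ennreal (C\<^sup>2)"
      using C(1)
    proof eventually_elim
      case (elim n)
      then have "(l2n (f n))\<^sup>2 \<le> C\<^sup>2" by (intro power_mono l2n_nonneg)
      then show ?case unfolding nn_integral_eq_l2n[OF f] by (rule ennreal_leI)
    qed
  qed
  finally show ?thesis using sq_int_if_nn_integral_le[OF assms(5) C(2)] by blast
qed

text \<open>Riesz-Fischer. Completeness is used to extend operators by continuity and to obtain
  compactness from total boundedness.\<close>

instance L2 :: (euclidean_space) banach
proof
  fix X :: "nat \<Rightarrow> 'a L2"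
  assume X: "Cauchy X"
  have "\<forall>n. \<exists>M. \<forall>i\<ge>M. \<forall>j\<ge>M. norm (X i - X j) < (1 / 2) ^ n"
    using X unfolding Cauchy_def dist_norm by simp
  then obtain M where M: "\<And>n i j. i \<ge> M n \<Longrightarrow> j \<ge> M n \<Longrightarrow> norm (X i - X j) < (1 / 2) ^ n" by metis
  \<comment> \<open>The partial sums give \<open>r n \<ge> M n\<close>, and the summand n makes r
    strictly increasing.\<close>
  define r where "r n = (\<Sum>i\<le>n. M i) + n" for n
  have r: "strict_mono r" by (simp add: strict_mono_Suc_iff r_def)
  have rM: "r n \<ge> M n" for n
    using member_le_sum[of n "{..n}" M] by (simp add: r_def)
  have "\<forall>n. \<exists>f. sq_int f \<and> X (r n) = L2_class f" by (metis L2_cases)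
  then obtain f where f: "\<And>n. sq_int (f n)" "\<And>n. X (r n) = L2_class (f n)" by metis
  have [measurable]: "f n \<in> borel_measurable borel" for n using f by blast
  have d: "sq_int (\<lambda>x. f m x - f n x)" "l2n (\<lambda>x. f m x - f n x) = norm (X (r m) - X (r n))" for m n
  proof -
    show "sq_int (\<lambda>x. f m x - f n x)" using f by (intro sq_int_diff)
    then show "l2n (\<lambda>x. f m x - f n x) = norm (X (r m) - X (r n))"
      by (simp add: f L2_class_diff norm_L2_class)
  qed
  \<comment> \<open>Consecutive terms of the subsequence are closer than 2^-n, so the n-th weighted
    square integrates to at most 2^n * 4^-n = 2^-n. The series is therefore finite almost
    everywhere, and the f n converge there.\<close>
  have "(\<integral>\<^sup>+x. (\<Sum>n. ennreal (2 ^ n * (norm (f (Suc n) x - f n x))\<^sup>2)) \<partial>lborel)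
      = (\<Sum>n. \<integral>\<^sup>+x. ennreal (2 ^ n * (norm (f (Suc n) x - f n x))\<^sup>2) \<partial>lborel)"
    by (rule nn_integral_suminf) measurable
  also have "\<dots> \<le> (\<Sum>n. ennreal ((1 / 2) ^ n))"
  proof (intro suminf_le summableI)
    fix n
    have "l2n (\<lambda>x. f (Suc n) x - f n x) \<le> (1 / 2) ^ n"
      unfolding d(2) using M[of n "r (Suc n)" "r n"] rM[of n] strict_monoD[OF r, of n "Suc n"] by simp
    then have "(l2n (\<lambda>x. f (Suc n) x - f n x))\<^sup>2 \<le> ((1 / 2) ^ n)\<^sup>2"
      by (intro power_mono l2n_nonneg)
    then have "2 ^ n * (l2n (\<lambda>x. f (Suc n) x - f n x))\<^sup>2 \<le> 2 ^ n * ((1 / 2) ^ n)\<^sup>2" by simp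
    also have "\<dots> = (1 / 2) ^ n" by (simp add: power2_eq_square flip: power_mult_distrib)
    finally have "ennreal (2 ^ n * (l2n (\<lambda>x. f (Suc n) x - f n x))\<^sup>2) \<le> ennreal ((1 / 2) ^ n)"
      by (rule ennreal_leI)
    moreover have "(\<integral>\<^sup>+x. ennreal (2 ^ n * (norm (f (Suc n) x - f n x))\<^sup>2) \<partial>lborel)
        = ennreal (2 ^ n * (l2n (\<lambda>x. f (Suc n) x - f n x))\<^sup>2)"
      by (simp add: ennreal_mult nn_integral_cmult nn_integral_eq_l2n[OF d(1)])
    ultimately show "(\<integral>\<^sup>+x. ennreal (2 ^ n * (norm (f (Suc n) x - f n x))\<^sup>2) \<partial>lborel) \<le> ennreal ((1 / 2) ^ n)"
      by simp
  qed
  also have "\<dots> = ennreal (\<Sum>n. (1 / 2) ^ n)"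
    by (rule suminf_ennreal2) (auto intro: summable_geometric)
  also have "\<dots> < \<infinity>" by simp
  finally have "(\<integral>\<^sup>+x. (\<Sum>n. ennreal (2 ^ n * (norm (f (Suc n) x - f n x))\<^sup>2)) \<partial>lborel) \<noteq> \<infinity>" by simp
  then have "AE x in lborel. (\<Sum>n. ennreal (2 ^ n * (norm (f (Suc n) x - f n x))\<^sup>2)) \<noteq> \<infinity>"
    by (intro nn_integral_noteq_infinite) measurable
  then have lim: "AE x in lborel. (\<lambda>n. f n x) \<longlonglongrightarrow> lim (\<lambda>n. f n x)"
    by eventually_elim (drule convergent_if_weighted_summable, simp add: convergent_LIMSEQ_iff)
  define g where "g x = lim (\<lambda>n. f n x)" for x
  have [measurable]: "g \<in> borel_measurable borel"
    unfolding g_def[abs_def] by (rule borel_measurable_lim_metric) measurable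
  \<comment> \<open>Fatou's lemma, with m fixed and n tending to infinity, turns the Cauchy estimate
    into an estimate of the distance to the limit; it also yields the square integrability of
    g.\<close>
  have close: "sq_int (\<lambda>x. f m x - g x) \<and> l2n (\<lambda>x. f m x - g x) \<le> e"
    if e: "e > 0" "\<And>i j. i \<ge> N \<Longrightarrow> j \<ge> N \<Longrightarrow> norm (X i - X j) < e" and m: "m \<ge> N" for e N m
  proof -
    have rn: "r n \<ge> N" if "n \<ge> N" for n using seq_suble[OF r, of n] that by simp
    have ev: "\<forall>\<^sub>F n in sequentially. l2n (\<lambda>x. f m x - f n x) \<le> e"
      using eventually_ge_at_top[of N]
    proof eventually_elim
      case (elim n)
      then show ?case unfolding d(2) using e(2)[OF rn[OF m] rn[OF elim]] by simp
    qed
    have "AE x in lborel. (\<lambda>n. f m x - f n x) \<longlonglongrightarrow> f m x - g x"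
      using lim unfolding g_def by eventually_elim (intro tendsto_intros)
    from l2_Fatou[OF d(1) ev _ this] e(1) show ?thesis by (simp del: borel_measurable_diff)
  qed
  have N: "\<exists>N. \<forall>i\<ge>N. \<forall>j\<ge>N. norm (X i - X j) < e" if "e > 0" for e
    using X that unfolding Cauchy_def dist_norm by simp
  have g: "sq_int g"
  proof -
    obtain N where "\<forall>i\<ge>N. \<forall>j\<ge>N. norm (X i - X j) < 1" using N[of 1] by auto
    then have "sq_int (\<lambda>x. f N x - g x)" using close[of 1 N N] by simp
    from sq_int_diff[OF f(1)[of N] this] show ?thesis by simp
  qed
  have "(X \<circ> r) \<longlonglongrightarrow> L2_class g"
    unfolding LIMSEQ_iff
  proof (intro allI impI)
    fix e :: real assume e: "e > 0"
    obtain N' where N': "\<forall>i\<ge>N'. \<forall>j\<ge>N'. norm (X i - X j) < e / 2" using N[of "e / 2"] e by auto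
    have "norm ((X \<circ> r) m - L2_class g) < e" if "m \<ge> N'" for m
      using close[of "e / 2" N' m] N' that e g f by (simp add: L2_class_diff norm_L2_class)
    then show "\<exists>no. \<forall>n\<ge>no. norm ((X \<circ> r) n - L2_class g) < e" by blast
  qed
  then show "convergent X"
    using Cauchy_converges_subseq[OF X r] by (auto simp: convergent_def)
qed

lemma norm_scaleC_L2: "norm (scaleC_L2 c F) = norm c * norm F"
proof -
  obtain f where "sq_int f" "F = L2_class f" by (rule L2_cases)
  then show ?thesis
    using l2norm_cmult[of c f] by (simp add: L2_class_scaleC norm_L2_class sq_int_cmult flip: l2norm_eq_l2n)
qed

lemma scaleC_L2_add_right: "scaleC_L2 c (F + G) = scaleC_L2 c F + scaleC_L2 c G"
proof -
  obtain f g where "sq_int f" "F = L2_class f" "sq_int g" "G = L2_class g" by (metis L2_cases)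
  then show ?thesis by (simp add: L2_class_add L2_class_scaleC sq_int_add sq_int_cmult distrib_left)
qed

lemma scaleC_L2_add_left: "scaleC_L2 (c + d) F = scaleC_L2 c F + scaleC_L2 d F"
proof -
  obtain f where "sq_int f" "F = L2_class f" by (metis L2_cases)
  then show ?thesis by (simp add: L2_class_add L2_class_scaleC sq_int_cmult distrib_right)
qed

lemma scaleC_L2_scaleC: "scaleC_L2 c (scaleC_L2 d F) = scaleC_L2 (c * d) F"
proof -
  obtain f where "sq_int f" "F = L2_class f" by (metis L2_cases)
  then show ?thesis by (simp add: L2_class_scaleC sq_int_cmult mult.assoc)
qed

lemma bounded_linear_scaleC_L2: "bounded_linear (scaleC_L2 c)"
  by (rule bounded_linear_intro[where K = "norm c"])
    (simp_all add: scaleC_L2_add_right scaleR_L2_def scaleC_L2_scaleC norm_scaleC_L2 mult.commute)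

lemma bounded_linear_scaleC_L2_left: "bounded_linear (\<lambda>c. scaleC_L2 c F)"
  by (rule bounded_linear_intro[where K = "norm F"])
    (simp_all add: scaleC_L2_add_left scaleR_L2_def scaleC_L2_scaleC norm_scaleC_L2 scaleR_conv_of_real)

section \<open>Integral operators with bounded kernel\<close>

text \<open>A dense subspace on which integral operators with bounded kernel are given pointwise by
  absolutely convergent integrals.\<close>

definition L12 :: "('a::euclidean_space \<Rightarrow> complex) set"
  where "L12 = {v. sq_int v \<and> integrable lborel v}"

definition kop :: "('a::euclidean_space \<times> 'a \<Rightarrow> complex) \<Rightarrow> ('a \<Rightarrow> complex) \<Rightarrow> 'a \<Rightarrow> complex"
  where "kop k v x = (LINT y|lborel. k (x, y) * v y)"

definition bounded_kernel :: "('a::euclidean_space \<times> 'a \<Rightarrow> complex) \<Rightarrow> bool"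
  where "bounded_kernel k \<longleftrightarrow> k \<in> borel_measurable borel \<and> (\<exists>M. \<forall>z. norm (k z) \<le> M)"

definition kernel_bound :: "('a::euclidean_space \<times> 'a \<Rightarrow> complex) \<Rightarrow> real \<Rightarrow> bool"
  where "kernel_bound k K \<longleftrightarrow> bounded_kernel k \<and> 0 \<le> K \<and>
    (\<forall>v\<in>L12. sq_int (kop k v) \<and> l2n (kop k v) \<le> K * l2n v)"

lemma L12_add: "v \<in> L12 \<Longrightarrow> w \<in> L12 \<Longrightarrow> (\<lambda>x. v x + w x) \<in> L12"
  and L12_cmult: "v \<in> L12 \<Longrightarrow> (\<lambda>x. c * v x) \<in> L12"
  and L12_diff: "v \<in> L12 \<Longrightarrow> w \<in> L12 \<Longrightarrow> (\<lambda>x. v x - w x) \<in> L12"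
  using sq_int_add[of v w] sq_int_cmult[of v c] sq_int_diff[of v w] by (auto simp: L12_def)

lemma integrable_kernel:
  assumes "bounded_kernel k" "integrable lborel v"
  shows "integrable lborel (\<lambda>y. k (x, y) * v y)"
proof -
  obtain M where M: "\<And>z. norm (k z) \<le> M" using assms by (auto simp: bounded_kernel_def)
  have M0: "0 \<le> M" using M[of undefined] norm_ge_zero order_trans by blast
  have [measurable]: "v \<in> borel_measurable borel" "k \<in> borel_measurable (borel \<Otimes>\<^sub>M borel)"
    using assms by (auto simp: bounded_kernel_def borel_prod dest: borel_measurable_integrable)
  show ?thesis
  proof (rule Bochner_Integration.integrable_bound)
    show "integrable lborel (\<lambda>y. M * norm (v y))" using assms by simp
    show "AE y in lborel. norm (k (x, y) * v y) \<le> norm (M * norm (v y))"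
    proof (rule AE_I2)
      fix y
      show "norm (k (x, y) * v y) \<le> norm (M * norm (v y))"
        using mult_right_mono[OF M, of "norm (v y)" "(x, y)"] M0 by (simp add: norm_mult)
    qed
  qed measurable
qed

lemma kop_add: "bounded_kernel k \<Longrightarrow> v \<in> L12 \<Longrightarrow> w \<in> L12 \<Longrightarrow> kop k (\<lambda>x. v x + w x) = (\<lambda>x. kop k v x + kop k w x)"
  by (simp add: fun_eq_iff kop_def L12_def distrib_left integrable_kernel)

lemma kop_diff: "bounded_kernel k \<Longrightarrow> v \<in> L12 \<Longrightarrow> w \<in> L12 \<Longrightarrow> kop k (\<lambda>x. v x - w x) = (\<lambda>x. kop k v x - kop k w x)"
  by (simp add: fun_eq_iff kop_def L12_def right_diff_distrib integrable_kernel)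

lemma kop_cmult: "kop k (\<lambda>x. c * v x) = (\<lambda>x. c * kop k v x)"
  by (simp add: fun_eq_iff kop_def mult.left_commute)

text \<open>Cutting off at large balls: the product of g with the indicator of a ball is integrable,
  being a product of two square integrable functions.\<close>

lemma L12_dense:
  fixes F :: "'a::euclidean_space L2"
  assumes "e > 0"
  obtains v where "v \<in> L12" "norm (L2_class v - F) < e"
proof -
  obtain g where g: "sq_int g" "F = L2_class g" by (rule L2_cases)
  have [measurable]: "g \<in> borel_measurable borel" using g by blast
  define h where "h n x = (indicator (ball 0 (real n)) x :: complex)" for n :: nat and x :: 'a
  have h: "sq_int (h n)" for n
  proof -
    have "integrable lborel (indicator (ball (0::'a) (real n)) :: 'a \<Rightarrow> real)"
      using emeasure_lborel_ball_finite[of "0::'a" "real n"] by (simp add: integrable_indicator_iff)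
    moreover have "(norm (h n x))\<^sup>2 = indicator (ball 0 (real n)) x" for x by (simp add: h_def indicator_def)
    moreover have "h n \<in> borel_measurable borel" unfolding h_def[abs_def] by (intro borel_measurable_indicator) simp
    ultimately show ?thesis by simp
  qed
  have v: "(\<lambda>x. h n x * g x) \<in> L12" for n
    using sq_int_bounded_mult(1)[OF g(1), of "h n"] integrable_mult_sq_int[OF h g(1)] h
    by (auto simp: L12_def h_def indicator_def)
  have "(\<lambda>n. LINT x|lborel. (norm (h n x * g x - g x))\<^sup>2) \<longlonglongrightarrow> (LINT x|(lborel :: 'a measure). 0 :: real)"
  proof (rule integral_dominated_convergence)
    show "integrable lborel (\<lambda>x. (norm (g x))\<^sup>2)" using g by blast
    show "AE x in lborel. (\<lambda>n. (norm (h n x * g x - g x))\<^sup>2) \<longlonglongrightarrow> 0"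
    proof (rule AE_I2)
      fix x :: 'a
      obtain N :: nat where N: "norm x < N" using reals_Archimedean2 by blast
      have "\<forall>\<^sub>F n in sequentially. (norm (h n x * g x - g x))\<^sup>2 = 0"
        using eventually_ge_at_top[of N] by eventually_elim (use N in \<open>simp add: h_def indicator_def\<close>)
      then show "(\<lambda>n. (norm (h n x * g x - g x))\<^sup>2) \<longlonglongrightarrow> 0" by (rule tendsto_eventually)
    qed
    show "AE x in lborel. norm ((norm (h n x * g x - g x))\<^sup>2) \<le> (norm (g x))\<^sup>2" for n
      by (intro AE_I2) (simp add: h_def indicator_def)
    have [measurable]: "h n \<in> borel_measurable borel" for n using h by blast
    show "(\<lambda>x. (norm (h n x * g x - g x))\<^sup>2) \<in> borel_measurable lborel" for n by measurable
  qed simp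
  then have "(\<lambda>n. sqrt (LINT x|lborel. (norm (h n x * g x - g x))\<^sup>2)) \<longlonglongrightarrow> sqrt 0"
    by (intro tendsto_real_sqrt) simp
  then have "(\<lambda>n. norm (L2_class (\<lambda>x. h n x * g x) - F)) \<longlonglongrightarrow> 0"
    using v g by (simp add: L2_class_diff norm_L2_class L12_def sq_int_diff l2n_def)
  then obtain n where "norm (L2_class (\<lambda>x. h n x * g x) - F) < e"
    using assms by (auto simp: LIMSEQ_iff)
  with v that show thesis by blast
qed

lemma kop_cong_AE:
  assumes "bounded_kernel k" "v \<in> L12" "w \<in> L12" "AE x in lborel. v x = w x"
  shows "kop k v = kop k w"
proof
  fix x
  show "kop k v x = kop k w x"
    unfolding kop_def
  proof (rule integral_cong_AE)
    show "AE y in lborel. k (x, y) * v y = k (x, y) * w y" using assms(4) by eventually_elim simp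
  qed (rule borel_measurable_integrable, rule integrable_kernel[OF assms(1)], use assms in \<open>simp add: L12_def\<close>)+
qed

text \<open>Extension by uniform continuity from the dense image of \<open>L12\<close>; additivity,
  complex homogeneity and the norm bound pass to the limit along sequences.\<close>

lemma kernel_bound_imp_operator:
  fixes k :: "'a::euclidean_space \<times> 'a \<Rightarrow> complex"
  assumes k: "kernel_bound k K"
  obtains T where "bounded_operator T" "\<And>F. norm (T F) \<le> K * norm F"
    "\<And>v. v \<in> L12 \<Longrightarrow> T (L2_class v) = L2_class (kop k v)"
proof -
  have bk: "bounded_kernel k" and K0: "0 \<le> K"
    and kb: "\<And>v. v \<in> L12 \<Longrightarrow> sq_int (kop k v)" "\<And>v. v \<in> L12 \<Longrightarrow> l2n (kop k v) \<le> K * l2n v"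
    using k by (auto simp: kernel_bound_def)
  have sq: "v \<in> L12 \<Longrightarrow> sq_int v" for v :: "'a \<Rightarrow> complex" by (simp add: L12_def)
  \<comment> \<open>The choice of a representative does not matter, because \<open>kop\<close> does
    not distinguish functions that agree almost everywhere.\<close>
  define f where "f F = L2_class (kop k (SOME v. v \<in> L12 \<and> L2_class v = F))" for F
  have f: "f (L2_class v) = L2_class (kop k v)" if v: "v \<in> L12" for v
  proof -
    define w where "w = (SOME w. w \<in> L12 \<and> L2_class w = L2_class v)"
    have w: "w \<in> L12" "L2_class w = L2_class v"
      unfolding w_def using someI[of "\<lambda>w. w \<in> L12 \<and> L2_class w = L2_class v" v] v by blast+
    then have "AE x in lborel. w x = v x" using L2_class_eq_iff[OF sq sq] v by blast
    then have "kop k w = kop k v" using kop_cong_AE[OF bk w(1) v] by blast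
    then show ?thesis by (simp add: f_def w_def)
  qed
  have lip: "dist (f x) (f y) \<le> K * dist x y" if xy: "x \<in> L2_class ` L12" "y \<in> L2_class ` L12" for x y
  proof -
    obtain v w where vw: "v \<in> L12" "w \<in> L12" "x = L2_class v" "y = L2_class w" using xy by blast
    have "f x - f y = L2_class (kop k (\<lambda>x. v x - w x))"
      using vw kb(1) by (simp add: f L2_class_diff kop_diff[OF bk])
    moreover have "x - y = L2_class (\<lambda>x. v x - w x)" using vw sq by (simp add: L2_class_diff)
    ultimately show ?thesis
      using kb L12_diff[OF vw(1,2)] sq by (simp add: dist_norm norm_L2_class)
  qed
  have "uniformly_continuous_on (L2_class ` L12) f"
    by (rule lipschitz_on_uniformly_continuous[of K]) (use lip K0 in \<open>auto simp: lipschitz_on_def\<close>)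
  then obtain T where T: "uniformly_continuous_on (closure (L2_class ` L12)) T"
    "\<And>x. x \<in> L2_class ` L12 \<Longrightarrow> f x = T x"
    using uniformly_continuous_on_extension_on_closure by metis
  have "x \<in> closure (L2_class ` L12)" for x :: "'a L2"
    unfolding closure_approachable dist_norm by (metis L12_dense imageI)
  then have "closure (L2_class ` L12) = (UNIV :: 'a L2 set)" by blast
  with T(1) have cont: "isCont T x" for x
    using uniformly_continuous_imp_continuous by (metis UNIV_I continuous_on_eq_continuous_at open_UNIV)
  have Tv: "T (L2_class v) = L2_class (kop k v)" if "v \<in> L12" for v using T(2) f that by fastforce
  have seq: "\<exists>s. (\<forall>n. s n \<in> L12) \<and> (\<lambda>n. L2_class (s n)) \<longlonglongrightarrow> F" for F :: "'a L2"
  proof -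
    have "\<exists>v\<in>L12. norm (L2_class v - F) < inverse (real (Suc n))" for n
      using L12_dense[of "inverse (real (Suc n))" F] by auto
    then obtain s where s: "\<And>n. s n \<in> L12" "\<And>n. norm (L2_class (s n) - F) < inverse (real (Suc n))" by metis
    have "(\<lambda>n. L2_class (s n) - F) \<longlonglongrightarrow> 0"
      by (rule Lim_null_comparison[OF _ LIMSEQ_inverse_real_of_nat])
        (use s(2) in \<open>auto intro: always_eventually less_imp_le\<close>)
    then have "(\<lambda>n. L2_class (s n)) \<longlonglongrightarrow> F" by (rule LIM_zero_cancel)
    with s(1) show ?thesis by blast
  qed
  have add: "T (F + G) = T F + T G" for F G
  proof -
    obtain s t where st: "\<And>n. s n \<in> L12" "(\<lambda>n. L2_class (s n)) \<longlonglongrightarrow> F" "\<And>n. t n \<in> L12" "(\<lambda>n. L2_class (t n)) \<longlonglongrightarrow> G"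
      using seq by metis
    have "T (L2_class (s n) + L2_class (t n)) = T (L2_class (s n)) + T (L2_class (t n))" for n
      by (simp only: L2_class_add[OF sq[OF st(1)] sq[OF st(3)]] Tv[OF L12_add[OF st(1,3)]] Tv[OF st(1)] Tv[OF st(3)]
          kop_add[OF bk st(1,3)] L2_class_add[OF kb(1)[OF st(1)] kb(1)[OF st(3)]])
    moreover have "(\<lambda>n. T (L2_class (s n) + L2_class (t n))) \<longlonglongrightarrow> T (F + G)"
      by (intro isCont_tendsto_compose[OF cont] tendsto_add st)
    moreover have "(\<lambda>n. T (L2_class (s n)) + T (L2_class (t n))) \<longlonglongrightarrow> T F + T G"
      by (intro tendsto_add isCont_tendsto_compose[OF cont] st)
    ultimately show ?thesis using LIMSEQ_unique by auto
  qed
  have scale: "T (scaleC_L2 c F) = scaleC_L2 c (T F)" for c F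
  proof -
    obtain s where s: "\<And>n. s n \<in> L12" "(\<lambda>n. L2_class (s n)) \<longlonglongrightarrow> F" using seq by metis
    have "T (scaleC_L2 c (L2_class (s n))) = scaleC_L2 c (T (L2_class (s n)))" for n
      by (simp only: L2_class_scaleC[OF sq[OF s(1)]] Tv[OF L12_cmult[OF s(1)]] Tv[OF s(1)] kop_cmult
          L2_class_scaleC[OF kb(1)[OF s(1)]])
    moreover have "(\<lambda>n. T (scaleC_L2 c (L2_class (s n)))) \<longlonglongrightarrow> T (scaleC_L2 c F)"
      by (intro isCont_tendsto_compose[OF cont] bounded_linear.tendsto[OF bounded_linear_scaleC_L2] s)
    moreover have "(\<lambda>n. scaleC_L2 c (T (L2_class (s n)))) \<longlonglongrightarrow> scaleC_L2 c (T F)"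
      by (intro bounded_linear.tendsto[OF bounded_linear_scaleC_L2] isCont_tendsto_compose[OF cont] s)
    ultimately show ?thesis using LIMSEQ_unique by auto
  qed
  have norm: "norm (T F) \<le> K * norm F" for F
  proof -
    obtain s where s: "\<And>n. s n \<in> L12" "(\<lambda>n. L2_class (s n)) \<longlonglongrightarrow> F" using seq by metis
    have "norm (T (L2_class (s n))) \<le> K * norm (L2_class (s n))" for n
      using s kb sq by (simp add: Tv norm_L2_class)
    then show ?thesis
      by (intro LIMSEQ_le[OF tendsto_norm[OF isCont_tendsto_compose[OF cont s(2)]] tendsto_mult[OF tendsto_const tendsto_norm[OF s(2)]]]) auto
  qed
  have "bounded_linear T"
    by (rule bounded_linear_intro[where K = K]) (simp_all add: add scale norm scaleR_L2_def mult.commute)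
  then show thesis
    using that[of T] scale norm Tv by (simp add: bounded_operator_def)
qed

text \<open>A finite Minkowski sum of continuous images of closed discs. Such a set contains the
  image of a bounded set under a finite rank operator.\<close>

lemma compact_finite_combinations:
  assumes "finite J"
  shows "compact {\<Sum>j\<in>J. scaleC_L2 (c j) (G j) | c. \<forall>j\<in>J. norm (c j) \<le> R}"
  using assms
proof (induction J rule: finite_induct)
  case empty
  then show ?case by simp
next
  case (insert i J)
  let ?S = "{\<Sum>j\<in>J. scaleC_L2 (c j) (G j) | c. \<forall>j\<in>J. norm (c j) \<le> R}"
  have "compact ((\<lambda>c. scaleC_L2 c (G i)) ` cball 0 R)"
    by (intro compact_continuous_image compact_cball linear_continuous_on bounded_linear_scaleC_L2_left)
  from compact_sums[OF this insert.IH]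
  have "compact {x + y | x y. x \<in> (\<lambda>c. scaleC_L2 c (G i)) ` cball 0 R \<and> y \<in> ?S}" .
  moreover have "{x + y | x y. x \<in> (\<lambda>c. scaleC_L2 c (G i)) ` cball 0 R \<and> y \<in> ?S} =
      {\<Sum>j\<in>insert i J. scaleC_L2 (c j) (G j) | c. \<forall>j\<in>insert i J. norm (c j) \<le> R}" (is "?A = ?B")
  proof
    show "?A \<subseteq> ?B"
    proof
      fix z assume "z \<in> ?A"
      then obtain d c where dc: "norm d \<le> R" "\<forall>j\<in>J. norm (c j) \<le> R" "z = scaleC_L2 d (G i) + (\<Sum>j\<in>J. scaleC_L2 (c j) (G j))"
        by auto
      have "(\<Sum>j\<in>J. scaleC_L2 ((c(i := d)) j) (G j)) = (\<Sum>j\<in>J. scaleC_L2 (c j) (G j))"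
        by (intro sum.cong refl) (use insert in auto)
      then have "z = (\<Sum>j\<in>insert i J. scaleC_L2 ((c(i := d)) j) (G j))" "\<forall>j\<in>insert i J. norm ((c(i := d)) j) \<le> R"
        using dc insert by auto
      then show "z \<in> ?B" by blast
    qed
    show "?B \<subseteq> ?A" using insert by fastforce
  qed
  ultimately show ?case by simp
qed

text \<open>The image of a bounded set stays close to a compact set of finite combinations, hence is
  totally bounded; by completeness its closure is compact.\<close>

lemma compact_operator_if_finite_rank_approx:
  fixes k :: "'a::euclidean_space \<times> 'a \<Rightarrow> complex"
  assumes T: "bounded_operator T" "\<And>F. norm (T F) \<le> K * norm F" "\<And>v. v \<in> L12 \<Longrightarrow> T (L2_class v) = L2_class (kop k v)"
    and sq: "\<And>v. v \<in> L12 \<Longrightarrow> sq_int (kop k v)"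
    and approx: "\<And>e. e > 0 \<Longrightarrow> \<exists>(J :: 'i set) X Y. finite J \<and> (\<forall>j\<in>J. sq_int (X j) \<and> sq_int (Y j)) \<and>
      (\<forall>v\<in>L12. l2n (\<lambda>x. kop k v x - (\<Sum>j\<in>J. (LINT y|lborel. Y j y * v y) * X j x)) \<le> e * l2n v)"
  shows "compact_operator T"
  unfolding compact_operator_def
proof (intro conjI allI impI T(1))
  fix B :: "'a L2 set" assume "bounded B"
  then obtain R where R: "R > 0" "\<And>F. F \<in> B \<Longrightarrow> norm F \<le> R" by (auto simp: bounded_pos)
  interpret T: bounded_linear T using T(1) by (simp add: bounded_operator_def)
  have tb: "\<exists>N. finite N \<and> T ` B \<subseteq> (\<Union>x\<in>N. ball x e)" if e: "e > 0" for e
  proof -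
    \<comment> \<open>An error of e/4 is allowed for the net of S, for the finite rank approximation
      and for replacing F by a function v in \<open>L12\<close>. Since v is within 1 of F, its norm
      is at most R + 1.\<close>
    define e1 where "e1 = e / 4 / (R + 1)"
    have e1: "e1 > 0" using e R by (simp add: e1_def)
    obtain J :: "'i set" and X Y where J: "finite J" "\<forall>j\<in>J. sq_int (X j) \<and> sq_int (Y j)"
      "\<And>v. v \<in> L12 \<Longrightarrow> l2n (\<lambda>x. kop k v x - (\<Sum>j\<in>J. (LINT y|lborel. Y j y * v y) * X j x)) \<le> e1 * l2n v"
      using approx[OF e1] by blast
    define R1 where "R1 = (\<Sum>j\<in>J. l2n (Y j)) * (R + 1)"
    define S where "S = {\<Sum>j\<in>J. scaleC_L2 (c j) (L2_class (X j)) | c. \<forall>j\<in>J. norm (c j) \<le> R1}"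
    have "compact S" unfolding S_def by (rule compact_finite_combinations[OF J(1)])
    then obtain N where N: "finite N" "S \<subseteq> (\<Union>x\<in>N. ball x (e / 4))"
      using e unfolding compact_eq_totally_bounded by (metis divide_pos_pos zero_less_numeral)
    have "T ` B \<subseteq> (\<Union>x\<in>N. ball x e)"
    proof
      fix H assume "H \<in> T ` B"
      then obtain F where F: "F \<in> B" "H = T F" by blast
      define e2 where "e2 = min 1 (e / 4 / (\<bar>K\<bar> + 1))"
      have e2: "e2 > 0" using e by (simp add: e2_def)
      obtain v where v: "v \<in> L12" "norm (L2_class v - F) < e2" using L12_dense[OF e2] by blast
      have vsq: "sq_int v" using v by (simp add: L12_def)
      have "norm (L2_class v) \<le> norm (L2_class v - F) + norm F" by (metis add.commute norm_triangle_sub)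
      then have nv: "l2n v \<le> R + 1" using v(2) R(2)[OF F(1)] vsq by (simp add: norm_L2_class e2_def)
      define G where "G = (\<Sum>j\<in>J. scaleC_L2 (LINT y|lborel. Y j y * v y) (L2_class (X j)))"
      have cj: "norm (LINT y|lborel. Y j y * v y) \<le> R1" if "j \<in> J" for j
      proof -
        have "norm (LINT y|lborel. Y j y * v y) \<le> l2n (Y j) * l2n v"
          using l2_Cauchy_Schwarz J(2) that vsq by blast
        also have "\<dots> \<le> R1"
          unfolding R1_def using nv R J(1) that
          by (intro mult_mono member_le_sum[of j J "\<lambda>j. l2n (Y j)"]) (auto simp: l2n_nonneg sum_nonneg)
        finally show ?thesis .
      qed
      then have "G \<in> S"
        unfolding G_def S_def by (intro CollectI exI[of _ "\<lambda>j. LINT y|lborel. Y j y * v y"] conjI refl ballI)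
      then obtain x where x: "x \<in> N" "dist x G < e / 4" using N(2) by auto
      have Geq: "sq_int (\<lambda>x. \<Sum>j\<in>J. (LINT y|lborel. Y j y * v y) * X j x) \<and>
          G = L2_class (\<lambda>x. \<Sum>j\<in>J. (LINT y|lborel. Y j y * v y) * X j x)"
      proof -
        have "sq_int (\<lambda>x. \<Sum>j\<in>I. c j * X j x) \<and> (\<Sum>j\<in>I. scaleC_L2 (c j) (L2_class (X j))) = L2_class (\<lambda>x. \<Sum>j\<in>I. c j * X j x)"
          if "I \<subseteq> J" for I c
          using finite_subset[OF that J(1)] that
        proof (induction I rule: finite_induct)
          case empty
          then show ?case by (simp add: zero_L2_def)
        next
          case (insert i I)
          then have i: "sq_int (\<lambda>x. c i * X i x)" and IH: "sq_int (\<lambda>x. \<Sum>j\<in>I. c j * X j x)"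
            "(\<Sum>j\<in>I. scaleC_L2 (c j) (L2_class (X j))) = L2_class (\<lambda>x. \<Sum>j\<in>I. c j * X j x)"
            using sq_int_cmult J(2) by auto
          show ?case
            using sq_int_add[OF i IH(1)] insert J(2) IH i by (simp add: L2_class_scaleC L2_class_add)
        qed
        from this[of J] show ?thesis by (simp add: G_def)
      qed
      have "norm (T (L2_class v) - G) \<le> e1 * l2n v"
        using Geq J(3)[OF v(1)] sq[OF v(1)] by (simp add: T(3)[OF v(1)] L2_class_diff norm_L2_class sq_int_diff)
      also have "\<dots> \<le> e1 * (R + 1)" using nv e1 by (intro mult_left_mono) auto
      also have "\<dots> = e / 4" by (rule nonzero_eq_divide_eq[THEN iffD1, OF _ e1_def]) (use R(1) in simp)
      finally have 1: "dist G (T (L2_class v)) \<le> e / 4" by (simp add: dist_norm norm_minus_commute)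
      have "norm (T (L2_class v) - T F) \<le> K * norm (L2_class v - F)"
        using T(2)[of "L2_class v - F"] by (simp add: T.diff)
      also have "\<dots> \<le> (\<bar>K\<bar> + 1) * e2" using v(2) by (intro mult_mono) auto
      also have "\<dots> \<le> (\<bar>K\<bar> + 1) * (e / 4 / (\<bar>K\<bar> + 1))" by (intro mult_left_mono) (auto simp: e2_def)
      also have "\<dots> = e / 4"
        unfolding times_divide_eq_right[of "\<bar>K\<bar> + 1" "e / 4"]
        by (rule nonzero_mult_div_cancel_left) (use abs_ge_zero[of K] in linarith)
      finally have 2: "dist (T (L2_class v)) H \<le> e / 4" by (simp add: dist_norm F)
      have "dist x H \<le> dist x G + (dist G (T (L2_class v)) + dist (T (L2_class v)) H)"
        by (intro order_trans[OF dist_triangle[of x H G]] add_left_mono dist_triangle)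
      then have "dist x H < e" using x(2) 1 2 e by linarith
      then show "H \<in> (\<Union>x\<in>N. ball x e)" using x(1) by auto
    qed
    with N(1) show ?thesis by blast
  qed
  show "compact (closure (T ` B))"
    unfolding compact_eq_totally_bounded
  proof (intro conjI allI impI)
    show "complete (closure (T ` B))" by (simp add: complete_eq_closed)
    fix e :: real assume e: "e > 0"
    then obtain N where N: "finite N" "T ` B \<subseteq> (\<Union>x\<in>N. ball x (e / 2))" using tb[of "e / 2"] by auto
    have "closure (T ` B) \<subseteq> (\<Union>x\<in>N. ball x e)"
    proof
      fix y assume "y \<in> closure (T ` B)"
      then obtain z where "z \<in> T ` B" "dist z y < e / 2" using e by (meson closure_approachable half_gt_zero)
      moreover then obtain x where "x \<in> N" "dist x z < e / 2" using N(2) by auto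
      ultimately show "y \<in> (\<Union>x\<in>N. ball x e)" using dist_triangle_half_r[of z x e y] by (auto simp: dist_commute)
    qed
    with N(1) show "\<exists>k. finite k \<and> closure (T ` B) \<subseteq> (\<Union>x\<in>k. ball x e)" by blast
  qed
qed

section \<open>From local pairings to operator bounds\<close>

lemma l2n_triangle:
  assumes "sq_int f" "sq_int g"
  shows "l2n (\<lambda>x. f x + g x) \<le> l2n f + l2n g"
  using norm_triangle_ineq[of "L2_class f" "L2_class g"] sq_int_add[OF assms] assms
  by (simp only: L2_class_add norm_L2_class)

lemma sq_int_dominated:
  assumes "f \<in> borel_measurable borel" "sq_int g" "\<And>x. norm (f x) \<le> norm (g x)"
  shows "sq_int f" "l2n f \<le> l2n g"
proof -
  have le: "(norm (f x))\<^sup>2 \<le> (norm (g x))\<^sup>2" for x using assms(3) by (intro power_mono) auto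
  have i: "integrable lborel (\<lambda>x. (norm (f x))\<^sup>2)"
    by (rule Bochner_Integration.integrable_bound[of _ "\<lambda>x. (norm (g x))\<^sup>2"]) (use assms le in auto)
  then show "sq_int f" using assms by blast
  show "l2n f \<le> l2n g"
    unfolding l2n_def by (intro real_sqrt_le_mono integral_mono i le) (use assms in blast)
qed

lemma l2n_cmult: "sq_int f \<Longrightarrow> l2n (\<lambda>x. c * f x) = norm c * l2n f"
  using norm_scaleC_L2[of c "L2_class f"] sq_int_cmult[of f c] by (simp only: L2_class_scaleC norm_L2_class)

lemma vfloor_set_measurable: "G \<in> sets borel \<Longrightarrow> {x. vfloor x \<in> G} \<in> sets borel"
  using measurable_sets[OF vfloor_measurable, of G] by (simp add: vimage_def)

lemma vfloor_finite_measurable: "finite G \<Longrightarrow> {x. vfloor x \<in> G} \<in> sets borel"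
  by (intro vfloor_set_measurable borel_closed finite_imp_closed)

lemma sum_indicator_unit_cube:
  fixes G :: "'a::euclidean_space set"
  assumes "finite G"
  shows "(\<Sum>k\<in>G. indicator (unit_cube k) x) = (indicator {x. vfloor x \<in> G} x :: 'b::semiring_1)"
  using assms by (simp add: unit_cube_def indicator_def)

lemma sq_int_indicator_cubes:
  assumes "finite G" "G \<subseteq> lattice"
  shows "sq_int (\<lambda>x. indicator {x. vfloor x \<in> G} x)" "l2n (\<lambda>x. indicator {x. vfloor x \<in> G} x) = sqrt (card G)"
    "integrable lborel (indicator {x. vfloor x \<in> G} :: 'a::euclidean_space \<Rightarrow> real)"
proof -
  have G: "{x. vfloor x \<in> G} \<in> sets borel" using assms by (intro vfloor_finite_measurable)
  have int: "has_bochner_integral lborel (indicator (unit_cube k) :: 'a \<Rightarrow> real) 1" if "k \<in> G" for k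
    using has_bochner_integral_real_indicator[of "unit_cube k" lborel] emeasure_unit_cube[of k] that assms
    by (auto simp: measure_def)
  have h: "has_bochner_integral lborel (indicator {x. vfloor x \<in> G} :: 'a \<Rightarrow> real) (card G)"
    using has_bochner_integral_sum[of G lborel "\<lambda>k. indicator (unit_cube k) :: 'a \<Rightarrow> real" "\<lambda>_. 1"] int
    by (simp add: sum_indicator_unit_cube[OF assms(1)])
  then show I: "integrable lborel (indicator {x. vfloor x \<in> G} :: 'a \<Rightarrow> real)"
    by (simp add: has_bochner_integral_iff)
  have eq: "(norm (indicator {x. vfloor x \<in> G} x :: complex))\<^sup>2 = indicator {x. vfloor x \<in> G} x" for x :: 'a
    by (simp add: indicator_def)
  have "(\<lambda>x. indicator {x. vfloor x \<in> G} x :: complex) \<in> borel_measurable borel"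
    using G by (intro borel_measurable_indicator)
  then show "sq_int (\<lambda>x. indicator {x. vfloor x \<in> G} x)" using I unfolding eq by blast
  show "l2n (\<lambda>x. indicator {x. vfloor x \<in> G} x) = sqrt (card G)"
    using h unfolding l2n_def eq by (simp add: has_bochner_integral_iff)
qed

lemma kop_measurable [measurable]:
  assumes "bounded_kernel k" "v \<in> L12"
  shows "kop k v \<in> borel_measurable borel"
proof -
  have [measurable]: "v \<in> borel_measurable borel" "k \<in> borel_measurable (borel \<Otimes>\<^sub>M borel)"
    using assms by (auto simp: bounded_kernel_def L12_def borel_prod)
  show ?thesis unfolding kop_def[abs_def] by measurable
qed

lemma norm_kop_le:
  assumes "\<And>z. norm (k z) \<le> M" "v \<in> L12"
  shows "norm (kop k v x) \<le> M * (LINT y|lborel. norm (v y))"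
proof -
  have "norm (kop k v x) \<le> (LINT y|lborel. M * norm (v y))"
    unfolding kop_def
    by (rule norm_integral_le_integral) (use assms in \<open>auto simp: L12_def norm_mult intro: mult_right_mono\<close>)
  then show ?thesis by simp
qed

text \<open>Duality by a single test function: take for w the conjugate of A =
  \<open>kop k v\<close>, cut off to finitely many cubes. The pairing becomes the square of the norm
  of w, and dividing by that norm bounds the cut-off of A by K times the norm of v; Fatou's lemma
  removes the cut-off.\<close>

lemma kernel_bound_if_local_pairings:
  fixes k :: "'a::euclidean_space \<times> 'a \<Rightarrow> complex"
  assumes bk: "bounded_kernel k" and K: "0 \<le> K"
    and pair: "\<And>I w v. finite I \<Longrightarrow> I \<subseteq> lattice \<Longrightarrow> sq_int w \<Longrightarrow> sq_int v \<Longrightarrow>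
      norm (\<Sum>i\<in>I. LINT z|lborel. indicator (unit_cube i) z *\<^sub>R (k z * (w (fst z) * v (snd z)))) \<le> K * (l2n w * l2n v)"
  shows "kernel_bound k K"
proof -
  have "sq_int (kop k v) \<and> l2n (kop k v) \<le> K * l2n v" if v: "v \<in> L12" for v
  proof -
    have vs: "sq_int v" "integrable lborel v" using v by (auto simp: L12_def)
    obtain M where M: "\<And>z. norm (k z) \<le> M" using bk by (auto simp: bounded_kernel_def)
    have [measurable]: "k \<in> borel_measurable borel" "v \<in> borel_measurable borel" using bk vs by (auto simp: bounded_kernel_def)
    define A where "A = kop k v"
    have [measurable]: "A \<in> borel_measurable borel" unfolding A_def by (rule kop_measurable[OF bk v])
    define C where "C = M * (LINT y|lborel. norm (v y))"
    have C: "norm (A x) \<le> C" for x unfolding A_def C_def by (rule norm_kop_le[OF M v])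
    define G where "G n = lattice \<inter> cball (0::'a) (real n)" for n :: nat
    have G: "finite (G n)" "G n \<subseteq> lattice" for n unfolding G_def by (auto intro: finite_lattice_bounded)
    have Gx: "\<forall>\<^sub>F n in sequentially. vfloor x \<in> G n" for x :: 'a
    proof -
      obtain N :: nat where N: "norm (vfloor x) < N" using reals_Archimedean2 by blast
      show ?thesis using eventually_ge_at_top[of N] by eventually_elim (use N in \<open>simp add: G_def\<close>)
    qed
    define U where "U n = {x::'a. vfloor x \<in> G n}" for n
    have [measurable]: "U n \<in> sets borel" for n unfolding U_def using G by (intro vfloor_finite_measurable)
    note U = sq_int_indicator_cubes[OF G, folded U_def]
    define w where "w n x = indicator (U n) x * cnj (A x)" for n x
    have wm: "w n \<in> borel_measurable borel" for n
      unfolding w_def[abs_def] using borel_measurable_continuous_on[OF continuous_on_cnj[OF continuous_on_id], of A borel] by measurable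
    \<comment> \<open>A is bounded because v is integrable, so its restriction to finitely many
      cubes is square integrable before anything is known about A in \<open>L2\<close>.\<close>
    have wle: "norm (w n x) \<le> norm (complex_of_real C * indicator (U n) x)" for n x
      using C[of x] norm_ge_zero[of "A x"] by (auto simp: w_def indicator_def)
    have ws: "sq_int (w n)" for n
      by (rule sq_int_dominated(1)[OF wm sq_int_cmult[OF U(1)] wle])
    have wi: "integrable lborel (w n)" for n
    proof (rule Bochner_Integration.integrable_bound)
      show "integrable lborel (\<lambda>x. C * indicator (U n) x)" using U(3) by simp
      show "w n \<in> borel_measurable lborel" using wm by simp
      show "AE x in lborel. norm (w n x) \<le> norm (C * indicator (U n) x)"
      proof (rule AE_I2)
        fix x show "norm (w n x) \<le> norm (C * indicator (U n) x)"
          using wle[of n x] by (cases "x \<in> U n") (simp_all add: norm_mult)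
      qed
    qed
    have wn: "l2n (w n) \<le> K * l2n v" for n
    proof -
      define H where "H z = k z * (w n (fst z) * v (snd z))" for z
      have Hi: "integrable lborel H"
      proof (rule Bochner_Integration.integrable_bound)
        show "integrable lborel (\<lambda>z. M * norm (w n (fst z) * v (snd z)))"
          using integral_fst_snd_mult(1)[OF wi vs(2)] by simp
        have [measurable]: "w n \<in> borel_measurable borel" by (rule wm)
        have [measurable]: "(\<lambda>z. w n (fst z)) \<in> borel_measurable (borel :: ('a \<times> 'a) measure)" "(\<lambda>z. v (snd z)) \<in> borel_measurable (borel :: ('a \<times> 'a) measure)"
          unfolding borel_prod[symmetric] by measurable
        show "H \<in> borel_measurable lborel" unfolding H_def[abs_def] by measurable
        show "AE z in lborel. norm (H z) \<le> norm (M * norm (w n (fst z) * v (snd z)))"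
        proof (rule AE_I2)
          fix z
          have "norm (H z) \<le> M * norm (w n (fst z) * v (snd z))"
            unfolding H_def norm_mult[of "k z"] by (rule mult_right_mono[OF M]) simp
          then show "norm (H z) \<le> norm (M * norm (w n (fst z) * v (snd z)))" by simp
        qed
      qed
      have Hm [measurable]: "H \<in> borel_measurable borel" using borel_measurable_integrable[OF Hi] by simp
      have int: "(LINT z|lborel. H z) = of_real ((l2n (w n))\<^sup>2)"
      proof -
        have "(LINT z|lborel. H z) = (LINT x|lborel. LINT y|lborel. H (x, y))"
          using lborel_pair.integral_fst'[of H] Hi by (simp add: lborel_prod)
        also have "\<dots> = (LINT x|lborel. w n x * A x)"
          by (intro Bochner_Integration.integral_cong refl) (simp add: H_def A_def kop_def mult_ac flip: integral_mult_right_zero)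
        also have "\<dots> = (LINT x|lborel. complex_of_real ((norm (w n x))\<^sup>2))"
          unfolding complex_norm_square
          by (intro Bochner_Integration.integral_cong refl) (simp add: w_def indicator_def mult.commute)
        finally show ?thesis unfolding l2n_power2 by (simp only: integral_complex_of_real)
      qed
      \<comment> \<open>The hypothesis covers finitely many cubes of the product only; in the second
        variable they exhaust the space as m grows, with the integrable function H as a dominating
        function.\<close>
      define F where "F m = (\<Sum>i\<in>G n \<times> G m. LINT z|lborel. indicator (unit_cube i) z *\<^sub>R H z)" for m
      have Feq: "F m = (LINT z|lborel. indicator {z. vfloor z \<in> G n \<times> G m} z *\<^sub>R H z)" for m
      proof -
        have "F m = (LINT z|lborel. (\<Sum>i\<in>G n \<times> G m. indicator (unit_cube i) z *\<^sub>R H z))"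
          unfolding F_def
          by (rule Bochner_Integration.integral_sum[symmetric]) (intro integrable_mult_indicator Hi, simp)
        then show ?thesis
          using G by (simp add: sum_indicator_unit_cube flip: scaleR_sum_left)
      qed
      have "(\<lambda>m. LINT z|lborel. indicator {z. vfloor z \<in> G n \<times> G m} z *\<^sub>R H z) \<longlonglongrightarrow> (LINT z|lborel. H z)"
      proof (rule integral_dominated_convergence)
        show "integrable lborel (\<lambda>z. norm (H z))" using Hi by simp
        show "(\<lambda>z. indicator {z. vfloor z \<in> G n \<times> G m} z *\<^sub>R H z) \<in> borel_measurable lborel" for m
        proof -
          have "{z. vfloor z \<in> G n \<times> G m} \<in> sets (borel :: ('a \<times> 'a) measure)"
            by (intro vfloor_finite_measurable) (simp add: G)
          then show ?thesis by measurable
        qed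
        show "AE z in lborel. (\<lambda>m. indicator {z. vfloor z \<in> G n \<times> G m} z *\<^sub>R H z) \<longlonglongrightarrow> H z"
        proof (rule AE_I2)
          fix z :: "'a \<times> 'a"
          have vz: "vfloor z = (vfloor (fst z), vfloor (snd z))" by (cases z) (simp add: vfloor_Pair)
          have "\<forall>\<^sub>F m in sequentially. indicator {z. vfloor z \<in> G n \<times> G m} z *\<^sub>R H z = H z"
            using Gx[of "snd z"]
          proof eventually_elim
            case (elim m)
            then show ?case
              by (cases "vfloor (fst z) \<in> G n") (auto simp: vz H_def w_def U_def)
          qed
          then show "(\<lambda>m. indicator {z. vfloor z \<in> G n \<times> G m} z *\<^sub>R H z) \<longlonglongrightarrow> H z" by (rule tendsto_eventually)
        qed
        show "AE z in lborel. norm (indicator {z. vfloor z \<in> G n \<times> G m} z *\<^sub>R H z) \<le> norm (H z)" for m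
          by (intro AE_I2) (simp add: indicator_def)
      qed simp
      then have lim: "F \<longlonglongrightarrow> of_real ((l2n (w n))\<^sup>2)" unfolding Feq[abs_def] int .
      have "norm (F m) \<le> K * (l2n (w n) * l2n v)" for m
        unfolding F_def H_def
      proof (rule pair)
        show "finite (G n \<times> G m)" using G by simp
        show "G n \<times> G m \<subseteq> lattice" using G(2)[of n] G(2)[of m] by (auto simp: lattice_Pair)
      qed (use ws vs in auto)
      then have "norm (complex_of_real ((l2n (w n))\<^sup>2)) \<le> K * (l2n (w n) * l2n v)"
        by (intro LIMSEQ_le_const2[OF tendsto_norm[OF lim]]) auto
      then have "l2n (w n) * l2n (w n) \<le> (K * l2n v) * l2n (w n)"
        by (simp only: norm_of_real abs_power2) (simp add: power2_eq_square mult_ac)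
      then show ?thesis
        using l2n_nonneg[of "w n"] K l2n_nonneg[of v]
        by (cases "l2n (w n) = 0") (auto intro: mult_right_le_imp_le)
    qed
    have "(\<lambda>n. indicator (U n) x * A x) \<longlonglongrightarrow> A x" for x
    proof (rule tendsto_eventually)
      show "\<forall>\<^sub>F n in sequentially. indicator (U n) x * A x = A x"
        using Gx[of x] by eventually_elim (simp add: U_def)
    qed
    then have lim: "AE x in lborel. (\<lambda>n. indicator (U n) x * A x) \<longlonglongrightarrow> A x" by (intro AE_I2)
    have "sq_int (\<lambda>x. indicator (U n) x * A x) \<and> l2n (\<lambda>x. indicator (U n) x * A x) = l2n (w n)" for n
    proof -
      have "norm (indicator (U n) x * A x) = norm (w n x)" for x by (simp add: w_def norm_mult)
      then show ?thesis using ws[of n] by (simp add: l2n_def)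
    qed
    then have "sq_int A \<and> l2n A \<le> K * l2n v"
      using wn K by (intro l2_Fatou[OF _ _ _ lim]) (auto simp: l2n_nonneg)
    then show ?thesis by (simp add: A_def)
  qed
  then show ?thesis using bk K by (simp add: kernel_bound_def)
qed

text \<open>The Cauchy-Schwarz inequality in y and then integration in x, as in the Hilbert-Schmidt
  estimate; the cardinalities are the volumes of the supports.\<close>

lemma kernel_bound_small_support:
  fixes h :: "'a::euclidean_space \<times> 'a \<Rightarrow> complex"
  assumes h: "h \<in> borel_measurable borel" and G: "finite G" "G \<subseteq> lattice" and G': "finite G'" "G' \<subseteq> lattice" and e: "0 \<le> e"
    and le: "\<And>x y. norm (h (x, y)) \<le> e * (indicator {x. vfloor x \<in> G} x * indicator {y. vfloor y \<in> G'} y)"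
  shows "kernel_bound h (e * (sqrt (card G) * sqrt (card G')))"
proof -
  have "norm (h z) \<le> e" for z
    using order_trans[OF le[of "fst z" "snd z"], of e] e by (auto simp: indicator_def)
  then have bk: "bounded_kernel h" using h by (auto simp: bounded_kernel_def)
  have "sq_int (kop h v) \<and> l2n (kop h v) \<le> e * (sqrt (card G) * sqrt (card G')) * l2n v" if v: "v \<in> L12" for v
  proof -
    have vs: "sq_int v" "integrable lborel v" using v by (auto simp: L12_def)
    have nv: "sq_int (\<lambda>y. complex_of_real (norm (v y)))" "l2n (\<lambda>y. complex_of_real (norm (v y))) = l2n v"
      using vs by (auto simp: l2n_def)
    define I where "I = (LINT y|lborel. indicator {y. vfloor y \<in> G'} y * norm (v y))"
    have Ii: "integrable lborel (\<lambda>y. indicator {y. vfloor y \<in> G'} y * norm (v y))"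
      using integrable_mult_indicator[OF _ integrable_norm[OF vs(2)], of "{y. vfloor y \<in> G'}"] G'
      by (simp add: vfloor_finite_measurable)
    have I: "0 \<le> I" "I \<le> sqrt (card G') * l2n v"
    proof -
      show "0 \<le> I" unfolding I_def by (intro integral_nonneg_AE) (simp add: indicator_def)
      have "norm (LINT y|lborel. indicator {y. vfloor y \<in> G'} y * complex_of_real (norm (v y))) \<le> sqrt (card G') * l2n v"
        using l2_Cauchy_Schwarz[OF sq_int_indicator_cubes(1)[OF G'] nv(1)] sq_int_indicator_cubes(2)[OF G'] nv(2) by simp
      moreover have "(LINT y|lborel. indicator {y. vfloor y \<in> G'} y * complex_of_real (norm (v y))) = complex_of_real I"
        unfolding I_def integral_complex_of_real[symmetric]
        by (intro Bochner_Integration.integral_cong refl) (simp add: indicator_def)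
      ultimately show "I \<le> sqrt (card G') * l2n v" using \<open>0 \<le> I\<close> by simp
    qed
    have "norm (kop h v x) \<le> norm (complex_of_real (e * I) * indicator {x. vfloor x \<in> G} x)" for x
    proof -
      have "norm (kop h v x) \<le> (LINT y|lborel. (e * indicator {x. vfloor x \<in> G} x) * (indicator {y. vfloor y \<in> G'} y * norm (v y)))"
        unfolding kop_def
      proof (rule norm_integral_le_integral)
        show "norm (h (x, y) * v y) \<le> (e * indicator {x. vfloor x \<in> G} x) * (indicator {y. vfloor y \<in> G'} y * norm (v y))" for y
          using mult_right_mono[OF le[of x y], of "norm (v y)"] by (simp add: norm_mult mult_ac)
      qed (use Ii in simp)
      also have "\<dots> = (e * indicator {x. vfloor x \<in> G} x) * I" by (simp add: I_def)
      finally show ?thesis using e I by (auto simp: indicator_def norm_mult)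
    qed
    note dom = sq_int_dominated[OF kop_measurable[OF bk v] sq_int_cmult[OF sq_int_indicator_cubes(1)[OF G]] this]
    have "l2n (kop h v) \<le> (e * I) * sqrt (card G)"
      using dom(2) e I by (simp add: l2n_cmult[OF sq_int_indicator_cubes(1)[OF G]] sq_int_indicator_cubes(2)[OF G] norm_mult)
    also have "\<dots> \<le> (e * (sqrt (card G') * l2n v)) * sqrt (card G)"
      using e I by (intro mult_right_mono mult_left_mono) auto
    finally show ?thesis using dom(1) by (simp add: mult_ac)
  qed
  then show ?thesis using bk e by (simp add: kernel_bound_def)
qed

section \<open>Compactness\<close>

lemma norm_vfloor_diff_le: "norm (x - vfloor x) \<le> DIM('a)" for x :: "'a::euclidean_space"
proof -
  have "norm (x - vfloor x) \<le> (\<Sum>b\<in>Basis. \<bar>(x - vfloor x) \<bullet> b\<bar>)" by (rule norm_le_l1)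
  also have "\<dots> \<le> (\<Sum>b\<in>(Basis::'a set). 1)"
  proof (rule sum_mono)
    fix b :: 'a assume "b \<in> Basis"
    then show "\<bar>(x - vfloor x) \<bullet> b\<bar> \<le> 1" using floor_correct[of "x \<bullet> b"] by (simp add: inner_diff_left) linarith
  qed
  finally show ?thesis by simp
qed

text \<open>Off the cubes in P the kernel is small in operator norm. On them it is uniformly
  continuous, and sampling it on a fine grid gives a step kernel, that is a finite sum of products
  \<open>X j x * Y j y\<close>.\<close>

lemma compact_operator_if_small_outside_finite:
  fixes k :: "'a::euclidean_space \<times> 'a \<Rightarrow> complex"
  assumes kb: "kernel_bound k K" and cont: "continuous_on UNIV k"
    and small: "\<And>e. e > 0 \<Longrightarrow> \<exists>P. finite P \<and> P \<subseteq> lattice \<and> kernel_bound (\<lambda>z. of_bool (vfloor z \<notin> P) * k z) e"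
    and T: "bounded_operator T" "\<And>F. norm (T F) \<le> K * norm F" "\<And>v. v \<in> L12 \<Longrightarrow> T (L2_class v) = L2_class (kop k v)"
  shows "compact_operator T"
proof (rule compact_operator_if_finite_rank_approx[OF T, where 'i = "('a \<times> 'a) \<times> ('a \<times> 'a)"])
  have bk: "bounded_kernel k" using kb by (simp add: kernel_bound_def)
  show "sq_int (kop k v)" if "v \<in> L12" for v using kb that by (simp add: kernel_bound_def)
  fix e :: real assume e: "e > 0"
  obtain P where P: "finite P" "P \<subseteq> lattice" "kernel_bound (\<lambda>z. of_bool (vfloor z \<notin> P) * k z) (e / 2)"
    using small[of "e / 2"] e by auto
  define G G' where "G = fst ` P" and "G' = snd ` P"
  have latP: "fst i \<in> lattice" "snd i \<in> lattice" if "i \<in> P" for i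
    using P(2) that lattice_Pair[of "fst i" "snd i"] by auto
  have G: "finite G" "G \<subseteq> lattice" and G': "finite G'" "G' \<subseteq> lattice"
    using P(1) latP by (auto simp: G_def G'_def)
  define s where "s = sqrt (card G) * sqrt (card G')"
  \<comment> \<open>By \<open>kernel_bound_small_support\<close> a pointwise error e1 costs e1 * s
    in norm, to be at most e/2; the 1 avoids division by zero.\<close>
  define e1 where "e1 = e / 2 / (s + 1)"
  have s0: "0 \<le> s" by (simp add: s_def)
  have e1: "e1 > 0" "e1 * s \<le> e / 2"
  proof -
    show "e1 > 0" using e s0 by (simp add: e1_def)
    have "e1 * (s + 1) = e / 2" by (rule nonzero_eq_divide_eq[THEN iffD1, OF _ e1_def]) (use s0 in simp)
    then show "e1 * s \<le> e / 2" using \<open>e1 > 0\<close> by (simp add: distrib_left)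
  qed
  obtain R0 where R0: "\<And>i. i \<in> P \<Longrightarrow> norm i \<le> R0" using finite_imp_bounded[OF P(1)] by (auto simp: bounded_iff)
  define d where "d = real DIM('a \<times> 'a)"
  define R where "R = \<bar>R0\<bar> + d"
  have R: "norm z \<le> R" if "vfloor z \<in> P" for z
    using norm_vfloor_diff_le[of z] R0[OF that] norm_triangle_sub[of z "vfloor z"] unfolding R_def d_def by linarith
  have "uniformly_continuous_on (cball 0 (R + 1)) k"
    by (intro compact_uniformly_continuous continuous_on_subset[OF cont]) auto
  then obtain \<delta> where \<delta>: "\<delta> > 0"
    "\<And>z z'. z \<in> cball 0 (R + 1) \<Longrightarrow> z' \<in> cball 0 (R + 1) \<Longrightarrow> dist z' z < \<delta> \<Longrightarrow> dist (k z') (k z) < e1"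
    using e1(1) unfolding uniformly_continuous_on_def by metis
  \<comment> \<open>The mesh is 1/N, so a sample point lies within d/N of z: closer than \<delta>,
    and less than 1, so that it stays in the ball of radius R + 1 where k is uniformly
    continuous.\<close>
  obtain N :: nat where N: "d / min 1 \<delta> < N" using reals_Archimedean2 by blast
  have d0: "d \<ge> 0" by (simp add: d_def)
  have N0: "real N > 0" using N d0 \<delta>(1) by (smt (verit) divide_nonneg_pos)
  define q where "q z = (1 / real N) *\<^sub>R vfloor (real N *\<^sub>R z)" for z :: "'a \<times> 'a"
  have qz: "dist (q z) z < min 1 \<delta>" for z
  proof -
    have "z - q z = (1 / real N) *\<^sub>R (real N *\<^sub>R z - vfloor (real N *\<^sub>R z))"
      using N0 by (simp add: q_def scaleR_diff_right)
    then have "norm (z - q z) = norm (real N *\<^sub>R z - vfloor (real N *\<^sub>R z)) / real N" by simp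
    also have "\<dots> \<le> d / real N"
      unfolding d_def by (intro divide_right_mono norm_vfloor_diff_le) simp
    also have "\<dots> < min 1 \<delta>"
    proof -
      have m: "0 < min 1 \<delta>" using \<delta>(1) by simp
      from N show ?thesis by (simp only: pos_divide_less_eq[OF m] pos_divide_less_eq[OF N0] mult.commute)
    qed
    finally show ?thesis by (simp add: dist_norm norm_minus_commute)
  qed
  define Q where "Q = lattice \<inter> cball (0 :: 'a \<times> 'a) (real N * (R + 1))"
  have Q: "finite Q" unfolding Q_def by (rule finite_lattice_bounded) simp
  have inQ: "vfloor (real N *\<^sub>R z) \<in> Q" if "vfloor z \<in> P" for z
  proof -
    have "norm (q z) \<le> R + 1"
      using R[OF that] qz[of z] norm_triangle_sub[of "q z" z] by (simp add: dist_norm)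
    then show ?thesis using N0 by (simp add: Q_def q_def field_simps)
  qed
  define kS where "kS z = of_bool (vfloor z \<in> P) * k (q z)" for z
  \<comment> \<open>The index j consists of a unit cube in P and a cell of the fine grid. X carries
    the sampled value, Y only an indicator, and exactly one j can contribute at a given
    point.\<close>
  define X where "X j x = of_bool (vfloor x = fst (fst j) \<and> vfloor (real N *\<^sub>R x) = fst (snd j)) * k ((1 / real N) *\<^sub>R snd j)"
    for j :: "('a \<times> 'a) \<times> ('a \<times> 'a)" and x :: 'a
  define Y where "Y j y = (of_bool (vfloor y = snd (fst j) \<and> vfloor (real N *\<^sub>R y) = snd (snd j)) :: complex)"
    for j :: "('a \<times> 'a) \<times> ('a \<times> 'a)" and y :: 'a
  have X: "sq_int (X j)" if "j \<in> P \<times> Q" for j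
  proof (rule sq_int_dominated(1))
    show "sq_int (\<lambda>x. k ((1 / real N) *\<^sub>R snd j) * indicator {x. vfloor x \<in> {fst (fst j)}} x)"
      by (intro sq_int_cmult sq_int_indicator_cubes(1)) (use that latP in auto)
    show "X j \<in> borel_measurable borel" unfolding X_def[abs_def] by measurable
  qed (auto simp: X_def)
  have Y: "sq_int (Y j)" if "j \<in> P \<times> Q" for j
  proof (rule sq_int_dominated(1))
    show "sq_int (\<lambda>x. indicator {x. vfloor x \<in> {snd (fst j)}} x)"
      by (intro sq_int_indicator_cubes(1)) (use that latP in auto)
    show "Y j \<in> borel_measurable borel" unfolding Y_def[abs_def] by measurable
  qed (auto simp: Y_def)
  have kS: "kS (x, y) = (\<Sum>j\<in>P \<times> Q. X j x * Y j y)" for x y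
  proof -
    have v2: "vfloor (real N *\<^sub>R (x, y)) = (vfloor (real N *\<^sub>R x), vfloor (real N *\<^sub>R y))"
      by (simp add: vfloor_Pair)
    have "(\<Sum>j\<in>P \<times> Q. X j x * Y j y) = (\<Sum>j\<in>P \<times> Q. if j = (vfloor (x, y), vfloor (real N *\<^sub>R (x, y))) then k (q (x, y)) else 0)"
      by (intro sum.cong refl) (auto simp: X_def Y_def v2 vfloor_Pair q_def)
    also have "\<dots> = kS (x, y)"
      using P(1) Q inQ[of "(x, y)"] by (simp add: kS_def sum.delta)
    finally show ?thesis ..
  qed
  have kSb: "kernel_bound (\<lambda>z. of_bool (vfloor z \<in> P) * k z - kS z) (e1 * s)"
    unfolding s_def
  proof (rule kernel_bound_small_support[OF _ G G'])
    have [measurable]: "k \<in> borel_measurable borel" by (rule borel_measurable_continuous_onI[OF cont])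
    have "{z. vfloor z \<in> P} \<in> sets borel" by (intro vfloor_finite_measurable P)
    then have [measurable]: "Measurable.pred borel (\<lambda>z. vfloor z \<in> P)" by (simp add: pred_def)
    show "(\<lambda>z. of_bool (vfloor z \<in> P) * k z - kS z) \<in> borel_measurable borel"
      unfolding kS_def[abs_def] q_def[abs_def] by measurable
    fix x y
    show "norm (of_bool (vfloor (x, y) \<in> P) * k (x, y) - kS (x, y)) \<le> e1 * (indicator {x. vfloor x \<in> G} x * indicator {y. vfloor y \<in> G'} y)"
    proof (cases "vfloor (x, y) \<in> P")
      case True
      have "dist (k (q (x, y))) (k (x, y)) < e1"
      proof (rule \<delta>(2))
        show "(x, y) \<in> cball 0 (R + 1)" using R[OF True] by simp
        show "q (x, y) \<in> cball 0 (R + 1)"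
          using R[OF True] qz[of "(x, y)"] norm_triangle_sub[of "q (x, y)" "(x, y)"] by (simp add: dist_norm)
      qed (use qz[of "(x, y)"] in simp)
      moreover have "vfloor x \<in> G" "vfloor y \<in> G'" using True unfolding G_def G'_def vfloor_Pair by force+
      ultimately show ?thesis using True by (simp add: kS_def dist_norm norm_minus_commute)
    qed (simp add: kS_def e1(1) less_imp_le)
  qed (use e1 in simp)
  show "\<exists>(J :: (('a \<times> 'a) \<times> ('a \<times> 'a)) set) X Y. finite J \<and> (\<forall>j\<in>J. sq_int (X j) \<and> sq_int (Y j)) \<and>
      (\<forall>v\<in>L12. l2n (\<lambda>x. kop k v x - (\<Sum>j\<in>J. (LINT y|lborel. Y j y * v y) * X j x)) \<le> e * l2n v)"
  proof (rule exI[of _ "P \<times> Q"], rule exI[of _ X], rule exI[of _ Y], intro conjI ballI)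
    fix v :: "'a \<Rightarrow> complex" assume v: "v \<in> L12"
    then have vs: "sq_int v" "integrable lborel v" by (auto simp: L12_def)
    define k1 where "k1 z = of_bool (vfloor z \<notin> P) * k z" for z
    define k2 where "k2 z = of_bool (vfloor z \<in> P) * k z - kS z" for z
    have k1: "bounded_kernel k1" "sq_int (kop k1 v)" "l2n (kop k1 v) \<le> e / 2 * l2n v"
      and k2: "bounded_kernel k2" "sq_int (kop k2 v)" "l2n (kop k2 v) \<le> e1 * s * l2n v"
      using P(3) kSb v unfolding k1_def[symmetric, abs_def] k2_def[symmetric, abs_def] by (auto simp: kernel_bound_def)
    have "kop k v x - (\<Sum>j\<in>P \<times> Q. (LINT y|lborel. Y j y * v y) * X j x) = kop k1 v x + kop k2 v x" for x
    proof -
      have "(LINT y|lborel. kS (x, y) * v y) = (\<Sum>j\<in>P \<times> Q. LINT y|lborel. X j x * (Y j y * v y))"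
      proof -
        have "kS (x, y) * v y = (\<Sum>j\<in>P \<times> Q. X j x * (Y j y * v y))" for y
          by (simp only: kS sum_distrib_right mult.assoc)
        then show ?thesis
          by (simp only:) (intro Bochner_Integration.integral_sum integrable_mult_right integrable_mult_sq_int Y vs)
      qed
      then have S: "(LINT y|lborel. kS (x, y) * v y) = (\<Sum>j\<in>P \<times> Q. (LINT y|lborel. Y j y * v y) * X j x)"
        by (simp add: mult.commute)
      have Si: "integrable lborel (\<lambda>y. kS (x, y) * v y)"
      proof -
        have "kS (x, y) * v y = (\<Sum>j\<in>P \<times> Q. X j x * (Y j y * v y))" for y
          by (simp only: kS sum_distrib_right mult.assoc)
        then show ?thesis
          by (simp only:) (intro Bochner_Integration.integrable_sum integrable_mult_right integrable_mult_sq_int Y vs)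
      qed
      have "k (x, y) * v y = (k1 (x, y) * v y + k2 (x, y) * v y) + kS (x, y) * v y" for y
        by (simp add: k1_def k2_def algebra_simps)
      then have "kop k v x = (LINT y|lborel. (k1 (x, y) * v y + k2 (x, y) * v y) + kS (x, y) * v y)"
        unfolding kop_def by (simp only:)
      also have "\<dots> = kop k1 v x + kop k2 v x + (LINT y|lborel. kS (x, y) * v y)"
        unfolding kop_def
        using integrable_kernel[OF k1(1) vs(2)] integrable_kernel[OF k2(1) vs(2)] Si
        by (subst Bochner_Integration.integral_add | simp)+
      finally show ?thesis using S by simp
    qed
    then have "l2n (\<lambda>x. kop k v x - (\<Sum>j\<in>P \<times> Q. (LINT y|lborel. Y j y * v y) * X j x)) = l2n (\<lambda>x. kop k1 v x + kop k2 v x)"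
      by (simp only:)
    also have "\<dots> \<le> l2n (kop k1 v) + l2n (kop k2 v)" by (rule l2n_triangle[OF k1(2) k2(2)])
    also have "\<dots> \<le> e / 2 * l2n v + e / 2 * l2n v"
      using k1(3) order_trans[OF k2(3) mult_right_mono[OF e1(2) l2n_nonneg]] by (intro add_mono)
    finally show "l2n (\<lambda>x. kop k v x - (\<Sum>j\<in>P \<times> Q. (LINT y|lborel. Y j y * v y) * X j x)) \<le> e * l2n v"
      by (simp add: field_simps)
  qed (use P Q X Y in auto)
qed

section \<open>Oscillatory integral operators\<close>

lemma finite_uniform_bound:
  assumes "finite A" "\<And>z. 0 \<le> w z" "\<And>i. i \<in> A \<Longrightarrow> \<exists>C::real. \<forall>z. f i z \<le> C * w z"
  shows "\<exists>C\<ge>0. \<forall>i\<in>A. \<forall>z. f i z \<le> C * w z"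
proof -
  have "\<exists>C. i \<in> A \<longrightarrow> (\<forall>z. f i z \<le> C * w z)" for i using assms(3) by blast
  then obtain C where C: "\<And>i z. i \<in> A \<Longrightarrow> f i z \<le> C i * w z" by metis
  have "f i z \<le> (\<Sum>i\<in>A. \<bar>C i\<bar>) * w z" if "i \<in> A" for i z
  proof -
    have "C i \<le> (\<Sum>i\<in>A. \<bar>C i\<bar>)"
      using member_le_sum[of i A "\<lambda>i. \<bar>C i\<bar>"] assms(1) that abs_ge_self[of "C i"] by force
    then show ?thesis using C[OF that, of z] mult_right_mono[OF _ assms(2)[of z]] order_trans by blast
  qed
  then show ?thesis by (intro exI[of _ "\<Sum>i\<in>A. \<bar>C i\<bar>"]) (simp add: sum_nonneg)
qed

section \<open>Phases, their frequencies and their multiplicity\<close>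

definition grad1 :: "('a::euclidean_space \<times> 'a \<Rightarrow> real) \<Rightarrow> 'a \<times> 'a \<Rightarrow> 'a"
  where "grad1 S z = (\<Sum>b\<in>Basis. partial_deriv (b, 0) S z *\<^sub>R b)"

definition grad2 :: "('a::euclidean_space \<times> 'a \<Rightarrow> real) \<Rightarrow> 'a \<times> 'a \<Rightarrow> 'a"
  where "grad2 S z = (\<Sum>b\<in>Basis. partial_deriv (0, b) S z *\<^sub>R b)"

text \<open>What the argument on cubes takes from (G1) to (G3), without reference to coordinates or
  determinants. The gradient itself may grow. The phase of the Fourier transform has this property
  too, so one estimate serves both operators.\<close>

definition nondegenerate_phase :: "('a::euclidean_space \<times> 'a \<Rightarrow> real) \<Rightarrow> bool"
  where "nondegenerate_phase S \<longleftrightarrow> smooth_on UNIV S \<and>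
    (\<forall>ls. set ls \<subseteq> Basis \<longrightarrow> 2 \<le> length ls \<longrightarrow> (\<exists>C. \<forall>z. norm (pds ls S z) \<le> C)) \<and>
    (\<exists>c>0. \<forall>x \<theta> \<theta>'. c * dist \<theta> \<theta>' \<le> dist (grad1 S (x, \<theta>)) (grad1 S (x, \<theta>'))) \<and>
    (\<exists>c>0. \<forall>x x' \<theta>. c * dist x x' \<le> dist (grad2 S (x, \<theta>)) (grad2 S (x', \<theta>)))"

text \<open>Rounding the gradient at the corner \<open>k\<close> down to multiples of \<open>2\<pi>\<close> splits off a Fourier mode of the
  unit cube and leaves a phase with bounded derivatives.\<close>

definition frequency :: "('a::euclidean_space \<times> 'a \<Rightarrow> real) \<Rightarrow> 'a \<times> 'a \<Rightarrow> 'a \<times> 'a"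
  where "frequency S k = vfloor ((1 / (2 * pi)) *\<^sub>R (grad1 S k, grad2 S k))"

text \<open>If i and j have the same rounding, then g i and g j are within 2 pi times twice the
  rounding error, so by expansion j - i is a lattice point of a fixed ball.\<close>

lemma card_fibre_le:
  fixes g :: "'a::euclidean_space \<Rightarrow> 'a"
  assumes c: "c > 0" "\<And>x y. c * dist x y \<le> dist (g x) (g y)" and J: "J \<subseteq> lattice"
  shows "card {j \<in> J. vfloor ((1 / (2 * pi)) *\<^sub>R g j) = p} \<le> card (lattice \<inter> cball (0::'a) (2 * pi * (2 * DIM('a)) / c))"
    (is "card ?A \<le> card ?B")
proof (cases "?A = {}")
  case False
  then obtain i where i: "i \<in> J" "vfloor ((1 / (2 * pi)) *\<^sub>R g i) = p" by blast
  have "?A \<subseteq> (\<lambda>d. i + d) ` ?B"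
  proof
    fix j assume j: "j \<in> ?A"
    let ?x = "(1 / (2 * pi)) *\<^sub>R g i" and ?y = "(1 / (2 * pi)) *\<^sub>R g j"
    have "norm (?y - ?x) = norm ((?y - vfloor ?y) - (?x - vfloor ?x))" using i j by simp
    also have "\<dots> \<le> norm (?y - vfloor ?y) + norm (?x - vfloor ?x)" by (rule norm_triangle_ineq4)
    also have "\<dots> \<le> 2 * DIM('a)" using norm_vfloor_diff_le[of ?x] norm_vfloor_diff_le[of ?y] by linarith
    finally have "norm (g j - g i) / (2 * pi) \<le> 2 * DIM('a)" by (simp flip: scaleR_diff_right)
    then have "dist (g i) (g j) \<le> 2 * pi * (2 * DIM('a))"
      by (simp add: dist_norm norm_minus_commute pos_divide_le_eq mult.commute)
    then have "c * dist i j \<le> 2 * pi * (2 * DIM('a))" using c(2)[of i j] by linarith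
    then have "norm (j - i) \<le> 2 * pi * (2 * DIM('a)) / c"
      using c(1) by (simp add: dist_norm norm_minus_commute pos_le_divide_eq mult.commute)
    moreover have "j - i \<in> lattice" using i j J lattice_diff by blast
    ultimately show "j \<in> (\<lambda>d. i + d) ` ?B" by (intro image_eqI[of _ _ "j - i"]) auto
  qed
  then have "card ?A \<le> card ((\<lambda>d. i + d) ` ?B)" by (intro card_mono finite_imageI finite_lattice_bounded) auto
  also have "\<dots> \<le> card ?B" by (intro card_image_le finite_lattice_bounded) auto
  finally show ?thesis .
next
  case True
  show ?thesis unfolding True by simp
qed

text \<open>Fix the cube of x and the frequency in x. The free index is the cube of \<theta>, and
  the x-gradient is expansive as a function of \<theta>; so few cubes of \<theta> are possible. The
  other half is symmetric.\<close>

lemma frequency_multiplicity: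
  fixes S :: "'a::euclidean_space \<times> 'a \<Rightarrow> real"
  assumes "nondegenerate_phase S"
  shows "\<exists>D. \<forall>I y. finite I \<longrightarrow> I \<subseteq> lattice \<longrightarrow>
    card {k \<in> I. (fst k, fst (frequency S k)) = y} \<le> D \<and> card {k \<in> I. (snd k, snd (frequency S k)) = y} \<le> D"
proof -
  obtain c1 c2 where c1: "c1 > 0" "\<And>x \<theta> \<theta>'. c1 * dist \<theta> \<theta>' \<le> dist (grad1 S (x, \<theta>)) (grad1 S (x, \<theta>'))"
    and c2: "c2 > 0" "\<And>x x' \<theta>. c2 * dist x x' \<le> dist (grad2 S (x, \<theta>)) (grad2 S (x', \<theta>))"
    using assms unfolding nondegenerate_phase_def by blast
  define D1 where "D1 = card (lattice \<inter> cball (0::'a) (2 * pi * (2 * DIM('a)) / c1))"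
  define D2 where "D2 = card (lattice \<inter> cball (0::'a) (2 * pi * (2 * DIM('a)) / c2))"
  have fr: "fst (frequency S k) = vfloor ((1 / (2 * pi)) *\<^sub>R grad1 S k)" "snd (frequency S k) = vfloor ((1 / (2 * pi)) *\<^sub>R grad2 S k)" for k
    by (simp_all add: frequency_def vfloor_Pair)
  show ?thesis
  proof (intro exI[of _ "D1 + D2"] allI impI conjI)
    fix I :: "('a \<times> 'a) set" and y :: "'a \<times> 'a" assume I: "finite I" "I \<subseteq> lattice"
    obtain x p where y: "y = (x, p)" by (cases y)
    have lat: "snd ` I \<subseteq> lattice" "fst ` I \<subseteq> lattice"
      using I(2) by (force simp: lattice_Pair)+
    have "{k \<in> I. (fst k, fst (frequency S k)) = y} \<subseteq> (\<lambda>j. (x, j)) ` {j \<in> snd ` I. vfloor ((1 / (2 * pi)) *\<^sub>R grad1 S (x, j)) = p}"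
      unfolding y fr by force
    then have "card {k \<in> I. (fst k, fst (frequency S k)) = y} \<le> card ((\<lambda>j. (x, j)) ` {j \<in> snd ` I. vfloor ((1 / (2 * pi)) *\<^sub>R grad1 S (x, j)) = p})"
      by (intro card_mono) (use I in auto)
    also have "\<dots> \<le> card {j \<in> snd ` I. vfloor ((1 / (2 * pi)) *\<^sub>R grad1 S (x, j)) = p}"
      by (intro card_image_le) (use I in auto)
    also have "\<dots> \<le> D1"
      unfolding D1_def by (rule card_fibre_le[OF c1 lat(1)])
    finally show "card {k \<in> I. (fst k, fst (frequency S k)) = y} \<le> D1 + D2" by simp
    have "{k \<in> I. (snd k, snd (frequency S k)) = y} \<subseteq> (\<lambda>j. (j, x)) ` {j \<in> fst ` I. vfloor ((1 / (2 * pi)) *\<^sub>R grad2 S (j, x)) = p}"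
      unfolding y fr by force
    then have "card {k \<in> I. (snd k, snd (frequency S k)) = y} \<le> card ((\<lambda>j. (j, x)) ` {j \<in> fst ` I. vfloor ((1 / (2 * pi)) *\<^sub>R grad2 S (j, x)) = p})"
      by (intro card_mono) (use I in auto)
    also have "\<dots> \<le> card {j \<in> fst ` I. vfloor ((1 / (2 * pi)) *\<^sub>R grad2 S (j, x)) = p}"
      by (intro card_image_le) (use I in auto)
    also have "\<dots> \<le> D2"
      unfolding D2_def by (rule card_fibre_le[OF c2 lat(2)])
    finally show "card {k \<in> I. (snd k, snd (frequency S k)) = y} \<le> D1 + D2" by simp
  qed
qed

lemma smooth_diff_const_deriv_bounded:
  fixes f :: "'a::euclidean_space \<Rightarrow> real"
  assumes f: "smooth_on UNIV f" and c: "\<And>z. z \<in> K \<Longrightarrow> \<bar>f z - c\<bar> \<le> M"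
    and M: "\<And>ls z. set ls \<subseteq> Basis \<Longrightarrow> 1 \<le> length ls \<Longrightarrow> length ls \<le> n \<Longrightarrow> norm (pds ls f z) \<le> M"
  shows "deriv_bounded n M K (\<lambda>z. f z - c)"
proof (cases n)
  case 0
  then show ?thesis using c smooth_on_imp_continuous[OF f] by (auto intro!: continuous_intros)
next
  case (Suc n')
  have pd: "partial_deriv b (\<lambda>z. f z - c) = partial_deriv b f" for b
  proof
    fix z
    obtain f' where f': "(f has_derivative f') (at z)"
      using smooth_on_imp_differentiable[OF f, of z] by (auto simp: differentiable_def)
    have "((\<lambda>z. f z - c) has_derivative f') (at z)"
      using has_derivative_diff[OF f' has_derivative_const] by simp
    then show "partial_deriv b (\<lambda>z. f z - c) z = partial_deriv b f z"
      by (simp add: partial_deriv_unique[OF f'] partial_deriv_unique)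
  qed
  have "deriv_bounded n' M K (partial_deriv b f)" if b: "b \<in> Basis" for b
  proof (rule smooth_on_imp_deriv_bounded[OF smooth_on_partial_deriv[OF f b]])
    fix ls :: "'a list" and z assume "set ls \<subseteq> Basis" "length ls \<le> n'"
    then show "norm (pds ls (partial_deriv b f) z) \<le> M" using M[of "ls @ [b]" z] b Suc by simp
  qed
  then show ?thesis
    using c smooth_on_imp_differentiable[OF f] by (auto simp: Suc pd intro!: differentiable_diff)
qed

lemma Lipschitz_if_partial_derivs_bounded:
  fixes f :: "'a::euclidean_space \<Rightarrow> real" and C :: real
  assumes f: "\<And>z. f differentiable (at z)" and C: "\<And>b z. b \<in> Basis \<Longrightarrow> \<bar>partial_deriv b f z\<bar> \<le> C"
  shows "norm (f x - f y) \<le> DIM('a) * C * norm (x - y)"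
proof (rule differentiable_bound[OF convex_UNIV])
  show "(f has_derivative (\<lambda>h. \<Sum>b\<in>Basis. (h \<bullet> b) *\<^sub>R partial_deriv b f z)) (at z)" for z
    by (rule frechet_derivative_eq_sum_partial[OF f])
  show "onorm (\<lambda>h. \<Sum>b\<in>Basis. (h \<bullet> b) *\<^sub>R partial_deriv b f z) \<le> DIM('a) * C" for z
  proof (rule onorm_bound)
    fix h :: 'a
    have "norm (\<Sum>b\<in>Basis. (h \<bullet> b) *\<^sub>R partial_deriv b f z) \<le> (\<Sum>b\<in>(Basis :: 'a set). norm h * C)"
    proof (rule sum_norm_le)
      fix b :: 'a assume b: "b \<in> Basis"
      show "norm ((h \<bullet> b) *\<^sub>R partial_deriv b f z) \<le> norm h * C"
        using mult_mono[OF Basis_le_norm[OF b, of h] C[OF b, of z]] by (simp add: abs_mult)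
    qed
    then show "norm (\<Sum>b\<in>Basis. (h \<bullet> b) *\<^sub>R partial_deriv b f z) \<le> DIM('a) * C * norm h"
      by (simp add: mult_ac)
  next
    obtain b :: 'a where "b \<in> Basis" using nonempty_Basis by blast
    from order_trans[OF abs_ge_zero C[OF this]] show "0 \<le> DIM('a) * C" by simp
  qed
qed simp_all

lemma norm_le_DIM_if_mem_unit_cbox:
  fixes z :: "'a::euclidean_space"
  assumes "z \<in> cbox k (k + One)"
  shows "norm (z - k) \<le> DIM('a)"
proof -
  have "norm (z - k) \<le> (\<Sum>b\<in>Basis. \<bar>(z - k) \<bullet> b\<bar>)" by (rule norm_le_l1)
  also have "\<dots> \<le> (\<Sum>b\<in>(Basis::'a set). 1)"
    using assms by (intro sum_mono) (auto simp: mem_box inner_diff_left inner_add_left inner_sum_left inner_Basis)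
  finally show ?thesis by simp
qed

lemma frequency_inner:
  assumes "b \<in> Basis"
  shows "frequency S k \<bullet> b = of_int \<lfloor>partial_deriv b S k / (2 * pi)\<rfloor>"
proof -
  have "grad1 S k \<bullet> u = partial_deriv (u, 0) S k" "grad2 S k \<bullet> u = partial_deriv (0, u) S k" if "u \<in> Basis" for u
    using that by (simp_all add: grad1_def grad2_def inner_sum_left_Basis)
  then have "(grad1 S k, grad2 S k) \<bullet> b = partial_deriv b S k"
    using assms by (auto simp: Basis_prod_def)
  then show ?thesis using assms by (simp add: frequency_def del: inner_Pair scaleR_Pair)
qed

text \<open>Subtracting the linear phase changes the first derivatives by constants and leaves the
  higher ones alone, so only the first derivatives on the cube need an argument.\<close>

lemma local_phase_deriv_bounded:
  fixes S :: "'a::euclidean_space \<times> 'a \<Rightarrow> real"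
  assumes S: "nondegenerate_phase S"
  shows "\<exists>E\<ge>0. \<forall>k. deriv_bounded DIM('a \<times> 'a) E (cbox k (k + One)) (\<lambda>z. cis (S z - 2 * pi * (frequency S k \<bullet> z)))"
proof -
  have sm: "smooth_on UNIV S" using S by (simp add: nondegenerate_phase_def)
  obtain n where n: "DIM('a \<times> 'a) = Suc n" using DIM_positive[where 'a = "'a \<times> 'a"] by (cases "DIM('a \<times> 'a)") auto
  let ?L = "{ls :: ('a \<times> 'a) list. set ls \<subseteq> Basis \<and> length ls \<le> Suc n + 1} \<inter> {ls. 2 \<le> length ls}"
  have "finite {ls :: ('a \<times> 'a) list. set ls \<subseteq> Basis \<and> length ls \<le> Suc n + 1}"
    by (rule finite_lists_length_le) simp
  then have "\<exists>C\<ge>0. \<forall>ls\<in>?L. \<forall>z. norm (pds ls S z) \<le> C * 1"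
    using S unfolding nondegenerate_phase_def by (intro finite_uniform_bound) auto
  then obtain C2 where C20: "0 \<le> C2" and "\<forall>ls\<in>?L. \<forall>z. norm (pds ls S z) \<le> C2 * 1" by blast
  then have C2: "norm (pds ls S z) \<le> C2" if "set ls \<subseteq> Basis" "2 \<le> length ls" "length ls \<le> Suc n + 1" for ls z
    using that unfolding mult_1_right by blast
  define N where "N = real DIM('a \<times> 'a)"
  \<comment> \<open>C2 covers the derivatives of order at least two. \<open>N * C2 * N\<close> is
    the Lipschitz constant of a first derivative times a bound for the distance to the corner, and 2
    pi is the rounding error.\<close>
  define L where "L = C2 + (N * C2 * N + 2 * pi)"
  have L: "0 \<le> L" "C2 \<le> L" using C20 by (simp_all add: L_def N_def)
  have near: "\<bar>partial_deriv b S z - 2 * pi * (frequency S k \<bullet> b)\<bar> \<le> L"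
    if b: "b \<in> Basis" and z: "z \<in> cbox k (k + One)" for b z and k :: "'a \<times> 'a"
  proof -
    have smb: "smooth_on UNIV (partial_deriv b S)" by (rule smooth_on_partial_deriv[OF sm b])
    have "norm (partial_deriv b S z - partial_deriv b S k) \<le> N * C2 * norm (z - k)"
    proof -
      have "\<bar>partial_deriv b' (partial_deriv b S) x\<bar> \<le> C2" if "b' \<in> Basis" for b' x
        using C2[of "[b', b]" x] b that by simp
      from Lipschitz_if_partial_derivs_bounded[OF smooth_on_imp_differentiable[OF smb] this, of z k]
      show ?thesis unfolding N_def .
    qed
    also have "\<dots> \<le> N * C2 * N"
      using norm_le_DIM_if_mem_unit_cbox[OF z] C20 by (intro mult_left_mono) (simp_all add: N_def)
    finally have 1: "\<bar>partial_deriv b S z - partial_deriv b S k\<bar> \<le> N * C2 * N" by simp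
    have fl: "0 \<le> partial_deriv b S k / (2 * pi) - of_int \<lfloor>partial_deriv b S k / (2 * pi)\<rfloor>"
      "partial_deriv b S k / (2 * pi) - of_int \<lfloor>partial_deriv b S k / (2 * pi)\<rfloor> \<le> 1"
      using floor_correct[of "partial_deriv b S k / (2 * pi)"] by linarith+
    have "partial_deriv b S k - 2 * pi * (frequency S k \<bullet> b)
        = 2 * pi * (partial_deriv b S k / (2 * pi) - of_int \<lfloor>partial_deriv b S k / (2 * pi)\<rfloor>)"
      by (simp add: frequency_inner[OF b] algebra_simps)
    then have 2: "\<bar>partial_deriv b S k - 2 * pi * (frequency S k \<bullet> b)\<bar> \<le> 2 * pi"
      using fl by (simp add: abs_mult)
    show ?thesis using 1 2 C20 unfolding L_def by linarith
  qed
  have "deriv_bounded (Suc n) (exp_bound L (Suc n)) (cbox k (k + One)) (\<lambda>z. cis (S z - 2 * pi * (frequency S k \<bullet> z)))" for k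
  proof (rule deriv_bounded_cis[OF L(1)])
    have lin: "((\<lambda>z. 2 * pi * (frequency S k \<bullet> z)) has_derivative (\<lambda>h. 2 * pi * (frequency S k \<bullet> h))) (at z)" for z
      by (intro bounded_linear_imp_has_derivative bounded_linear_intros)
    show "(\<lambda>z. S z - 2 * pi * (frequency S k \<bullet> z)) differentiable at z" for z
      by (intro differentiable_diff smooth_on_imp_differentiable[OF sm] differentiableI[OF lin])
    fix b :: "'a \<times> 'a" assume b: "b \<in> Basis"
    have "partial_deriv b (\<lambda>z. S z - 2 * pi * (frequency S k \<bullet> z)) = (\<lambda>z. partial_deriv b S z - 2 * pi * (frequency S k \<bullet> b))"
    proof
      fix z
      obtain S' where S': "(S has_derivative S') (at z)"
        using smooth_on_imp_differentiable[OF sm, of z] by (auto simp: differentiable_def)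
      show "partial_deriv b (\<lambda>z. S z - 2 * pi * (frequency S k \<bullet> z)) z = partial_deriv b S z - 2 * pi * (frequency S k \<bullet> b)"
        unfolding partial_deriv_unique[OF has_derivative_diff[OF S' lin]] partial_deriv_unique[OF S'] ..
    qed
    moreover have "deriv_bounded n L (cbox k (k + One)) (\<lambda>z. partial_deriv b S z - 2 * pi * (frequency S k \<bullet> b))"
    proof (rule smooth_diff_const_deriv_bounded[OF smooth_on_partial_deriv[OF sm b] near[OF b]])
      fix ls z assume "set ls \<subseteq> (Basis :: ('a \<times> 'a) set)" "1 \<le> length ls" "length ls \<le> n"
      then have "norm (pds (ls @ [b]) S z) \<le> C2" using b by (intro C2) auto
      then show "norm (pds ls (partial_deriv b S) z) \<le> L" using L(2) by simp
    qed
    ultimately show "deriv_bounded n L (cbox k (k + One)) (partial_deriv b (\<lambda>z. S z - 2 * pi * (frequency S k \<bullet> z)))"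
      by simp
  qed
  then show ?thesis
    using exp_bound_ge_1[OF L(1), of "Suc n"] unfolding n by (intro exI[of _ "exp_bound L (Suc n)"]) simp
qed

text \<open>C is chosen before the amplitude a and the set Q of cubes, and the bound is linear in M,
  which concerns the cubes in Q only. The set Q is everything for boundedness and the complement of
  a finite set for compactness.\<close>

lemma oscillatory_kernel_bound:
  fixes S :: "'a::euclidean_space \<times> 'a \<Rightarrow> real"
  assumes S: "nondegenerate_phase S"
  shows "\<exists>C\<ge>0. \<forall>a Q M. 0 \<le> M \<longrightarrow> continuous_on UNIV a \<longrightarrow> {z. vfloor z \<in> Q} \<in> sets borel \<longrightarrow>
      (\<forall>k. k \<in> lattice \<longrightarrow> k \<in> Q \<longrightarrow> deriv_bounded DIM('a \<times> 'a) M (cbox k (k + One)) a) \<longrightarrow>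
      kernel_bound (\<lambda>z. of_bool (vfloor z \<in> Q) * (cis (S z) * a z)) (C * M)"
proof -
  obtain D where D: "\<forall>I y. finite I \<longrightarrow> I \<subseteq> lattice \<longrightarrow>
    card {k \<in> I. (fst k, fst (frequency S k)) = y} \<le> D \<and> card {k \<in> I. (snd k, snd (frequency S k)) = y} \<le> D"
    using frequency_multiplicity[OF S] ..
  obtain E where E: "0 \<le> E"
    "\<And>k. deriv_bounded DIM('a \<times> 'a) E (cbox k (k + One)) (\<lambda>z. cis (S z - 2 * pi * (frequency S k \<bullet> z)))"
    using local_phase_deriv_bounded[OF S] by blast
  \<comment> \<open>One power of 2 counts the terms from the fundamental theorem of calculus, the
    other comes from the product rule for exponential times amplitude; E bounds the local
    exponential and D is the multiplicity.\<close>
  define C where "C = 2 ^ DIM('a \<times> 'a) * (2 ^ DIM('a \<times> 'a) * E) * real D"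
  have contS: "continuous_on UNIV (\<lambda>z. cis (S z))"
    using S by (intro continuous_intros) (simp add: nondegenerate_phase_def smooth_on_imp_continuous)
  show ?thesis
  proof (intro exI[of _ C] allI impI conjI)
    show "0 \<le> C" using E by (simp add: C_def)
    fix a :: "'a \<times> 'a \<Rightarrow> complex" and Q M
    assume M: "0 \<le> M" and ca: "continuous_on UNIV a" and Q: "{z. vfloor z \<in> Q} \<in> sets borel"
      and "\<forall>k. k \<in> lattice \<longrightarrow> k \<in> Q \<longrightarrow> deriv_bounded DIM('a \<times> 'a) M (cbox k (k + One)) a"
    then have a: "\<And>k. k \<in> lattice \<Longrightarrow> k \<in> Q \<Longrightarrow> deriv_bounded DIM('a \<times> 'a) M (cbox k (k + One)) a" by blast
    define k where "k z = of_bool (vfloor z \<in> Q) * (cis (S z) * a z)" for z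
    have [measurable]: "Measurable.pred borel (\<lambda>z. vfloor z \<in> Q)" using Q by (simp add: pred_def)
    have [measurable]: "(\<lambda>z. cis (S z)) \<in> borel_measurable borel" "a \<in> borel_measurable borel"
      by (rule borel_measurable_continuous_onI[OF contS], rule borel_measurable_continuous_onI[OF ca])
    have "norm (k z) \<le> M" for z
    proof (cases "vfloor z \<in> Q")
      case True
      have "z \<in> cbox (vfloor z) (vfloor z + One)" using unit_cube_subset_cbox[of "vfloor z"] by (auto simp: unit_cube_def)
      then show ?thesis using deriv_bounded_norm_le[OF a[OF vfloor_in_lattice True]] by (simp add: k_def True norm_mult)
    qed (simp add: k_def M)
    moreover have "k \<in> borel_measurable borel" unfolding k_def[abs_def] by measurable
    ultimately have bk: "bounded_kernel k" by (auto simp: bounded_kernel_def)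
    have "kernel_bound k (C * M)"
    proof (rule kernel_bound_if_local_pairings[OF bk])
      show "0 \<le> C * M" using E M by (simp add: C_def)
      fix I :: "('a \<times> 'a) set" and w v :: "'a \<Rightarrow> complex"
      assume I: "finite I" "I \<subseteq> lattice" and wv: "sq_int w" "sq_int v"
      define f where "f i z = cis (S z - 2 * pi * (frequency S i \<bullet> z)) * a z" for i z
      have "(\<Sum>i\<in>I. LINT z|lborel. indicator (unit_cube i) z *\<^sub>R (k z * (w (fst z) * v (snd z))))
          = (\<Sum>i\<in>I. if i \<in> Q then LINT z|lborel. atom i (frequency S i) w v z * f i z else 0)"
      proof (intro sum.cong refl)
        fix i
        have "indicator (unit_cube i) z *\<^sub>R (k z * (w (fst z) * v (snd z))) =
            (if i \<in> Q then atom i (frequency S i) w v z * f i z else 0)" for z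
        proof (cases "z \<in> unit_cube i")
          case True
          have "cis (S z) = cis (2 * pi * (frequency S i \<bullet> z)) * cis (S z - 2 * pi * (frequency S i \<bullet> z))"
            by (simp add: cis_mult)
          with True show ?thesis by (simp add: k_def f_def atom_def unit_cube_def mult_ac)
        qed (simp add: atom_def)
        then show "(LINT z|lborel. indicator (unit_cube i) z *\<^sub>R (k z * (w (fst z) * v (snd z))))
            = (if i \<in> Q then LINT z|lborel. atom i (frequency S i) w v z * f i z else 0)" by simp
      qed
      also have "\<dots> = pairing (I \<inter> Q) (frequency S) f w v"
        unfolding pairing_def using I(1) by (simp add: sum.inter_restrict)
      finally have eq: "(\<Sum>i\<in>I. LINT z|lborel. indicator (unit_cube i) z *\<^sub>R (k z * (w (fst z) * v (snd z))))
          = pairing (I \<inter> Q) (frequency S) f w v" .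
      have "pairing_bound (I \<inter> Q) (frequency S) (2 ^ DIM('a \<times> 'a) * (2 ^ DIM('a \<times> 'a) * E * M) * D) f"
      proof (rule pairing_bound_deriv_bounded)
        show "finite (I \<inter> Q)" "I \<inter> Q \<subseteq> lattice" using I by auto
        then show "card {k \<in> I \<inter> Q. (fst k, fst (frequency S k)) = y} \<le> D"
          "card {k \<in> I \<inter> Q. (snd k, snd (frequency S k)) = y} \<le> D" for y
          using D by blast+
        show "frequency S k \<in> lattice" for k by (simp add: frequency_def)
        show "0 \<le> 2 ^ DIM('a \<times> 'a) * E * M" using E M by simp
        show "deriv_bounded DIM('a \<times> 'a) (2 ^ DIM('a \<times> 'a) * E * M) (cbox k (k + One)) (f k)" if "k \<in> I \<inter> Q" for k
          unfolding f_def by (rule deriv_bounded_mult[OF E(2) a E(1) M]) (use that I in auto)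
      qed
      then have "norm (pairing (I \<inter> Q) (frequency S) f w v) \<le>
          (2 ^ DIM('a \<times> 'a) * (2 ^ DIM('a \<times> 'a) * E * M) * D) * (l2n w * l2n v)"
        using wv unfolding pairing_bound_def by blast
      moreover have "2 ^ DIM('a \<times> 'a) * (2 ^ DIM('a \<times> 'a) * E * M) * real D = C * M"
        by (simp add: C_def mult_ac)
      ultimately show "norm (\<Sum>i\<in>I. LINT z|lborel. indicator (unit_cube i) z *\<^sub>R (k z * (w (fst z) * v (snd z)))) \<le> C * M * (l2n w * l2n v)"
        unfolding eq by (simp only:)
    qed
    then show "kernel_bound (\<lambda>z. of_bool (vfloor z \<in> Q) * (cis (S z) * a z)) (C * M)"
      by (simp add: k_def[abs_def])
  qed
qed

section \<open>Rapidly decaying functions\<close>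

lemma lam_ge_1: "1 \<le> lam z"
  by (simp add: lam_def)

text \<open>The exponent allots two powers of \<open>lam x\<close> to each coordinate: 1 + t^2 at t
  = \<open>x \<bullet> b\<close> is at most the square of \<open>lam x\<close>, which gives
  comparison with a product of one-dimensional integrable functions.\<close>

lemma integrable_lam_power: "integrable lborel (\<lambda>x::'a::euclidean_space. 1 / lam x ^ (2 * DIM('a)))"
proof (rule Bochner_Integration.integrable_bound)
  have "integrable lborel (\<lambda>t::real. inverse (1 + t\<^sup>2))"
    using integrable_inverse_1_plus_square by (simp add: set_integrable_def einterval_def)
  then show "integrable lborel (\<lambda>x::'a. \<Prod>b\<in>Basis. inverse (1 + (x \<bullet> b)\<^sup>2))"
    by (intro lborel_integral_prod_Basis(1))
  show "(\<lambda>x::'a. 1 / lam x ^ (2 * DIM('a))) \<in> borel_measurable lborel"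
    unfolding lam_def by measurable
  show "AE x in lborel. norm (1 / lam (x::'a) ^ (2 * DIM('a))) \<le> norm (\<Prod>b\<in>Basis. inverse (1 + (x \<bullet> b)\<^sup>2))"
  proof (rule AE_I2)
    fix x :: 'a
    have pos: "0 < (\<Prod>b\<in>Basis. 1 + (x \<bullet> b)\<^sup>2)" by (intro prod_pos) (auto intro: add_pos_nonneg)
    have "(\<Prod>b\<in>Basis. 1 + (x \<bullet> b)\<^sup>2) \<le> (\<Prod>b\<in>(Basis::'a set). (lam x)\<^sup>2)"
    proof (rule prod_mono, intro conjI)
      fix b :: 'a assume "b \<in> Basis"
      then have "(x \<bullet> b)\<^sup>2 \<le> (norm x)\<^sup>2" using Basis_le_norm[of b x] by (metis abs_le_square_iff abs_norm_cancel)
      moreover have "(lam x)\<^sup>2 = 1 + 2 * norm x + (norm x)\<^sup>2" by (simp add: lam_def power2_sum)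
      ultimately show "1 + (x \<bullet> b)\<^sup>2 \<le> (lam x)\<^sup>2" using norm_ge_zero[of x] by linarith
    qed (simp add: add_nonneg_nonneg)
    also have "\<dots> = lam x ^ (2 * DIM('a))" by (simp add: power_mult)
    finally have "inverse (lam x ^ (2 * DIM('a))) \<le> inverse (\<Prod>b\<in>Basis. 1 + (x \<bullet> b)\<^sup>2)"
      by (rule le_imp_inverse_le[OF _ pos])
    also have "\<dots> = (\<Prod>b\<in>Basis. inverse (1 + (x \<bullet> b)\<^sup>2))"
      by (simp add: prod_inversef[symmetric])
    finally have *: "1 / lam x ^ (2 * DIM('a)) \<le> (\<Prod>b\<in>Basis. inverse (1 + (x \<bullet> b)\<^sup>2))"
      by (simp add: inverse_eq_divide)
    moreover have "0 \<le> 1 / lam x ^ (2 * DIM('a))" using lam_ge_1[of x] by simp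
    ultimately show "norm (1 / lam x ^ (2 * DIM('a))) \<le> norm (\<Prod>b\<in>Basis. inverse (1 + (x \<bullet> b)\<^sup>2))"
      by simp
  qed
qed

lemma decay_imp_integrable:
  fixes u :: "'a::euclidean_space \<Rightarrow> complex"
  assumes [measurable]: "u \<in> borel_measurable borel" and C: "\<And>x. norm (u x) \<le> C / lam x ^ (2 * DIM('a))"
  shows "integrable lborel u"
proof (rule Bochner_Integration.integrable_bound)
  show "integrable lborel (\<lambda>x::'a. C * (1 / lam x ^ (2 * DIM('a))))"
    by (intro integrable_mult_right integrable_lam_power)
  show "AE x in lborel. norm (u x) \<le> norm (C * (1 / lam x ^ (2 * DIM('a))))"
  proof (rule AE_I2)
    fix x
    have "norm (u x) \<le> C * (1 / lam x ^ (2 * DIM('a)))" using C[of x] by simp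
    also have "\<dots> \<le> norm (C * (1 / lam x ^ (2 * DIM('a))))" by (simp only: real_norm_def abs_ge_self)
    finally show "norm (u x) \<le> norm (C * (1 / lam x ^ (2 * DIM('a))))" .
  qed
qed simp

lemma decay_imp_L12:
  fixes u :: "'a::euclidean_space \<Rightarrow> complex"
  assumes u: "u \<in> borel_measurable borel" and C: "\<And>x. norm (u x) \<le> C / lam x ^ (2 * DIM('a))"
  shows "u \<in> L12"
proof -
  note [measurable] = u
  have int: "integrable lborel u" by (rule decay_imp_integrable[OF u C])
  have "integrable lborel (\<lambda>x. (norm (u x))\<^sup>2)"
  proof (rule Bochner_Integration.integrable_bound)
    show "integrable lborel (\<lambda>x. C * norm (u x))" using int by simp
    show "AE x in lborel. norm ((norm (u x))\<^sup>2) \<le> norm (C * norm (u x))"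
    proof (rule AE_I2)
      fix x :: 'a
      have p: "1 \<le> lam x ^ (2 * DIM('a))" using lam_ge_1[of x] by (rule one_le_power)
      have "0 \<le> C / lam x ^ (2 * DIM('a))" using order_trans[OF norm_ge_zero C[of x]] .
      then have "0 \<le> C" using p by (simp add: zero_le_divide_iff)
      then have "C / lam x ^ (2 * DIM('a)) \<le> C / 1" using p by (intro divide_left_mono) auto
      then have "norm (u x) \<le> C" using C[of x] by simp
      then have "norm (u x) * norm (u x) \<le> C * norm (u x)" by (rule mult_right_mono) simp
      then show "norm ((norm (u x))\<^sup>2) \<le> norm (C * norm (u x))" by (simp add: power2_eq_square)
    qed
  qed measurable
  with int u show ?thesis by (simp add: L12_def)
qed

lemma lborel_integral_translate:
  fixes h :: "'a::euclidean_space \<Rightarrow> 'b::{banach, second_countable_topology}"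
  assumes "integrable lborel h"
  shows "integrable lborel (\<lambda>x. h (c + x))" "(LINT x|lborel. h (c + x)) = (LINT x|lborel. h x)"
proof -
  have m: "h \<in> borel_measurable borel" using borel_measurable_integrable[OF assms] by simp
  have t: "(+) c \<in> lborel \<rightarrow>\<^sub>M borel" by simp
  have "integrable (distr lborel borel ((+) c)) h" using assms by (simp add: lborel_distr_plus)
  then show "integrable lborel (\<lambda>x. h (c + x))" by (simp add: integrable_distr_eq[OF t m])
  have "(LINT x|lborel. h x) = (LINT x|distr lborel borel ((+) c). h x)" by (simp add: lborel_distr_plus)
  then show "(LINT x|lborel. h (c + x)) = (LINT x|lborel. h x)" by (simp add: integral_distr[OF t m])
qed

lemma norm_difference_le_partial_deriv:
  fixes h :: "'a::real_normed_vector \<Rightarrow> 'b::real_normed_vector"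
  assumes h: "\<And>z. h differentiable (at z)" and t: "0 \<le> t" and B: "\<And>s. s \<in> {0..t} \<Longrightarrow> norm (partial_deriv b h (x + s *\<^sub>R b)) \<le> B"
  shows "norm (h (x + t *\<^sub>R b) - h x) \<le> B * t"
proof -
  have "norm (h (x + t *\<^sub>R b) - h (x + 0 *\<^sub>R b)) \<le> B * norm (t - 0)"
  proof (rule differentiable_bound[of "{0..t}" "\<lambda>s. h (x + s *\<^sub>R b)" "\<lambda>s r. r *\<^sub>R partial_deriv b h (x + s *\<^sub>R b)"])
    fix s assume s: "s \<in> {0..t}"
    show "((\<lambda>s. h (x + s *\<^sub>R b)) has_derivative (\<lambda>r. r *\<^sub>R partial_deriv b h (x + s *\<^sub>R b))) (at s within {0..t})"
      by (rule has_derivative_at_withinI)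
        (use has_vector_derivative_along[OF h] in \<open>simp add: has_vector_derivative_def\<close>)
    show "onorm (\<lambda>r. r *\<^sub>R partial_deriv b h (x + s *\<^sub>R b)) \<le> B"
    proof (rule onorm_bound)
      show "norm (r *\<^sub>R partial_deriv b h (x + s *\<^sub>R b)) \<le> B * norm r" for r
        using mult_left_mono[OF B[OF s], of "norm r"] by (simp add: mult.commute)
    qed (rule order_trans[OF norm_ge_zero B[OF s]])
  qed (use t in auto)
  then show ?thesis using t by simp
qed

text \<open>Translation invariance makes the integrals of the difference quotients vanish.\<close>

lemma integral_partial_deriv_eq_0:
  fixes h :: "'a::euclidean_space \<Rightarrow> complex"
  assumes h: "\<And>z. h differentiable (at z)" and b: "b \<in> Basis" and c: "continuous_on UNIV (partial_deriv b h)"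
    and C: "\<And>x. norm (h x) \<le> C / lam x ^ (2 * DIM('a))" "\<And>x. norm (partial_deriv b h x) \<le> C / lam x ^ (2 * DIM('a))"
  shows "(LINT x|lborel. partial_deriv b h x) = 0"
proof -
  define t where "t n = inverse (real (Suc n))" for n
  have t: "0 < t n" "t n \<le> 1" for n by (simp_all add: t_def inverse_le_1_iff)
  have t0: "t \<longlonglongrightarrow> 0" unfolding t_def[abs_def] by (rule LIMSEQ_inverse_real_of_nat)
  define q where "q n x = (1 / t n) *\<^sub>R (h (x + t n *\<^sub>R b) - h x)" for n x
  have conth: "continuous_on UNIV h"
    using h by (auto simp: continuous_on_eq_continuous_at intro: differentiable_imp_continuous_within)
  have [measurable]: "h \<in> borel_measurable borel" "partial_deriv b h \<in> borel_measurable borel"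
    by (rule borel_measurable_continuous_onI[OF conth], rule borel_measurable_continuous_onI[OF c])
  have hi: "integrable lborel h" by (rule decay_imp_integrable[OF _ C(1)]) simp
  have C0: "0 \<le> C"
    using order_trans[OF norm_ge_zero C(1)[of 0]] by (simp add: lam_def)
  have "(\<lambda>n. LINT x|lborel. q n x) \<longlonglongrightarrow> (LINT x|lborel. partial_deriv b h x)"
  proof (rule integral_dominated_convergence)
    \<comment> \<open>The step sizes are at most 1, and a displacement by at most 1 changes
      \<open>lam\<close> by a factor of at most 2; the extra power of 2 pays for this in the bound
      of the difference quotients.\<close>
    show "integrable lborel (\<lambda>x::'a. (C * 2 ^ (2 * DIM('a))) * (1 / lam x ^ (2 * DIM('a))))"
      by (intro integrable_mult_right integrable_lam_power)
    show "AE x in lborel. (\<lambda>n. q n x) \<longlonglongrightarrow> partial_deriv b h x"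
    proof (rule AE_I2)
      fix x
      have "((\<lambda>s. h (x + s *\<^sub>R b)) has_vector_derivative partial_deriv b h (x + 0 *\<^sub>R b)) (at 0)"
        by (rule has_vector_derivative_along[OF h])
      then have "((\<lambda>s. norm (h (x + s *\<^sub>R b) - h x - s *\<^sub>R partial_deriv b h x) / norm s) \<longlongrightarrow> 0) (at 0)"
        by (simp add: has_vector_derivative_def has_derivative_at)
      moreover have "filterlim t (at 0) sequentially"
        unfolding filterlim_at using t0 t(1) by (auto intro!: always_eventually less_imp_neq[symmetric])
      ultimately have "(\<lambda>n. norm (h (x + t n *\<^sub>R b) - h x - t n *\<^sub>R partial_deriv b h x) / norm (t n)) \<longlonglongrightarrow> 0"
        by (rule filterlim_compose)
      moreover have "norm (h (x + t n *\<^sub>R b) - h x - t n *\<^sub>R partial_deriv b h x) / norm (t n) = norm (q n x - partial_deriv b h x)" for n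
      proof -
        have "q n x - partial_deriv b h x = (1 / t n) *\<^sub>R (h (x + t n *\<^sub>R b) - h x - t n *\<^sub>R partial_deriv b h x)"
          using t(1)[of n] by (simp add: q_def scaleR_diff_right)
        then show ?thesis using t(1)[of n] by simp
      qed
      ultimately have "(\<lambda>n. norm (q n x - partial_deriv b h x)) \<longlonglongrightarrow> 0" by (simp only:)
      then have "(\<lambda>n. q n x - partial_deriv b h x) \<longlonglongrightarrow> 0" by (rule tendsto_norm_zero_cancel)
      then show "(\<lambda>n. q n x) \<longlonglongrightarrow> partial_deriv b h x" by (rule LIM_zero_cancel)
    qed
    show "AE x in lborel. norm (q n x) \<le> (C * 2 ^ (2 * DIM('a))) * (1 / lam x ^ (2 * DIM('a)))" for n
    proof (rule AE_I2)
      fix x :: 'a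
      have "norm (h (x + t n *\<^sub>R b) - h x) \<le> ((C * 2 ^ (2 * DIM('a))) * (1 / lam x ^ (2 * DIM('a)))) * t n"
      proof (rule norm_difference_le_partial_deriv[OF h])
        fix s assume s: "s \<in> {0..t n}"
        define y where "y = x + s *\<^sub>R b"
        have "norm x \<le> norm y + norm (s *\<^sub>R b)" unfolding y_def by (metis add_diff_cancel norm_triangle_ineq4)
        also have "norm (s *\<^sub>R b) \<le> 1" using s t(2)[of n] b by simp
        finally have "norm x \<le> norm y + 1" by simp
        have "lam x \<le> 2 * lam y"
        proof -
          have "1 + norm x \<le> 2 + norm y" using \<open>norm x \<le> norm y + 1\<close> by simp
          also have "\<dots> \<le> 2 * (1 + norm y)" using norm_ge_zero[of y] by simp
          finally show ?thesis by (simp add: lam_def)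
        qed
        then have l: "lam x \<le> 2 * lam (x + s *\<^sub>R b)" by (simp add: y_def)
        then have "lam x ^ (2 * DIM('a)) \<le> (2 * lam (x + s *\<^sub>R b)) ^ (2 * DIM('a))"
          using lam_ge_1[of x] by (intro power_mono) auto
        then have "lam x ^ (2 * DIM('a)) \<le> 2 ^ (2 * DIM('a)) * lam (x + s *\<^sub>R b) ^ (2 * DIM('a))"
          by (simp only: power_mult_distrib)
        moreover have "0 < lam x ^ (2 * DIM('a))" "0 < lam (x + s *\<^sub>R b) ^ (2 * DIM('a))"
          using lam_ge_1[of x] lam_ge_1[of "x + s *\<^sub>R b"] by (auto intro!: zero_less_power)
        ultimately have "C / lam (x + s *\<^sub>R b) ^ (2 * DIM('a)) \<le> (C * 2 ^ (2 * DIM('a))) * (1 / lam x ^ (2 * DIM('a)))"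
          using C0 mult_left_mono[of "lam x ^ (2 * DIM('a))" "2 ^ (2 * DIM('a)) * lam (x + s *\<^sub>R b) ^ (2 * DIM('a))" C]
          by (simp add: divide_simps mult_ac)
        with C(2)[of "x + s *\<^sub>R b"] show "norm (partial_deriv b h (x + s *\<^sub>R b)) \<le> (C * 2 ^ (2 * DIM('a))) * (1 / lam x ^ (2 * DIM('a)))"
          by (rule order_trans)
      qed (use t(1)[of n] in simp)
      then show "norm (q n x) \<le> (C * 2 ^ (2 * DIM('a))) * (1 / lam x ^ (2 * DIM('a)))"
        using t(1)[of n] by (simp add: q_def pos_divide_le_eq)
    qed
    show "q n \<in> borel_measurable lborel" for n unfolding q_def[abs_def] by measurable
  qed measurable
  moreover have "(LINT x|lborel. q n x) = 0" for n
  proof -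
    have "(LINT x|lborel. h (x + t n *\<^sub>R b) - h x) = 0"
      using lborel_integral_translate[OF hi, of "t n *\<^sub>R b"] hi by (simp add: add.commute)
    then show ?thesis by (simp add: q_def)
  qed
  ultimately show ?thesis using LIMSEQ_unique[OF tendsto_const] by fastforce
qed

section \<open>The Fourier transform\<close>

definition fourier_phase :: "'a::euclidean_space \<times> 'a \<Rightarrow> real"
  where "fourier_phase z = - (fst z \<bullet> snd z)"

lemma fourier_eq_kop:
  assumes "u \<in> borel_measurable borel"
  shows "fourier u = kop (\<lambda>z. cis (fourier_phase z)) u"
proof
  fix \<theta> :: 'a
  have [measurable]: "u \<in> borel_measurable borel" by (rule assms)
  have "(\<lambda>y. exp (- \<i> * of_real (y \<bullet> \<theta>)) * u y) \<in> borel_measurable lborel" by measurable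
  then have "fourier u \<theta> = (LINT y|lborel. exp (- \<i> * of_real (y \<bullet> \<theta>)) * u y)"
    unfolding fourier_def by (rule integral_completion)
  then show "fourier u \<theta> = kop (\<lambda>z. cis (fourier_phase z)) u \<theta>"
    by (simp add: kop_def fourier_phase_def cis_conv_exp inner_commute)
qed

lemma smooth_onI:
  assumes "\<And>z. f differentiable (at z)" "\<And>b. b \<in> Basis \<Longrightarrow> smooth_on UNIV (partial_deriv b f)"
  shows "smooth_on UNIV f"
  unfolding smooth_on_def
proof
  fix k
  show "times_differentiable_on k UNIV f"
  proof (cases k)
    case 0
    then show ?thesis
      using assms(1) by (auto simp: continuous_on_eq_continuous_at intro: differentiable_imp_continuous_within)
  qed (use assms in \<open>auto simp: smooth_on_def\<close>)
qed

lemma partial_deriv_const: "partial_deriv b (\<lambda>z. c) = (\<lambda>z. 0)"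
  by (simp add: partial_deriv_def fun_eq_iff)

lemma smooth_on_const: "smooth_on UNIV (\<lambda>z::'a::euclidean_space. c :: 'b::real_normed_vector)"
proof -
  have "times_differentiable_on k UNIV (\<lambda>z::'a. c)" for k and c :: 'b
    by (induction k arbitrary: c) (simp_all add: partial_deriv_const)
  then show ?thesis by (simp add: smooth_on_def)
qed

lemma pds_const: "pds ls (\<lambda>z. c) = (\<lambda>z. if ls = [] then c else 0)"
  by (induction ls) (simp_all add: partial_deriv_const)

lemma nondegenerate_fourier_phase: "nondegenerate_phase (fourier_phase :: 'a::euclidean_space \<times> 'a \<Rightarrow> real)"
proof -
  have d: "(fourier_phase has_derivative (\<lambda>h. - (fst h \<bullet> snd z + fst z \<bullet> snd h))) (at z)" for z :: "'a \<times> 'a"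
    unfolding fourier_phase_def by (auto intro!: derivative_eq_intros simp: add.commute)
  have d1: "partial_deriv b fourier_phase = (\<lambda>z. - (fst b \<bullet> snd z + fst z \<bullet> snd b))" for b :: "'a \<times> 'a"
    by (intro ext) (rule partial_deriv_unique[OF d])
  have dd: "((\<lambda>z. - (fst b \<bullet> snd z + fst z \<bullet> snd b)) has_derivative (\<lambda>h. - (fst b \<bullet> snd h + fst h \<bullet> snd b))) (at z)"
    for b z :: "'a \<times> 'a"
    by (auto intro!: derivative_eq_intros)
  have d2: "partial_deriv c (partial_deriv b fourier_phase) = (\<lambda>z. - (fst b \<bullet> snd c + fst c \<bullet> snd b))" for b c :: "'a \<times> 'a"
    unfolding d1 by (intro ext) (rule partial_deriv_unique[OF dd])
  have sm: "smooth_on UNIV (fourier_phase :: 'a \<times> 'a \<Rightarrow> real)"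
  proof (rule smooth_onI)
    show "smooth_on UNIV (partial_deriv b (fourier_phase :: 'a \<times> 'a \<Rightarrow> real))" for b
      by (rule smooth_onI) (simp_all only: d2 smooth_on_const, unfold d1, rule differentiableI[OF dd])
  qed (rule differentiableI[OF d])
  have bd: "\<exists>C. \<forall>z. norm (pds ls (fourier_phase :: 'a \<times> 'a \<Rightarrow> real) z) \<le> C" if len: "2 \<le> length ls" for ls
  proof -
    obtain ks b c where ls: "ls = ks @ [c, b]"
    proof -
      from len have "ls \<noteq> []" by auto
      then obtain ls' b where 1: "ls = ls' @ [b]" by (metis append_butlast_last_id)
      with len have "ls' \<noteq> []" by auto
      then obtain ks c where "ls' = ks @ [c]" by (metis append_butlast_last_id)
      with 1 show thesis using that[of ks c b] by simp
    qed
    show ?thesis by (intro exI[of _ "\<bar>- (fst b \<bullet> snd c + fst c \<bullet> snd b)\<bar>"]) (simp add: ls d2 pds_const)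
  qed
  have g1: "grad1 fourier_phase (x, \<theta>) = - \<theta>" and g2: "grad2 fourier_phase (x, \<theta>) = - x" for x \<theta> :: 'a
    by (simp_all add: grad1_def grad2_def d1 sum_negf euclidean_representation inner_commute[of _ \<theta>])
  show ?thesis
    unfolding nondegenerate_phase_def using sm bd
    by (auto simp: g1 g2 dist_norm norm_minus_commute intro!: exI[of _ "1::real"])
qed

lemma deriv_bounded_const: "norm c \<le> M \<Longrightarrow> 0 \<le> M \<Longrightarrow> deriv_bounded n M K (\<lambda>z. c)"
  by (induction n arbitrary: c) (simp_all add: partial_deriv_const)

lemma bounded_fourier_kernel:
  obtains C where "kernel_bound (\<lambda>z::'a::euclidean_space \<times> 'a. cis (fourier_phase z)) C"
proof -
  obtain C where C: "\<forall>a Q M. 0 \<le> M \<longrightarrow> continuous_on UNIV a \<longrightarrow> {z. vfloor z \<in> Q} \<in> sets borel \<longrightarrow>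
      (\<forall>k. k \<in> lattice \<longrightarrow> k \<in> Q \<longrightarrow> deriv_bounded DIM('a \<times> 'a) M (cbox k (k + One)) a) \<longrightarrow>
      kernel_bound (\<lambda>z::'a \<times> 'a. of_bool (vfloor z \<in> Q) * (cis (fourier_phase z) * a z)) (C * M)"
    using oscillatory_kernel_bound[OF nondegenerate_fourier_phase] by blast
  have "kernel_bound (\<lambda>z::'a \<times> 'a. of_bool (vfloor z \<in> UNIV) * (cis (fourier_phase z) * 1)) (C * 1)"
    by (rule C[rule_format]) (auto intro: deriv_bounded_const)
  then show thesis using that[of "C * 1"] by simp
qed

section \<open>Fourier transforms of Schwartz functions\<close>

lemma schwartz_smooth: "u \<in> schwartz \<Longrightarrow> smooth_on UNIV u"
  by (simp add: schwartz_def)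

lemma schwartz_pds_decay:
  fixes u :: "'a::euclidean_space \<Rightarrow> complex"
  assumes u: "u \<in> schwartz" and ls: "set ls \<subseteq> Basis"
  shows "\<exists>C. \<forall>x. norm (pds ls u x) \<le> C / lam x ^ k"
proof -
  have sm: "smooth_on UNIV u" by (rule schwartz_smooth[OF u])
  have "\<exists>C. \<forall>x. lam x ^ k * norm (mderiv (count_list ls) u x) \<le> C"
    using u by (simp add: schwartz_def)
  then obtain C where C: "\<And>x. lam x ^ k * norm (pds ls u x) \<le> C"
    unfolding pds_eq_mderiv[OF sm ls] by blast
  have "norm (pds ls u x) \<le> C / lam x ^ k" for x
  proof -
    have "0 < lam x ^ k" using lam_ge_1[of x] by (intro zero_less_power) simp
    then show ?thesis using C[of x] by (simp add: pos_le_divide_eq mult.commute)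
  qed
  then show ?thesis by blast
qed

lemma pds_schwartz_L12:
  fixes u :: "'a::euclidean_space \<Rightarrow> complex"
  assumes u: "u \<in> schwartz" and ls: "set ls \<subseteq> Basis"
  shows "pds ls u \<in> L12"
proof -
  obtain C where "\<And>x. norm (pds ls u x) \<le> C / lam x ^ (2 * DIM('a))" using schwartz_pds_decay[OF u ls] by blast
  moreover have "pds ls u \<in> borel_measurable borel"
    by (intro borel_measurable_continuous_onI smooth_on_imp_continuous smooth_on_pds schwartz_smooth u ls)
  ultimately show ?thesis by (intro decay_imp_L12)
qed

text \<open>Integration by parts: the derivative of
  \<open>cis (- (\<theta> \<bullet> y)) * g y\<close> in y has integral 0, and the product rule
  splits it into the two sides.\<close>

lemma fourier_partial_deriv:
  fixes u :: "'a::euclidean_space \<Rightarrow> complex"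
  assumes u: "u \<in> schwartz" and ls: "set ls \<subseteq> Basis" and b: "b \<in> Basis"
  shows "kop (\<lambda>z. cis (fourier_phase z)) (pds (b # ls) u) \<theta> =
    \<i> * of_real (\<theta> \<bullet> b) * kop (\<lambda>z. cis (fourier_phase z)) (pds ls u) \<theta>"
proof -
  define g where "g = pds ls u"
  have sm: "smooth_on UNIV g" unfolding g_def by (intro smooth_on_pds schwartz_smooth u ls)
  have bls: "set (b # ls) \<subseteq> Basis" using b ls by simp
  obtain C1 where C1: "\<And>x. norm (g x) \<le> C1 / lam x ^ (2 * DIM('a))" unfolding g_def using schwartz_pds_decay[OF u ls] by blast
  obtain C2 where C2: "\<And>x. norm (partial_deriv b g x) \<le> C2 / lam x ^ (2 * DIM('a))"
    using schwartz_pds_decay[OF u bls] unfolding g_def pds_simps by blast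
  have i: "integrable lborel g" "integrable lborel (partial_deriv b g)"
    using pds_schwartz_L12[OF u ls] pds_schwartz_L12[OF u bls] by (simp_all add: L12_def g_def)
  define h where "h y = cis (- (\<theta> \<bullet> y)) * g y" for y
  have dh: "(h has_derivative (\<lambda>k. cis (- (\<theta> \<bullet> y)) * g' k + ((- (\<theta> \<bullet> k)) *\<^sub>R (\<i> * cis (- (\<theta> \<bullet> y)))) * g y)) (at y)"
    if "(g has_derivative g') (at y)" for y g'
  proof -
    have "(cis has_derivative (\<lambda>t. t *\<^sub>R (\<i> * cis (- (\<theta> \<bullet> y))))) (at (- (\<theta> \<bullet> y)))"
      using has_vector_derivative_real_field[of "\<lambda>t. exp (\<i> * t)" "\<i> * exp (\<i> * - (\<theta> \<bullet> y))" "- (\<theta> \<bullet> y)" UNIV]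
      by (auto simp: has_vector_derivative_def cis_conv_exp intro!: derivative_eq_intros)
    moreover have "((\<lambda>y. - (\<theta> \<bullet> y)) has_derivative (\<lambda>k. - (\<theta> \<bullet> k))) (at y)"
      by (auto intro!: derivative_eq_intros)
    ultimately have "((\<lambda>y. cis (- (\<theta> \<bullet> y))) has_derivative (\<lambda>k. (- (\<theta> \<bullet> k)) *\<^sub>R (\<i> * cis (- (\<theta> \<bullet> y))))) (at y)"
      using has_derivative_compose by blast
    from has_derivative_mult[OF this that] show ?thesis unfolding h_def .
  qed
  have gd: "\<exists>g'. (g has_derivative g') (at y)" for y
    using smooth_on_imp_differentiable[OF sm] by (auto simp: differentiable_def)
  have ph: "partial_deriv b h = (\<lambda>y. cis (- (\<theta> \<bullet> y)) * partial_deriv b g y - \<i> * of_real (\<theta> \<bullet> b) * (cis (- (\<theta> \<bullet> y)) * g y))"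
  proof
    fix y
    obtain g' where g': "(g has_derivative g') (at y)" using gd by blast
    show "partial_deriv b h y = cis (- (\<theta> \<bullet> y)) * partial_deriv b g y - \<i> * of_real (\<theta> \<bullet> b) * (cis (- (\<theta> \<bullet> y)) * g y)"
      unfolding partial_deriv_unique[OF dh[OF g']] partial_deriv_unique[OF g'] by (simp add: scaleR_conv_of_real)
  qed
  have "(LINT y|lborel. partial_deriv b h y) = 0"
  \<comment> \<open>One constant has to dominate both h and its derivative; it may depend on
    \<theta>, which is fixed here.\<close>
  proof (rule integral_partial_deriv_eq_0[where C = "C1 + (C2 + \<bar>\<theta> \<bullet> b\<bar> * C1)", OF _ b])
    have C10: "0 \<le> C1" "0 \<le> C2" using order_trans[OF norm_ge_zero C1[of 0]] order_trans[OF norm_ge_zero C2[of 0]] by (simp_all add: lam_def)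
    show "h differentiable (at z)" for z using dh gd differentiableI by blast
    show "continuous_on UNIV (partial_deriv b h)"
      unfolding ph by (intro continuous_intros smooth_on_imp_continuous smooth_on_partial_deriv sm b)
    fix x :: 'a
    have l: "0 < lam x ^ (2 * DIM('a))" using lam_ge_1[of x] by (intro zero_less_power) simp
    have "norm (h x) \<le> C1 / lam x ^ (2 * DIM('a))" using C1[of x] by (simp add: h_def norm_mult)
    also have "\<dots> \<le> (C1 + (C2 + \<bar>\<theta> \<bullet> b\<bar> * C1)) / lam x ^ (2 * DIM('a))"
      using l C10 by (intro divide_right_mono) auto
    finally show "norm (h x) \<le> (C1 + (C2 + \<bar>\<theta> \<bullet> b\<bar> * C1)) / lam x ^ (2 * DIM('a))" .
    have "norm (partial_deriv b h x) \<le> norm (partial_deriv b g x) + \<bar>\<theta> \<bullet> b\<bar> * norm (g x)"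
      unfolding ph by (rule order_trans[OF norm_triangle_ineq4]) (simp add: norm_mult)
    also have "\<dots> \<le> C2 / lam x ^ (2 * DIM('a)) + \<bar>\<theta> \<bullet> b\<bar> * (C1 / lam x ^ (2 * DIM('a)))"
      by (intro add_mono mult_left_mono C1 C2) simp
    also have "\<dots> = (C2 + \<bar>\<theta> \<bullet> b\<bar> * C1) / lam x ^ (2 * DIM('a))" by (simp add: add_divide_distrib)
    also have "\<dots> \<le> (C1 + (C2 + \<bar>\<theta> \<bullet> b\<bar> * C1)) / lam x ^ (2 * DIM('a))"
      using l C10 by (intro divide_right_mono) auto
    finally show "norm (partial_deriv b h x) \<le> (C1 + (C2 + \<bar>\<theta> \<bullet> b\<bar> * C1)) / lam x ^ (2 * DIM('a))" .
  qed
  moreover have bk: "bounded_kernel (\<lambda>z::'a \<times> 'a. cis (fourier_phase z))"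
    using bounded_fourier_kernel kernel_bound_def by metis
  ultimately have "(LINT y|lborel. cis (- (\<theta> \<bullet> y)) * partial_deriv b g y) = \<i> * of_real (\<theta> \<bullet> b) * (LINT y|lborel. cis (- (\<theta> \<bullet> y)) * g y)"
    using integrable_kernel[OF bk i(1), of \<theta>] integrable_kernel[OF bk i(2), of \<theta>]
    by (simp add: ph fourier_phase_def)
  then show ?thesis by (simp add: kop_def fourier_phase_def g_def)
qed

text \<open>Let s be the largest of 1 and the absolute coordinates. Then \<open>lam \<theta>\<close>
  is at most (1 + dimension) * s, and the m-th power of s is one of the terms on the right. Thus
  powers of single coordinates control all of \<open>lam\<close>.\<close>

lemma lam_power_le_sum:
  fixes \<theta> :: "'a::euclidean_space"
  shows "lam \<theta> ^ m \<le> (1 + real DIM('a)) ^ m * (1 + (\<Sum>b\<in>Basis. \<bar>\<theta> \<bullet> b\<bar> ^ m))"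
proof -
  define A where "A = insert 1 ((\<lambda>b. \<bar>\<theta> \<bullet> b\<bar>) ` Basis)"
  define s where "s = Max A"
  have A: "finite A" "A \<noteq> {}" by (auto simp: A_def)
  have "y \<le> s" if "y \<in> A" for y unfolding s_def by (rule Max_ge[OF A(1) that])
  then have s: "1 \<le> s" "\<And>b. b \<in> Basis \<Longrightarrow> \<bar>\<theta> \<bullet> b\<bar> \<le> s" by (simp_all add: A_def)
  have "s \<in> A" unfolding s_def by (rule Max_in[OF A])
  then have sm: "s ^ m \<le> 1 + (\<Sum>b\<in>Basis. \<bar>\<theta> \<bullet> b\<bar> ^ m)"
  proof -
    consider "s = 1" | b where "b \<in> Basis" "s = \<bar>\<theta> \<bullet> b\<bar>" using \<open>s \<in> A\<close> by (auto simp: A_def)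
    then show ?thesis
    proof cases
      case 1
      then show ?thesis by (simp add: sum_nonneg)
    next
      case 2
      then show ?thesis using member_le_sum[of b Basis "\<lambda>b. \<bar>\<theta> \<bullet> b\<bar> ^ m"] by simp
    qed
  qed
  have "norm \<theta> \<le> (\<Sum>b\<in>Basis. \<bar>\<theta> \<bullet> b\<bar>)" by (rule norm_le_l1)
  also have "\<dots> \<le> (\<Sum>b\<in>(Basis::'a set). s)" by (intro sum_mono s)
  finally have "lam \<theta> \<le> (1 + real DIM('a)) * s" using s(1) by (simp add: lam_def distrib_right)
  then have "lam \<theta> ^ m \<le> ((1 + real DIM('a)) * s) ^ m" using lam_ge_1[of \<theta>] by (intro power_mono) auto
  also have "\<dots> \<le> (1 + real DIM('a)) ^ m * (1 + (\<Sum>b\<in>Basis. \<bar>\<theta> \<bullet> b\<bar> ^ m))"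
    unfolding power_mult_distrib by (intro mult_left_mono sm) simp
  finally show ?thesis .
qed

lemma schwartz_L12: "u \<in> schwartz \<Longrightarrow> u \<in> L12"
  using pds_schwartz_L12[of u "[]"] by simp

text \<open>Differentiating 2 * dimension times in each single direction gives decay of that order,
  just enough for \<open>L12\<close>. Membership there lets T act on \<open>fourier u\<close> by its
  pointwise kernel formula.\<close>

lemma fourier_schwartz_L12:
  fixes u :: "'a::euclidean_space \<Rightarrow> complex"
  assumes u: "u \<in> schwartz"
  shows "fourier u \<in> L12"
proof -
  define m where "m = 2 * DIM('a)"
  have bk: "bounded_kernel (\<lambda>z::'a \<times> 'a. cis (fourier_phase z))"
    using bounded_fourier_kernel kernel_bound_def by metis
  have um: "u \<in> borel_measurable borel" using schwartz_L12[OF u] by (simp add: L12_def)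
  define F where "F v = kop (\<lambda>z::'a \<times> 'a. cis (fourier_phase z)) v" for v
  have fu: "fourier u = F u" unfolding F_def by (rule fourier_eq_kop[OF um])
  have Fb: "norm (F v \<theta>) \<le> (LINT y|lborel. norm (v y))" if "v \<in> L12" for v \<theta>
    using norm_kop_le[of "\<lambda>z. cis (fourier_phase z)" 1 v \<theta>] that by (simp add: F_def)
  have rep: "F (pds (replicate k b) u) \<theta> = (\<i> * of_real (\<theta> \<bullet> b)) ^ k * F u \<theta>" if b: "b \<in> Basis" for k b \<theta>
  proof (induction k)
    case (Suc k)
    have "set (replicate k b) \<subseteq> Basis" using b by (auto simp: set_replicate_conv_if)
    from fourier_partial_deriv[OF u this b, of \<theta>] show ?case
      using Suc by (simp add: F_def mult.assoc)
  qed simp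
  have setr: "set (replicate k b) \<subseteq> Basis" if "b \<in> Basis" for k and b :: 'a
    using that by (auto simp: set_replicate_conv_if)
  define K where "K = (LINT y|lborel. norm (u y)) + (\<Sum>b\<in>Basis. LINT y|lborel. norm (pds (replicate m b) u y))"
  have "norm (fourier u \<theta>) \<le> ((1 + real DIM('a)) ^ m * K) / lam \<theta> ^ (2 * DIM('a))" for \<theta>
  proof -
    have "(\<Sum>b\<in>Basis. \<bar>\<theta> \<bullet> b\<bar> ^ m * norm (F u \<theta>)) \<le> (\<Sum>b\<in>Basis. LINT y|lborel. norm (pds (replicate m b) u y))"
    proof (rule sum_mono)
      fix b :: 'a assume b: "b \<in> Basis"
      have "\<bar>\<theta> \<bullet> b\<bar> ^ m * norm (F u \<theta>) = norm (F (pds (replicate m b) u) \<theta>)"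
        unfolding rep[OF b] by (simp add: norm_mult norm_power)
      also have "\<dots> \<le> (LINT y|lborel. norm (pds (replicate m b) u y))"
        by (rule Fb[OF pds_schwartz_L12[OF u setr[OF b]]])
      finally show "\<bar>\<theta> \<bullet> b\<bar> ^ m * norm (F u \<theta>) \<le> (LINT y|lborel. norm (pds (replicate m b) u y))" .
    qed
    then have "(1 + (\<Sum>b\<in>Basis. \<bar>\<theta> \<bullet> b\<bar> ^ m)) * norm (F u \<theta>) \<le> K"
      using Fb[OF schwartz_L12[OF u], of \<theta>] by (simp add: K_def distrib_right sum_distrib_right)
    then have "(1 + real DIM('a)) ^ m * ((1 + (\<Sum>b\<in>Basis. \<bar>\<theta> \<bullet> b\<bar> ^ m)) * norm (F u \<theta>)) \<le> (1 + real DIM('a)) ^ m * K"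
      by (intro mult_left_mono) simp_all
    moreover have "lam \<theta> ^ m * norm (F u \<theta>) \<le> (1 + real DIM('a)) ^ m * ((1 + (\<Sum>b\<in>Basis. \<bar>\<theta> \<bullet> b\<bar> ^ m)) * norm (F u \<theta>))"
      unfolding mult.assoc[symmetric] by (intro mult_right_mono lam_power_le_sum norm_ge_zero)
    ultimately have "lam \<theta> ^ m * norm (F u \<theta>) \<le> (1 + real DIM('a)) ^ m * K" by (rule order_trans[rotated])
    moreover have "0 < lam \<theta> ^ m" using lam_ge_1[of \<theta>] by (intro zero_less_power) simp
    ultimately show ?thesis by (simp add: fu m_def pos_le_divide_eq mult.commute)
  qed
  moreover have "fourier u \<in> borel_measurable borel"
    unfolding fu F_def by (rule kop_measurable[OF bk schwartz_L12[OF u]])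
  ultimately show ?thesis by (intro decay_imp_L12)
qed

section \<open>Nondegenerate phases from the hypotheses\<close>

text \<open>L sends basis vectors to basis vectors, so the partial derivatives of the composition
  are again of this form with a basis derivative of G, and induction applies. Slices of functions on
  a product are the intended case.\<close>

lemma smooth_on_compose_affine:
  fixes G :: "'a::euclidean_space \<Rightarrow> 'c::real_normed_vector" and L :: "'b::euclidean_space \<Rightarrow> 'a"
  assumes L: "bounded_linear L" "L ` Basis \<subseteq> Basis" and G: "smooth_on UNIV G"
  shows "smooth_on UNIV (\<lambda>x. G (c + L x))"
proof -
  note lin = bounded_linear.linear[OF L(1)]
  have "times_differentiable_on k UNIV (\<lambda>x. G (c + L x))" if "times_differentiable_on k UNIV G" for k and G :: "'a \<Rightarrow> 'c"
    using that
  proof (induction k arbitrary: G)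
    case 0
    then have G: "continuous_on UNIV G" by simp
    have "continuous_on UNIV (\<lambda>x. G (c + L x))"
      by (rule continuous_on_compose2[OF G])
        (auto intro!: continuous_intros bounded_linear.continuous_on[OF L(1)])
    then show ?case by simp
  next
    case (Suc k)
    have "(\<lambda>x. G (c + L x)) differentiable (at x)" for x
    proof -
      obtain G' where G': "(G has_derivative G') (at (c + L x))"
        using Suc.prems unfolding times_differentiable_on.simps differentiable_def by blast
      have "((\<lambda>x. c + L x) has_derivative L) (at x)"
        using has_derivative_add[OF has_derivative_const bounded_linear_imp_has_derivative[OF L(1)]] by simp
      from has_derivative_compose[OF this G'] show ?thesis by (rule differentiableI)
    qed
    moreover have "partial_deriv b (\<lambda>x. G (c + L x)) = (\<lambda>x. partial_deriv (L b) G (c + L x))" for b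
      by (simp add: partial_deriv_def fun_eq_iff linear_add[OF lin] linear_cmul[OF lin] add.assoc)
    moreover have "L b \<in> Basis" if "b \<in> Basis" for b using L(2) that by blast
    ultimately show ?case using Suc by simp
  qed
  with G show ?thesis by (simp add: smooth_on_def)
qed

lemma smooth_on_slice:
  fixes G :: "'a::euclidean_space \<times> 'b::euclidean_space \<Rightarrow> 'c::real_normed_vector"
  assumes "smooth_on UNIV G"
  shows "smooth_on UNIV (\<lambda>x. G (x, p))" "smooth_on UNIV (\<lambda>y. G (q, y))"
proof -
  have "smooth_on UNIV (\<lambda>x. G ((0, p) + (x, 0)))"
    by (rule smooth_on_compose_affine[OF bounded_linear_Pair[OF bounded_linear_ident bounded_linear_zero] _ assms])
      (auto simp: Basis_prod_def)
  then show "smooth_on UNIV (\<lambda>x. G (x, p))" by simp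
  have "smooth_on UNIV (\<lambda>y. G ((q, 0) + (0, y)))"
    by (rule smooth_on_compose_affine[OF bounded_linear_Pair[OF bounded_linear_zero bounded_linear_ident] _ assms])
      (auto simp: Basis_prod_def)
  then show "smooth_on UNIV (\<lambda>y. G (q, y))" by simp
qed

lemma sum_Basis_vec: "(\<Sum>b\<in>(Basis :: (real^'n) set). f b) = (\<Sum>j\<in>UNIV. f (axis j 1))"
proof -
  have B: "(Basis :: (real^'n) set) = (\<lambda>j. axis j 1) ` UNIV" by (auto simp: Basis_vec_def)
  have inj: "inj (\<lambda>j::'n. axis j (1::real))" by (auto simp: inj_on_def axis_eq_axis)
  show ?thesis unfolding B sum.reindex[OF inj] o_def ..
qed

text \<open>\<phi> i p is the i-th component of a partial gradient, with the other variable p held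
  fixed. Bounded second derivatives of the components make the Jacobian Lipschitz, uniformly in
  p.\<close>

lemma gradient_expansive:
  fixes \<phi> :: "'n \<Rightarrow> 'b \<Rightarrow> real^'n \<Rightarrow> real"
  assumes sm: "\<And>i p. smooth_on UNIV (\<phi> i p)"
    and C1: "\<And>i j p x. \<bar>partial_deriv (axis j 1) (\<phi> i p) x\<bar> \<le> C"
    and C2: "\<And>i j b p x. b \<in> Basis \<Longrightarrow> \<bar>partial_deriv b (partial_deriv (axis j 1) (\<phi> i p)) x\<bar> \<le> C"
    and \<delta>: "\<delta> > 0" "\<And>p x. \<delta> \<le> \<bar>det (\<chi> i j. partial_deriv (axis j 1) (\<phi> i p) x)\<bar>"
  shows "\<exists>c>0. \<forall>p x y. c * dist x y \<le> dist (\<chi> i. \<phi> i p x) (\<chi> i. \<phi> i p y)"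
proof -
  define J where "J p x = (\<chi> i j. partial_deriv (axis j 1) (\<phi> i p) x)" for p x
  define N where "N = real CARD('n)"
  have C0: "0 \<le> C" using order_trans[OF abs_ge_zero C1] .
  have "((\<lambda>x. \<chi> i. \<phi> i p x) has_derivative (\<lambda>h. J p x *v h)) (at x)" for p x
  proof (rule has_derivative_componentwise_within[THEN iffD2], rule ballI)
    fix b :: "real^'n" assume "b \<in> Basis"
    then obtain k where b: "b = axis k 1" by (auto simp: Basis_vec_def)
    have "(\<Sum>b\<in>Basis. (h \<bullet> b) *\<^sub>R partial_deriv b (\<phi> k p) x) = (J p x *v h) \<bullet> b" for h
      by (simp add: b sum_Basis_vec inner_axis matrix_vector_mult_def J_def mult.commute)
    with frechet_derivative_eq_sum_partial[OF smooth_on_imp_differentiable[OF sm[of k p]], of x]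
    show "((\<lambda>x. (\<chi> i. \<phi> i p x) \<bullet> b) has_derivative (\<lambda>h. (J p x *v h) \<bullet> b)) (at x)"
      by (simp add: b inner_axis)
  qed
  moreover have "\<delta> \<le> \<bar>det (J p x)\<bar>" for p x using \<delta>(2) by (simp add: J_def)
  moreover have "\<bar>J p x $ i $ j\<bar> \<le> C" for p x i j using C1 by (simp add: J_def)
  \<comment> \<open>One N comes from the Lipschitz constant of an entry, two from summing over
    columns and rows; the 1 makes the constant positive.\<close>
  moreover have "norm ((J p x - J p y) *v h) \<le> (N * (N * (N * C)) + 1) * dist x y * norm h" for p x y h
  proof -
    have e: "\<bar>(J p x - J p y) $ i $ j\<bar> \<le> N * C * dist x y" for i j
    proof -
      have "smooth_on UNIV (partial_deriv (axis j 1) (\<phi> i p))"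
        by (rule smooth_on_partial_deriv[OF sm]) (simp add: axis_in_Basis_iff)
      from Lipschitz_if_partial_derivs_bounded[OF smooth_on_imp_differentiable[OF this] C2, of x y]
      show ?thesis by (simp add: J_def N_def dist_norm)
    qed
    have "norm ((J p x - J p y) *v h) \<le> (\<Sum>i\<in>(UNIV::'n set). \<bar>((J p x - J p y) *v h) $ i\<bar>)" by (rule norm_le_l1_cart)
    also have "\<dots> \<le> (\<Sum>i\<in>(UNIV::'n set). N * (N * C * dist x y * norm h))"
    proof (rule sum_mono)
      fix i :: 'n
      have "\<bar>((J p x - J p y) *v h) $ i\<bar> \<le> (\<Sum>j\<in>(UNIV::'n set). N * C * dist x y * norm h)"
        unfolding matrix_vector_mult_def vec_lambda_beta
      proof (rule order_trans[OF sum_abs sum_mono])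
        fix j :: 'n
        show "\<bar>(J p x - J p y) $ i $ j * h $ j\<bar> \<le> N * C * dist x y * norm h"
          using mult_mono[OF e[of i j] component_le_norm_cart[of h j]] C0 by (simp add: abs_mult N_def)
      qed
      then show "\<bar>((J p x - J p y) *v h) $ i\<bar> \<le> N * (N * C * dist x y * norm h)" by (simp add: N_def)
    qed
    also have "\<dots> = (N * (N * (N * C))) * (dist x y * norm h)" by (simp add: N_def mult_ac)
    also have "\<dots> \<le> (N * (N * (N * C)) + 1) * (dist x y * norm h)" by (intro mult_right_mono) auto
    finally show ?thesis by (simp add: mult.assoc)
  qed
  moreover have "N * (N * (N * C)) + 1 > 0" using C0 by (simp add: N_def add_nonneg_pos)
  ultimately obtain c where "c > 0" "\<And>p x y. c * dist x y \<le> dist (\<chi> i. \<phi> i p x) (\<chi> i. \<phi> i p y)"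
    using expansive_if_det_bounded_below[of "\<lambda>p x. \<chi> i. \<phi> i p x" J \<delta> C "N * (N * (N * C)) + 1"] \<delta>(1)
    by metis
  then show ?thesis by blast
qed

text \<open>The Jacobian of the x-gradient as a function of \<theta> is the mixed Hessian, by
  symmetry of the derivatives; that of the \<theta>-gradient as a function of x is its transpose. So
  one determinant bound yields both expansions.\<close>

lemma nondegenerate_phaseI:
  fixes S :: "(real^'n) \<times> (real^'n) \<Rightarrow> real"
  assumes sm: "smooth_on UNIV S"
    and bd: "\<And>ls. set ls \<subseteq> Basis \<Longrightarrow> 2 \<le> length ls \<Longrightarrow> \<exists>C. \<forall>z. norm (pds ls S z) \<le> C"
    and \<delta>: "\<delta> > 0" "\<And>z. \<delta> \<le> \<bar>det (mixed_hessian S z)\<bar>"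
  shows "nondegenerate_phase S"
proof -
  \<comment> \<open>Second derivatives bound the entries of the Jacobians, third derivatives their
    variation.\<close>
  let ?L = "{ls :: ((real^'n) \<times> (real^'n)) list. set ls \<subseteq> Basis \<and> length ls \<le> 3} \<inter> {ls. 2 \<le> length ls}"
  have "finite {ls :: ((real^'n) \<times> (real^'n)) list. set ls \<subseteq> Basis \<and> length ls \<le> 3}"
    by (rule finite_lists_length_le) simp
  then have "\<exists>C\<ge>0. \<forall>ls\<in>?L. \<forall>z. norm (pds ls S z) \<le> C * 1"
    using bd by (intro finite_uniform_bound) auto
  then obtain C where C': "\<forall>ls\<in>?L. \<forall>z. norm (pds ls S z) \<le> C * 1" by blast
  have C: "norm (pds ls S z) \<le> C" if "ls \<in> ?L" for ls z
    using C' that unfolding mult_1_right by blast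
  have B: "(b, 0) \<in> (Basis :: ((real^'n) \<times> (real^'n)) set)" "(0, b) \<in> (Basis :: ((real^'n) \<times> (real^'n)) set)"
    if "b \<in> Basis" for b :: "real^'n"
    using that by (auto simp: Basis_prod_def)
  have ax: "axis i (1::real) \<in> Basis" for i :: 'n by (simp add: axis_in_Basis_iff)
  have C2: "\<bar>partial_deriv b (partial_deriv b' S) z\<bar> \<le> C" if "b \<in> Basis" "b' \<in> Basis" for b b' z
    using C[of "[b, b']" z] that by simp
  have C3: "\<bar>partial_deriv b (partial_deriv b' (partial_deriv b'' S)) z\<bar> \<le> C" if "b \<in> Basis" "b' \<in> Basis" "b'' \<in> Basis" for b b' b'' z
    using C[of "[b, b', b'']" z] that by simp
  have pf: "partial_deriv b (\<lambda>x. G (x, p)) = (\<lambda>x. partial_deriv (b, 0) G (x, p))"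
    and ps: "partial_deriv b (\<lambda>\<theta>. G (p, \<theta>)) = (\<lambda>\<theta>. partial_deriv (0, b) G (p, \<theta>))"
    for b p and G :: "(real^'n) \<times> (real^'n) \<Rightarrow> real"
    by (simp_all add: partial_deriv_def fun_eq_iff)
  have g1: "grad1 S z = (\<chi> i. partial_deriv (axis i 1, 0) S z)" and g2: "grad2 S z = (\<chi> i. partial_deriv (0, axis i 1) S z)" for z
    by (simp_all add: grad1_def grad2_def sum_Basis_vec vec_eq_iff axis_def if_distrib sum.delta cong: if_cong)
  have "\<exists>c>0. \<forall>p x y. c * dist x y \<le> dist (\<chi> i. partial_deriv (axis i 1, 0) S (p, x)) (\<chi> i. partial_deriv (axis i 1, 0) S (p, y))"
  proof (rule gradient_expansive[where C = C and \<delta> = \<delta>])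
    show "smooth_on UNIV (\<lambda>\<theta>. partial_deriv (axis i 1, 0) S (p, \<theta>))" for i p
      by (intro smooth_on_slice(2) smooth_on_partial_deriv sm B ax)
    show "\<bar>partial_deriv (axis j 1) (\<lambda>\<theta>. partial_deriv (axis i 1, 0) S (p, \<theta>)) x\<bar> \<le> C" for i j p x
      unfolding ps by (intro C2 B ax)
    show "\<bar>partial_deriv b (partial_deriv (axis j 1) (\<lambda>\<theta>. partial_deriv (axis i 1, 0) S (p, \<theta>))) x\<bar> \<le> C"
      if "b \<in> Basis" for i j b p x
      unfolding ps by (intro C3 B ax that)
    show "\<delta> \<le> \<bar>det (\<chi> i j. partial_deriv (axis j 1) (\<lambda>\<theta>. partial_deriv (axis i 1, 0) S (p, \<theta>)) x)\<bar>" for p x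
    proof -
      have "(\<chi> i j. partial_deriv (axis j 1) (\<lambda>\<theta>. partial_deriv (axis i 1, 0) S (p, \<theta>)) x) = mixed_hessian S (p, x)"
        unfolding mixed_hessian_def ps using partial_deriv_commute[OF sm B(2)[OF ax] B(1)[OF ax]] by simp
      then show ?thesis using \<delta>(2) by simp
    qed
  qed (rule \<delta>)
  moreover have "\<exists>c>0. \<forall>p x y. c * dist x y \<le> dist (\<chi> i. partial_deriv (0, axis i 1) S (x, p)) (\<chi> i. partial_deriv (0, axis i 1) S (y, p))"
  proof (rule gradient_expansive[where C = C and \<delta> = \<delta>])
    show "smooth_on UNIV (\<lambda>x. partial_deriv (0, axis i 1) S (x, p))" for i p
      by (intro smooth_on_slice(1) smooth_on_partial_deriv sm B ax)
    show "\<bar>partial_deriv (axis j 1) (\<lambda>x. partial_deriv (0, axis i 1) S (x, p)) x\<bar> \<le> C" for i j p x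
      unfolding pf by (intro C2 B ax)
    show "\<bar>partial_deriv b (partial_deriv (axis j 1) (\<lambda>x. partial_deriv (0, axis i 1) S (x, p))) x\<bar> \<le> C"
      if "b \<in> Basis" for i j b p x
      unfolding pf by (intro C3 B ax that)
    show "\<delta> \<le> \<bar>det (\<chi> i j. partial_deriv (axis j 1) (\<lambda>x. partial_deriv (0, axis i 1) S (x, p)) x)\<bar>" for p x
    proof -
      have "(\<chi> i j. partial_deriv (axis j 1) (\<lambda>x. partial_deriv (0, axis i 1) S (x, p)) x) = transpose (mixed_hessian S (x, p))"
        unfolding mixed_hessian_def pf transpose_def by simp
      then show ?thesis using \<delta>(2) by simp
    qed
  qed (rule \<delta>)
  ultimately show ?thesis
    unfolding nondegenerate_phase_def g1 g2 using sm bd by blast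
qed

section \<open>Assembling the operator\<close>

lemma bounded_operator_compose: "bounded_operator T \<Longrightarrow> bounded_operator U \<Longrightarrow> bounded_operator (\<lambda>F. T (U F))"
  by (simp add: bounded_operator_def bounded_linear_compose)

lemma compact_operator_compose:
  assumes T: "compact_operator T" and U: "bounded_operator U"
  shows "compact_operator (\<lambda>F. T (U F))"
  unfolding compact_operator_def
proof (intro conjI allI impI)
  show "bounded_operator (\<lambda>F. T (U F))"
    by (rule bounded_operator_compose[OF _ U]) (use T in \<open>simp add: compact_operator_def\<close>)
  fix B :: "'a L2 set" assume "bounded B"
  then have "bounded (U ` B)" using U by (intro bounded_linear_image) (auto simp: bounded_operator_def)
  then have "compact (closure (T ` U ` B))" using T by (simp add: compact_operator_def)
  then show "compact (closure ((\<lambda>F. T (U F)) ` B))" by (simp add: image_image)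
qed

lemma kernel_bound_mono: "kernel_bound k K \<Longrightarrow> K \<le> K' \<Longrightarrow> kernel_bound k K'"
  unfolding kernel_bound_def by (meson l2n_nonneg mult_right_mono order_trans)

lemma symbol_pds_bound:
  fixes a :: "'a::euclidean_space \<Rightarrow> complex"
  assumes m: "tempered_weight m" and a: "a \<in> symbol_class m 0 UNIV"
  shows "\<exists>A\<ge>0. \<forall>ls z. set ls \<subseteq> Basis \<longrightarrow> length ls \<le> n \<longrightarrow> norm (pds ls a z) \<le> A * m z"
proof -
  have sm: "smooth_on UNIV a" using a by (simp add: symbol_class_def)
  have "\<exists>A\<ge>0. \<forall>ls\<in>{ls. set ls \<subseteq> Basis \<and> length ls \<le> n}. \<forall>z. norm (pds ls a z) \<le> A * m z"
  proof (rule finite_uniform_bound)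
    show "finite {ls::'a list. set ls \<subseteq> Basis \<and> length ls \<le> n}" by (rule finite_lists_length_le) simp
    show "0 \<le> m z" for z using m unfolding tempered_weight_def by blast
    fix ls :: "'a list" assume ls: "ls \<in> {ls. set ls \<subseteq> Basis \<and> length ls \<le> n}"
    have "\<exists>C>0. \<forall>z. norm (mderiv (count_list ls) a z) \<le> C * m z * lam z powr (- 0 * real (mi_order (count_list ls)))"
      using a unfolding symbol_class_def by blast
    \<comment> \<open>\<open>powr\<close> takes the default value 0 at base 0, so the factor with
      exponent 0 equals 1 only for a nonzero base.\<close>
    moreover have "lam z \<noteq> 0" for z :: 'a using lam_ge_1[of z] by linarith
    ultimately show "\<exists>C. \<forall>z. norm (pds ls a z) \<le> C * m z"
      using ls by (auto simp: pds_eq_mderiv[OF sm])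
  qed
  then show ?thesis by blast
qed

lemma fourier_integral_op_eq_kop:
  fixes S :: "'a::euclidean_space \<times> 'a \<Rightarrow> real"
  assumes "continuous_on UNIV S" "continuous_on UNIV a" "fourier u \<in> L12"
  shows "fourier_integral_op S a u = kop (\<lambda>z. cis (S z) * ((1 / (2 * pi) ^ DIM('a)) *\<^sub>R a z)) (fourier u)"
proof
  fix x
  have [measurable]: "(\<lambda>\<theta>. exp (\<i> * of_real (S (x, \<theta>))) * a (x, \<theta>)) \<in> borel_measurable borel"
    by (intro borel_measurable_continuous_onI continuous_intros continuous_on_compose2[OF assms(1)] continuous_on_compose2[OF assms(2)]) auto
  have [measurable]: "fourier u \<in> borel_measurable borel" using assms(3) by (simp add: L12_def)
  have m: "(\<lambda>\<theta>. exp (\<i> * of_real (S (x, \<theta>))) * a (x, \<theta>) * fourier u \<theta>) \<in> borel_measurable lborel"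
    by measurable
  show "fourier_integral_op S a u x = kop (\<lambda>z. cis (S z) * ((1 / (2 * pi) ^ DIM('a)) *\<^sub>R a z)) (fourier u) x"
    unfolding fourier_integral_op_def kop_def integral_completion[OF m] integral_scaleR_right[symmetric]
    by (intro Bochner_Integration.integral_cong refl) (simp add: cis_conv_exp)
qed

text \<open>T is the operator with kernel e^{iS} a, the normalising factor included, and U extends
  the Fourier transform. T is exposed together with its kernel formula and norm bound because
  compactness is proved for T and then inherited by the composition.\<close>

lemma extension_of_fourier_integral_op:
  fixes S :: "'a::euclidean_space \<times> 'a \<Rightarrow> real"
  assumes S: "continuous_on UNIV S" and a: "continuous_on UNIV a"
    and k: "kernel_bound (\<lambda>z. cis (S z) * ((1 / (2 * pi) ^ DIM('a)) *\<^sub>R a z)) K"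
  shows "\<exists>T U. bounded_operator T \<and> bounded_operator U \<and> (\<forall>F. norm (T F) \<le> K * norm F) \<and>
    (\<forall>v\<in>L12. T (L2_class v) = L2_class (kop (\<lambda>z. cis (S z) * ((1 / (2 * pi) ^ DIM('a)) *\<^sub>R a z)) v)) \<and>
    extends_from_schwartz (fourier_integral_op S a) (\<lambda>F. T (U F))"
proof -
  let ?k = "\<lambda>z. cis (S z) * ((1 / (2 * pi) ^ DIM('a)) *\<^sub>R a z)"
  obtain T where T: "bounded_operator T" "\<And>F. norm (T F) \<le> K * norm F" "\<And>v. v \<in> L12 \<Longrightarrow> T (L2_class v) = L2_class (kop ?k v)"
    by (rule kernel_bound_imp_operator[OF k]) blast
  obtain C where C: "kernel_bound (\<lambda>z::'a \<times> 'a. cis (fourier_phase z)) C" by (rule bounded_fourier_kernel)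
  obtain U where U: "bounded_operator U" "\<And>v::'a \<Rightarrow> complex. v \<in> L12 \<Longrightarrow> U (L2_class v) = L2_class (kop (\<lambda>z. cis (fourier_phase z)) v)"
    by (rule kernel_bound_imp_operator[OF C]) blast
  have "extends_from_schwartz (fourier_integral_op S a) (\<lambda>F. T (U F))"
    unfolding extends_from_schwartz_def
  proof (intro ballI conjI)
    fix u :: "'a \<Rightarrow> complex" assume u: "u \<in> schwartz"
    have uL: "u \<in> L12" by (rule schwartz_L12[OF u])
    have fL: "fourier u \<in> L12" by (rule fourier_schwartz_L12[OF u])
    have eq: "fourier_integral_op S a u = kop ?k (fourier u)" by (rule fourier_integral_op_eq_kop[OF S a fL])
    show "square_integrable u" using uL sq_int_iff[of u] by (simp add: L12_def)
    show "square_integrable (fourier_integral_op S a u)"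
      using k fL sq_int_iff[of "kop ?k (fourier u)"] unfolding eq by (simp add: kernel_bound_def)
    have "fourier u = kop (\<lambda>z. cis (fourier_phase z)) u"
      using uL by (intro fourier_eq_kop) (simp add: L12_def)
    then show "T (U (L2_class u)) = L2_class (fourier_integral_op S a u)"
      unfolding eq U(2)[OF uL] using T(3)[OF fL] by simp
  qed
  with T U(1) show ?thesis by blast
qed

theorem corollary4p2:
  fixes m :: "(real^'n) \<times> (real^'n) \<Rightarrow> real"
    and a :: "(real^'n) \<times> (real^'n) \<Rightarrow> complex"
    and S :: "(real^'n) \<times> (real^'n) \<Rightarrow> real"
  assumes m: "tempered_weight m"
    and a: "a \<in> symbol_class m 0 UNIV"
    and G1: "smooth_on UNIV S"
    and G2: "\<exists>\<delta>>0. (INF z. \<bar>det (mixed_hessian S z)\<bar>) \<ge> \<delta>"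
    and G3: "\<forall>\<alpha> \<beta>. \<exists>C>0. \<forall>z.
      \<bar>mderiv_fst \<alpha> (mderiv_snd \<beta> S) z\<bar>
        \<le> C * lam z powi (2 - int (mi_order \<alpha>) - int (mi_order \<beta>))"
  shows "(bounded (range m) \<longrightarrow>
            (\<exists>T. bounded_operator T \<and> extends_from_schwartz (fourier_integral_op S a) T)) \<and>
         ((m \<longlongrightarrow> 0) (filtercomap (\<lambda>(x, \<theta>). norm x + norm \<theta>) at_top) \<longrightarrow>
            (\<exists>T. compact_operator T \<and> extends_from_schwartz (fourier_integral_op S a) T))"
proof -
  have m0: "0 \<le> m z" for z using m unfolding tempered_weight_def by blast
  have sma: "smooth_on UNIV a" using a by (simp add: symbol_class_def)
  note contS = smooth_on_imp_continuous[OF G1] and conta = smooth_on_imp_continuous[OF sma]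
  have phase: "nondegenerate_phase S"
  proof -
    obtain \<delta> where \<delta>: "\<delta> > 0" "(INF z. \<bar>det (mixed_hessian S z)\<bar>) \<ge> \<delta>" using G2 by blast
    have "\<delta> \<le> \<bar>det (mixed_hessian S z)\<bar>" for z
      by (rule order_trans[OF \<delta>(2) cINF_lower]) (auto intro!: bdd_belowI[of _ 0])
    moreover have "\<exists>C. \<forall>z. norm (pds ls S z) \<le> C" if ls: "set ls \<subseteq> Basis" "2 \<le> length ls" for ls
    proof -
      obtain \<alpha> \<beta> where ab: "pds ls S = mderiv_fst \<alpha> (mderiv_snd \<beta> S)" "mi_order \<alpha> + mi_order \<beta> = length ls"
        using pds_eq_mderiv_fst_snd[OF G1 ls(1)] .
      obtain C where C: "C > 0" "\<And>z. \<bar>mderiv_fst \<alpha> (mderiv_snd \<beta> S) z\<bar> \<le> C * lam z powi (2 - int (mi_order \<alpha>) - int (mi_order \<beta>))"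
        using G3 by blast
      \<comment> \<open>For derivatives of order at least two the exponent in (G3) is not positive,
        so the weight is at most 1.\<close>
      have e: "2 - int (mi_order \<alpha>) - int (mi_order \<beta>) = - int (length ls - 2)" using ab(2) ls(2) by simp
      have "lam z powi (2 - int (mi_order \<alpha>) - int (mi_order \<beta>)) \<le> 1" for z :: "(real^'n) \<times> (real^'n)"
        unfolding e power_int_minus power_int_of_nat
        using one_le_power[OF lam_ge_1[of z], of "length ls - 2"] by (simp add: inverse_le_1_iff)
      then have "norm (pds ls S z) \<le> C" for z
        using order_trans[OF C(2) mult_left_mono[of _ 1 C]] C(1) by (simp add: ab(1))
      then show ?thesis by blast
    qed
    ultimately show ?thesis using nondegenerate_phaseI[OF G1 _ \<delta>(1)] by blast
  qed
  define \<kappa> where "\<kappa> = 1 / (2 * pi) ^ DIM(real^'n)"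
  \<comment> \<open>Scaling by a factor of modulus at most 1 preserves all derivative bounds of
    a.\<close>
  have \<kappa>: "\<bar>\<kappa>\<bar> \<le> 1"
    using one_le_power[of "2 * pi" "DIM(real^'n)"] pi_gt3 by (simp add: \<kappa>_def)
  define k where "k z = cis (S z) * (\<kappa> *\<^sub>R a z)" for z
  obtain A where A: "0 \<le> A" "\<And>ls z. set ls \<subseteq> Basis \<Longrightarrow> length ls \<le> DIM((real^'n) \<times> (real^'n)) \<Longrightarrow> norm (pds ls a z) \<le> A * m z"
    using symbol_pds_bound[OF m a] by blast
  obtain C where C: "0 \<le> C" "\<forall>a Q M. 0 \<le> M \<longrightarrow> continuous_on UNIV a \<longrightarrow> {z. vfloor z \<in> Q} \<in> sets borel \<longrightarrow>
      (\<forall>k. k \<in> lattice \<longrightarrow> k \<in> Q \<longrightarrow> deriv_bounded DIM((real^'n) \<times> (real^'n)) M (cbox k (k + One)) a) \<longrightarrow>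
      kernel_bound (\<lambda>z. of_bool (vfloor z \<in> Q) * (cis (S z) * a z)) (C * M)"
    using oscillatory_kernel_bound[OF phase] by blast
  \<comment> \<open>On a cube the derivatives of a are bounded by A times the supremum of m, so
    smallness of m on the cubes in Q becomes smallness of the operator.\<close>
  have kQ: "kernel_bound (\<lambda>z. of_bool (vfloor z \<in> Q) * k z) (C * (A * B))"
    if Q: "{z. vfloor z \<in> Q} \<in> sets borel" and B: "0 \<le> B"
      "\<And>i z. i \<in> lattice \<Longrightarrow> i \<in> Q \<Longrightarrow> z \<in> cbox i (i + One) \<Longrightarrow> m z \<le> B" for Q B
    unfolding k_def
  proof (rule C(2)[rule_format])
    show "0 \<le> A * B" using A B by simp
    show "continuous_on UNIV (\<lambda>z. \<kappa> *\<^sub>R a z)" by (intro continuous_intros conta)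
    show "deriv_bounded DIM((real^'n) \<times> (real^'n)) (A * B) (cbox i (i + One)) (\<lambda>z. \<kappa> *\<^sub>R a z)" if i: "i \<in> lattice" "i \<in> Q" for i
    proof (rule deriv_bounded_bounded_linear[where L = "\<lambda>w. \<kappa> *\<^sub>R w" and f = a])
      show "bounded_linear (\<lambda>w::complex. \<kappa> *\<^sub>R w)" by (rule bounded_linear_scaleR_right)
      show "norm (\<kappa> *\<^sub>R w) \<le> norm w" for w :: complex using mult_right_mono[OF \<kappa>, of "norm w"] by simp
      show "deriv_bounded DIM((real^'n) \<times> (real^'n)) (A * B) (cbox i (i + One)) a"
        using order_trans[OF A(2) mult_left_mono[OF B(2)[OF i] A(1)]] by (intro smooth_on_imp_deriv_bounded[OF sma])
    qed
  qed (rule Q)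
  have kB: "kernel_bound k (C * (A * B))" if "\<And>z. m z \<le> B" for B
    using kQ[of UNIV B] that order_trans[OF m0 that] by simp
  show ?thesis
  proof (intro conjI impI)
    assume "bounded (range m)"
    then obtain B where "\<And>z. \<bar>m z\<bar> \<le> B" by (auto simp: bounded_iff)
    then have "m z \<le> B" for z using abs_ge_self order_trans by blast
    from kB[OF this] have "kernel_bound (\<lambda>z. cis (S z) * (1 / (2 * pi) ^ DIM(real^'n)) *\<^sub>R a z) (C * (A * B))"
      by (simp only: k_def[abs_def] \<kappa>_def)
    from extension_of_fourier_integral_op[OF contS conta this] obtain T U where
      "bounded_operator T" "bounded_operator U" "extends_from_schwartz (fourier_integral_op S a) (\<lambda>F. T (U F))" by blast
    then show "\<exists>T. bounded_operator T \<and> extends_from_schwartz (fourier_integral_op S a) T"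
      using bounded_operator_compose by blast
  next
    assume lim: "(m \<longlongrightarrow> 0) (filtercomap (\<lambda>(x, \<theta>). norm x + norm \<theta>) at_top)"
    have small: "\<exists>R. \<forall>z. R \<le> norm z \<longrightarrow> m z < e" if "e > 0" for e
    proof -
      from tendstoD[OF lim that] obtain R where R: "\<And>z. R \<le> (case z of (x, \<theta>) \<Rightarrow> norm x + norm \<theta>) \<Longrightarrow> dist (m z) 0 < e"
        unfolding eventually_filtercomap_at_top_linorder by blast
      \<comment> \<open>The sum of the norms of x and \<theta> dominates the norm of the pair, so
        large norm of z suffices.\<close>
      have "m z < e" if "R \<le> norm z" for z
        using R[of z] that norm_triangle_ineq[of "(fst z, 0)" "(0, snd z)"] by (cases z) (auto simp: norm_Pair)
      then show ?thesis by blast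
    qed
    \<comment> \<open>A continuous weight that vanishes at infinity is bounded, so the bounded
      extension T U is available in this case as well.\<close>
    obtain R1 where R1: "\<And>z. R1 \<le> norm z \<Longrightarrow> m z < 1" using small[of 1] by auto
    have "continuous_on (cball 0 R1) m" using m by (auto simp: tempered_weight_def intro: continuous_on_subset)
    then have "bounded (m ` cball 0 R1)" by (intro compact_imp_bounded compact_continuous_image) auto
    then obtain B1 where "\<forall>y\<in>m ` cball 0 R1. norm y \<le> B1" unfolding bounded_iff by blast
    then have B1: "\<bar>m z\<bar> \<le> B1" if "norm z \<le> R1" for z using that by simp
    have mB: "m z \<le> max 1 B1" for z
      using R1[of z] B1[of z] by (cases "R1 \<le> norm z") auto
    let ?K = "C * (A * max 1 B1)"
    have kb: "kernel_bound k ?K" by (rule kB[OF mB])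
    obtain T U where TU': "bounded_operator T" "bounded_operator U" "\<forall>F. norm (T F) \<le> ?K * norm F"
      "\<forall>v\<in>L12. T (L2_class v) = L2_class (kop k v)" "extends_from_schwartz (fourier_integral_op S a) (\<lambda>F. T (U F))"
      using extension_of_fourier_integral_op[OF contS conta kb[unfolded k_def[abs_def] \<kappa>_def]]
      unfolding k_def[abs_def] \<kappa>_def by blast
    have TU: "\<And>F. norm (T F) \<le> ?K * norm F" "\<And>v. v \<in> L12 \<Longrightarrow> T (L2_class v) = L2_class (kop k v)"
      using TU'(3,4) by blast+
    have "compact_operator T"
    proof (rule compact_operator_if_small_outside_finite[OF kb _ _ TU'(1) TU])
      show "continuous_on UNIV k"
        unfolding k_def by (intro continuous_intros conta contS)
      fix e :: real assume e: "e > 0"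
      \<comment> \<open>Chosen so that \<open>C * (A * e1) \<le> e\<close>; the added 1 avoids
        division by zero.\<close>
      define e1 where "e1 = e / (C * A + 1)"
      have e1: "e1 > 0" "C * (A * e1) \<le> e"
      proof -
        have CA: "0 \<le> C * A" using A C by simp
        then show "e1 > 0" using e by (simp add: e1_def)
        have "e1 * (C * A + 1) = e" by (rule nonzero_eq_divide_eq[THEN iffD1, OF _ e1_def]) (use CA in simp)
        then show "C * (A * e1) \<le> e" using \<open>e1 > 0\<close> by (simp add: algebra_simps)
      qed
      obtain R where R: "\<And>z. R \<le> norm z \<Longrightarrow> m z < e1" using small[OF e1(1)] by blast
      \<comment> \<open>The added dimension bounds the distance from the corner to any point of a
        closed unit cube, so cubes with corner outside this ball lie where
        \<open>norm z \<ge> R\<close>.\<close>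
      define P where "P = lattice \<inter> cball (0 :: (real^'n) \<times> (real^'n)) (R + DIM((real^'n) \<times> (real^'n)))"
      have P: "finite P" "P \<subseteq> lattice" unfolding P_def by (auto intro: finite_lattice_bounded)
      have "kernel_bound (\<lambda>z. of_bool (vfloor z \<in> - P) * k z) (C * (A * e1))"
      proof (rule kQ)
        have "{z. vfloor z \<in> P} \<in> sets borel" by (rule vfloor_finite_measurable[OF P(1)])
        then have "- {z. vfloor z \<in> P} \<in> sets borel" by (rule borel_comp)
        then show "{z. vfloor z \<in> - P} \<in> sets borel" by (simp add: Compl_eq)
        fix i z assume i: "i \<in> lattice" "i \<in> - P" and z: "z \<in> cbox i (i + One)"
        have "R + DIM((real^'n) \<times> (real^'n)) < norm i" using i by (simp add: P_def)
        moreover have "norm i \<le> norm z + norm (z - i)" by (metis norm_minus_commute norm_triangle_sub)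
        ultimately have "R \<le> norm z" using norm_le_DIM_if_mem_unit_cbox[OF z] by linarith
        then show "m z \<le> e1" using R by (simp add: less_imp_le)
      qed (use e1 in simp)
      then have "kernel_bound (\<lambda>z. of_bool (vfloor z \<notin> P) * k z) (C * (A * e1))" by (simp only: Compl_iff)
      from kernel_bound_mono[OF this e1(2)] have "kernel_bound (\<lambda>z. of_bool (vfloor z \<notin> P) * k z) e" .
      with P show "\<exists>P. finite P \<and> P \<subseteq> lattice \<and> kernel_bound (\<lambda>z. of_bool (vfloor z \<notin> P) * k z) e" by blast
    qed
    then have "compact_operator (\<lambda>F. T (U F))" by (rule compact_operator_compose[OF _ TU'(2)])
    with TU'(5) show "\<exists>T. compact_operator T \<and> extends_from_schwartz (fourier_integral_op S a) T" by blast
  qed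
qed

end
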